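(* For every cuspidal function $m\in C^\infty(G)$ that has compact support modulo $Z(G)$, there exists a polynomial $\beta\in\mathbb{N}[t]$ such that for every $x\in G^{rss}$, setting $i_0=\beta(ov_{G^{rss}}(x))$, we have $\mathcal{A}_i(m)(x)=\mathcal{A}_{i_0}(m)(x)$ for every integer $i>i_0$.
   Context: $F$ is a non-Archimedean local field of arbitrary characteristic, $O_F$ its ring of integers, $\mathrm{val}$ the normalized valuation. $G=\mathrm{GL}_n(F)$, $Z(G)$ its center, $G^{ad}=G/Z(G)$. For $x\in G$, $ov_G(x)=\max\big(\max_{i,j}(-\mathrm{val}(x_{ij})),\mathrm{val}(\det x)\big)$, $G_i=\{x: ov_G(x)\le i\}$, $(G^{ad})_i$ its image in $G^{ad}$. $\Delta(x)$ is the discriminant of the characteristic polynomial, $G^{rss}=\{\Delta\ne0\}$, $ov_{G^{rss}}(x)=\max(ov_G(x),\mathrm{val}\Delta(x))$. $\mu_{G^{ad}}$ is the Haar measure on $G^{ad}$ (quotient of the Haar measure of $G$ giving $\mathrm{GL}_n(O_F)$ measure 1 by that of $Z(G)\cong F^\times$ giving $O_F^\times$ measure 1). For $f\in C^\infty(G)$, $\mathcal{A}_i(f)(x)=\int_{(G^{ad})_i}f(gxg^{-1})\,d\mu_{G^{ad}}(g)$. A function $f\in C^\infty(G)$ is cuspidal if for the unipotent radical $U$ of every proper parabolic subgroup of $G$ and every $x\in G$, the function $u\mapsto f(ux)$ on $U$ is compactly supported and has integral $0$ with respect to a Haar measure of $U$. *)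

theory Defs
  imports "HOL-Analysis.Analysis" "Jordan_Normal_Form.Char_Poly" "Subresultants.Resultant_Prelim"
begin

text \<open>The field is a type of class field; val is the normalized valuation on nonzero
  elements (its value at 0 is irrelevant: every use is guarded by nonvanishing).\<close>

definition vclose :: "('a::field \<Rightarrow> int) \<Rightarrow> int \<Rightarrow> 'a \<Rightarrow> 'a \<Rightarrow> bool" where
  "vclose val k x y \<longleftrightarrow> x = y \<or> val (x - y) \<ge> k"

definition integral_elt :: "('a::field \<Rightarrow> int) \<Rightarrow> 'a \<Rightarrow> bool" where
  "integral_elt val x \<longleftrightarrow> x = 0 \<or> val x \<ge> 0"

definition nonarch_local_field :: "('a::field \<Rightarrow> int) \<Rightarrow> bool" where
  "nonarch_local_field val \<longleftrightarrow>
     (\<forall>x y. x \<noteq> 0 \<longrightarrow> y \<noteq> 0 \<longrightarrow> val (x * y) = val x + val y) \<and>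
     (\<forall>x y. x \<noteq> 0 \<longrightarrow> y \<noteq> 0 \<longrightarrow> x + y \<noteq> 0 \<longrightarrow> val (x + y) \<ge> min (val x) (val y)) \<and>
     (\<exists>\<pi>. \<pi> \<noteq> 0 \<and> val \<pi> = 1) \<and>
     \<comment> \<open>complete with respect to the valuation\<close>
     (\<forall>s :: nat \<Rightarrow> 'a.
        (\<forall>k. \<exists>N. \<forall>p\<ge>N. \<forall>q\<ge>N. vclose val k (s p) (s q)) \<longrightarrow>
        (\<exists>l. \<forall>k. \<exists>N. \<forall>p\<ge>N. vclose val k (s p) l)) \<and>
     \<comment> \<open>finite residue field O/m\<close>
     finite ((\<lambda>x. {y. integral_elt val y \<and> vclose val 1 x y}) ` {x. integral_elt val x})"

definition Ftop :: "('a::field \<Rightarrow> int) \<Rightarrow> 'a topology" where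
  "Ftop val = topology (\<lambda>U. \<forall>x\<in>U. \<exists>k. {y. vclose val k y x} \<subseteq> U)"

definition mbox :: "('a::field \<Rightarrow> int) \<Rightarrow> nat \<Rightarrow> 'a mat \<Rightarrow> int \<Rightarrow> 'a mat set" where
  "mbox val n x k = {y \<in> carrier_mat n n. \<forall>i<n. \<forall>j<n. vclose val k (y $$ (i,j)) (x $$ (i,j))}"

definition Mtop :: "('a::field \<Rightarrow> int) \<Rightarrow> nat \<Rightarrow> 'a mat topology" where
  "Mtop val n = topology (\<lambda>U. \<forall>x\<in>U. x \<in> carrier_mat n n \<and> (\<exists>k. mbox val n x k \<subseteq> U))"

definition borel_sets :: "'b topology \<Rightarrow> 'b set set" where
  "borel_sets T = sigma_sets (topspace T) (Collect (openin T))"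

definition GL :: "nat \<Rightarrow> 'a::field mat set" where
  "GL n = {x \<in> carrier_mat n n. det x \<noteq> 0}"

definition GL_O :: "('a::field \<Rightarrow> int) \<Rightarrow> nat \<Rightarrow> 'a mat set" where
  "GL_O val n = {x \<in> GL n. (\<forall>i<n. \<forall>j<n. integral_elt val (x $$ (i,j))) \<and> val (det x) = 0}"

definition minv :: "nat \<Rightarrow> 'a::field mat \<Rightarrow> 'a mat" where
  "minv n g = (SOME h. h \<in> carrier_mat n n \<and> g * h = 1\<^sub>m n \<and> h * g = 1\<^sub>m n)"

definition ov_G :: "('a::field \<Rightarrow> int) \<Rightarrow> nat \<Rightarrow> 'a mat \<Rightarrow> int" where
  "ov_G val n x = max (Max {- val (x $$ (i,j)) | i j. i < n \<and> j < n \<and> x $$ (i,j) \<noteq> 0})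
                      (val (det x))"

definition G_le :: "('a::field \<Rightarrow> int) \<Rightarrow> nat \<Rightarrow> int \<Rightarrow> 'a mat set" where
  "G_le val n i = {x \<in> GL n. ov_G val n x \<le> i}"

definition discr :: "'a::field poly \<Rightarrow> 'a" where
  "discr p = (-1) ^ (degree p * (degree p - 1) div 2) * resultant p (pderiv p) / lead_coeff p"

definition Delta :: "'a::field mat \<Rightarrow> 'a" where
  "Delta x = discr (char_poly x)"

definition G_rss :: "nat \<Rightarrow> 'a::field mat set" where
  "G_rss n = {x \<in> GL n. Delta x \<noteq> 0}"

definition ov_rss :: "('a::field \<Rightarrow> int) \<Rightarrow> nat \<Rightarrow> 'a mat \<Rightarrow> int" where
  "ov_rss val n x = max (ov_G val n x) (val (Delta x))"

definition zcoset :: "'a::field mat \<Rightarrow> 'a mat set" where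
  "zcoset g = {c \<cdot>\<^sub>m g | c. c \<noteq> 0}"

definition Gad :: "nat \<Rightarrow> 'a::field mat set set" where
  "Gad n = zcoset ` GL n"

definition Gad_le :: "('a::field \<Rightarrow> int) \<Rightarrow> nat \<Rightarrow> int \<Rightarrow> 'a mat set set" where
  "Gad_le val n i = zcoset ` G_le val n i"

definition rep :: "'a mat set \<Rightarrow> 'a mat" where
  "rep c = (SOME g. g \<in> c)"

definition haar_on :: "('a::field \<Rightarrow> int) \<Rightarrow> nat \<Rightarrow> 'a mat set \<Rightarrow> 'a mat measure \<Rightarrow> bool" where
  "haar_on val n H \<nu> \<longleftrightarrow>
     space \<nu> = H \<and> sets \<nu> = borel_sets (subtopology (Mtop val n) H) \<and>
     (\<forall>h\<in>H. \<forall>A\<in>sets \<nu>. emeasure \<nu> ((\<lambda>y. h * y) ` A) = emeasure \<nu> A) \<and>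
     (\<forall>C. compactin (subtopology (Mtop val n) H) C \<longrightarrow> emeasure \<nu> C < \<infinity>) \<and>
     emeasure \<nu> H > 0"

definition haar_G :: "('a::field \<Rightarrow> int) \<Rightarrow> nat \<Rightarrow> 'a mat measure \<Rightarrow> bool" where
  "haar_G val n \<mu> \<longleftrightarrow> haar_on val n (GL n) \<mu> \<and> emeasure \<mu> (GL_O val n) = 1"

text \<open>Haar measure of Z(G) = F^x (identified via c |-> c I), normalized by mu(O_F^x) = 1.\<close>
definition haar_Fx :: "('a::field \<Rightarrow> int) \<Rightarrow> 'a measure \<Rightarrow> bool" where
  "haar_Fx val \<mu> \<longleftrightarrow>
     space \<mu> = - {0} \<and> sets \<mu> = borel_sets (subtopology (Ftop val) (- {0})) \<and>
     (\<forall>c. c \<noteq> 0 \<longrightarrow> (\<forall>A\<in>sets \<mu>. emeasure \<mu> ((\<lambda>y. c * y) ` A) = emeasure \<mu> A)) \<and>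
     (\<forall>C. compactin (subtopology (Ftop val) (- {0})) C \<longrightarrow> emeasure \<mu> C < \<infinity>) \<and>
     emeasure \<mu> {c. c \<noteq> 0 \<and> val c = 0} = 1"

text \<open>The quotient Haar measure on G^ad = G/Z(G): the measure on the cosets
  satisfying the quotient integral formula
  mu_G(A) = int_{G^ad} int_{Z} 1_A(z g) dz d(gZ).\<close>
definition quotient_haar :: "('a::field \<Rightarrow> int) \<Rightarrow> nat \<Rightarrow> 'a mat measure \<Rightarrow> 'a measure
     \<Rightarrow> 'a mat set measure \<Rightarrow> bool" where
  "quotient_haar val n \<mu>G \<mu>Z \<mu>ad \<longleftrightarrow>
     space \<mu>ad = Gad n \<and> sets \<mu>ad = {S. S \<subseteq> Gad n \<and> \<Union>S \<in> sets \<mu>G} \<and>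
     (\<forall>A\<in>sets \<mu>G. emeasure \<mu>G A =
         (\<integral>\<^sup>+ c. (\<integral>\<^sup>+ z. indicator A (z \<cdot>\<^sub>m rep c) \<partial>\<mu>Z) \<partial>\<mu>ad))"

definition avg_op :: "('a::field \<Rightarrow> int) \<Rightarrow> nat \<Rightarrow> 'a mat set measure \<Rightarrow> int
     \<Rightarrow> ('a mat \<Rightarrow> complex) \<Rightarrow> 'a mat \<Rightarrow> complex" where
  "avg_op val n \<mu>ad i f x =
     (LINT c : Gad_le val n i | \<mu>ad. f (rep c * x * minv n (rep c)))"

definition smooth_fun :: "('a::field \<Rightarrow> int) \<Rightarrow> nat \<Rightarrow> ('a mat \<Rightarrow> complex) \<Rightarrow> bool" where
  "smooth_fun val n f \<longleftrightarrow>
     (\<forall>x\<in>GL n. \<exists>k. \<forall>y \<in> mbox val n x k \<inter> GL n. f y = f x)"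

definition compact_supp_mod_center :: "('a::field \<Rightarrow> int) \<Rightarrow> nat \<Rightarrow> ('a mat \<Rightarrow> complex) \<Rightarrow> bool" where
  "compact_supp_mod_center val n f \<longleftrightarrow>
     (\<exists>C. compactin (subtopology (Mtop val n) (GL n)) C \<and>
          (\<forall>x\<in>GL n. f x \<noteq> 0 \<longrightarrow> (\<exists>c. c \<noteq> 0 \<and> c \<cdot>\<^sub>m x \<in> C)))"

definition lsubspace :: "nat \<Rightarrow> 'a::field vec set \<Rightarrow> bool" where
  "lsubspace n V \<longleftrightarrow> V \<subseteq> carrier_vec n \<and> 0\<^sub>v n \<in> V \<and>
     (\<forall>v\<in>V. \<forall>w\<in>V. v + w \<in> V) \<and> (\<forall>c. \<forall>v\<in>V. c \<cdot>\<^sub>v v \<in> V)"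

text \<open>A proper parabolic subgroup of GL_n is the stabilizer of a nontrivial flag
  0 < V_1 < ... < V_k < F^n (k >= 1); we record the full chain including 0 and F^n.\<close>
definition flag_chain :: "nat \<Rightarrow> 'a::field vec set list \<Rightarrow> 'a vec set list" where
  "flag_chain n fl = [{0\<^sub>v n}] @ fl @ [carrier_vec n]"

definition proper_flag :: "nat \<Rightarrow> 'a::field vec set list \<Rightarrow> bool" where
  "proper_flag n fl \<longleftrightarrow> fl \<noteq> [] \<and> (\<forall>V \<in> set fl. lsubspace n V) \<and>
     sorted_wrt (\<subset>) (flag_chain n fl)"

text \<open>Unipotent radical of the parabolic subgroup stabilizing the flag: elements acting
  trivially on all successive quotients.\<close>
definition unip_radical :: "nat \<Rightarrow> 'a::field vec set list \<Rightarrow> 'a mat set" where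
  "unip_radical n fl = {g \<in> GL n. \<forall>j < length fl + 1.
      \<forall>v \<in> flag_chain n fl ! (j+1). g *\<^sub>v v - v \<in> flag_chain n fl ! j}"

definition cuspidal :: "('a::field \<Rightarrow> int) \<Rightarrow> nat \<Rightarrow> ('a mat \<Rightarrow> complex) \<Rightarrow> bool" where
  "cuspidal val n f \<longleftrightarrow>
     (\<forall>fl. proper_flag n fl \<longrightarrow> (\<forall>x\<in>GL n.
        (\<exists>C. compactin (subtopology (Mtop val n) (unip_radical n fl)) C \<and>
             (\<forall>u \<in> unip_radical n fl - C. f (u * x) = 0)) \<and>
        (\<forall>\<nu>. haar_on val n (unip_radical n fl) \<nu> \<longrightarrow>
             integrable \<nu> (\<lambda>u. f (u * x)) \<and> (LINT u|\<nu>. f (u * x)) = 0)))"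

end

theory Submission
  imports Defs
begin

text \<open>Fix \<open>x\<close> and let \<open>\<rho>\<close> bound \<open>ov(x)\<close> and \<open>val \<Delta>(x)\<close>. The shell \<open>G\<^sub>i - G\<^sub>i\<^sub>0\<close> modulo the centre is a
  finite union of cosets of a small congruence subgroup, so the difference of the two averages is a
  finite sum of values \<open>m(g x g\<inverse>)\<close>, and it suffices to group these values into vanishing sums.

  If no multiple of \<open>g\<close> lies in \<open>G\<^sub>i\<^sub>0\<close>, the Cartan decomposition has a large gap:
  \<open>g = k\<^sub>1 a k\<^sub>2\<close> with \<open>a\<close> strongly expanding the unipotent radical \<open>U\<close> of a maximal parabolic \<open>P\<close>. If
  \<open>m(g x g\<inverse>) \<noteq> 0\<close>, compactness of the support makes an off-diagonal block of \<open>y = k\<^sub>2 x k\<^sub>2\<inverse>\<close> tiny.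
  The Sylvester operator of the diagonal blocks is invertible with a loss controlled by
  \<open>val \<Delta>(x)\<close>, by Bezout and Taylor expansion of the characteristic polynomial. Hence Newton iteration
  replaces \<open>k\<^sub>2\<close> by some \<open>k\<^sub>3\<close> of bounded size with \<open>k\<^sub>3 x k\<^sub>3\<inverse> \<in> P\<close>, where the change
  is absorbed in \<open>k\<^sub>1\<close>.

  Now let \<open>u\<close> run over the small elements of \<open>k\<^sub>3\<inverse> U k\<^sub>3\<close>. Then \<open>g u x u\<inverse> g\<inverse> = v g x g\<inverse>\<close>,
  where \<open>u \<mapsto> v\<close> is injective, linear on Lie algebras and, thanks to the expansion by \<open>a\<close>, covers
  all \<open>v \<in> g k\<^sub>3\<inverse> U k\<^sub>3 g\<inverse>\<close> with \<open>m(v g x g\<inverse>) \<noteq> 0\<close>. So cuspidality makes the sum of \<open>m\<close> over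
  the \<open>g u\<close> vanish. The set of radicals available for \<open>g\<close> is unchanged by right
  multiplication with small elements; choosing one radical for each such set, the elements \<open>u\<close>
  permute the cosets with a given choice, and averaging over \<open>u\<close> kills their sum.\<close>

text \<open>The size of \<open>i0\<close> may depend neither on \<open>i\<close> nor on how finely
  \<open>m\<close> is locally constant along the orbit of \<open>x\<close>. So two scales are kept
  apart: the precision \<open>N\<close> that cuts the shell into cosets depends on \<open>i\<close>
  and \<open>x\<close> without control, whereas the elements used for cancelling live at a scale
  \<open>s\<close> which, like the gap \<open>M\<close>, is affine in \<open>\<rho>\<close>. Hence
  \<open>\<beta>\<close> has degree at most 1. Newton iteration does not act on the tiny block.
  Support considerations make the block of \<open>y\<close> in the direction of \<open>U\<close>
  tiny, but the correction is sought in the opposite radical, because conjugation by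
  \<open>a\<close> contracts only there; so a correction that is bounded, not small, can be moved
  into \<open>k1\<close>. The tiny block serves to make the quadratic term negligible. The
  characteristic is arbitrary, so there is no exponential map and no diagonalisation. For a maximal
  parabolic, products of two elements of the Lie algebra of \<open>U\<close> vanish, so
  \<open>X\<close> to \<open>1 + X\<close> is a homomorphism and Taylor expansions stop after the
  linear term. The integral condition in \<open>cuspidal\<close> ranges over all Haar measures of
  \<open>U\<close>; to use it, one must be constructed.\<close>

text \<open>Instantiated by the valuation on the field and by its Gauss extension to polynomials, so that
  the determinant estimates also apply to characteristic polynomials.\<close>

locale filtration =
  fixes B :: "int \<Rightarrow> 'r::comm_ring_1 \<Rightarrow> bool"
  assumes B_0: "B k 0"
    and B_1: "B 0 1"
    and B_add: "B k x \<Longrightarrow> B k y \<Longrightarrow> B k (x + y)"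
    and B_uminus: "B k x \<Longrightarrow> B k (- x)"
    and B_mult: "B k x \<Longrightarrow> B l y \<Longrightarrow> B (k + l) (x * y)"
    and B_mono: "B k x \<Longrightarrow> l \<le> k \<Longrightarrow> B l x"
begin

lemma B_diff: "B k x \<Longrightarrow> B k y \<Longrightarrow> B k (x - y)"
  using B_add[of k x "- y"] B_uminus[of k y] by simp

lemma B_sum: "(\<And>i. i \<in> S \<Longrightarrow> B k (f i)) \<Longrightarrow> B k (sum f S)"
  by (induction S rule: infinite_finite_induct) (auto simp: B_0 intro: B_add)

lemma B_prod: "finite S \<Longrightarrow> (\<And>i. i \<in> S \<Longrightarrow> B (- b) (f i)) \<Longrightarrow> B (- (int (card S) * b)) (prod f S)"
proof (induction S rule: finite_induct)
  case (insert x F)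
  have "B (- b + - (int (card F) * b)) (f x * prod f F)"
    using insert by (intro B_mult) auto
  then show ?case using insert by (simp add: algebra_simps)
qed (simp add: B_1)

lemma B_prod_diff:
  "finite S \<Longrightarrow> b \<ge> 0 \<Longrightarrow> (\<And>i. i \<in> S \<Longrightarrow> B (- b) (f i)) \<Longrightarrow> (\<And>i. i \<in> S \<Longrightarrow> B (- b) (g i)) \<Longrightarrow>
   (\<And>i. i \<in> S \<Longrightarrow> B s (f i - g i)) \<Longrightarrow> B (s - int (card S) * b) (prod f S - prod g S)"
proof (induction S rule: finite_induct)
  case (insert x F)
  have "B (s + - (int (card F) * b)) ((f x - g x) * prod f F)"
    using insert by (intro B_mult B_prod) auto
  then have 1: "B (s - int (card (insert x F)) * b) ((f x - g x) * prod f F)"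
    by (rule B_mono) (use insert in \<open>auto simp: algebra_simps\<close>)
  have "B (- b + (s - int (card F) * b)) (g x * (prod f F - prod g F))"
    using insert by (intro B_mult) auto
  then have 2: "B (s - int (card (insert x F)) * b) (g x * (prod f F - prod g F))"
    using insert by (simp add: algebra_simps)
  have "prod f (insert x F) - prod g (insert x F) = (f x - g x) * prod f F + g x * (prod f F - prod g F)"
    using insert by (simp add: algebra_simps)
  then show ?case using B_add[OF 1 2] by simp
qed (simp add: B_0)

lemma B_signof: "B k x \<Longrightarrow> B k (signof p * x)"
  by (cases "signof p = (1::'r)") (auto simp: sign_def B_uminus)

lemma B_det:
  assumes A: "A \<in> carrier_mat N N" and b: "\<And>i j. i < N \<Longrightarrow> j < N \<Longrightarrow> B (- b) (A $$ (i,j))"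
  shows "B (- (int N * b)) (det A)"
proof -
  have "B (- (int (card {0..<N}) * b)) (\<Prod>i = 0..<N. A $$ (i, p i))" if "p permutes {0..<N}" for p
    by (rule B_prod) (use that b in \<open>auto dest: permutes_in_image\<close>)
  then show ?thesis unfolding det_def'[OF A] by (intro B_sum B_signof) auto
qed

text \<open>Continuity of the determinant with an explicit modulus: in each product the factors are
  exchanged one at a time. Used for polynomial entries, it makes nearby matrices have nearby
  characteristic polynomials.\<close>

lemma B_det_diff:
  assumes A: "A \<in> carrier_mat N N" "A' \<in> carrier_mat N N" and b0: "b \<ge> 0"
    and b: "\<And>i j. i < N \<Longrightarrow> j < N \<Longrightarrow> B (- b) (A $$ (i,j))"
    "\<And>i j. i < N \<Longrightarrow> j < N \<Longrightarrow> B (- b) (A' $$ (i,j))"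
    and s: "\<And>i j. i < N \<Longrightarrow> j < N \<Longrightarrow> B s (A $$ (i,j) - A' $$ (i,j))"
  shows "B (s - int N * b) (det A - det A')"
proof -
  have "B (s - int (card {0..<N}) * b)
      ((\<Prod>i = 0..<N. A $$ (i, p i)) - (\<Prod>i = 0..<N. A' $$ (i, p i)))" if "p permutes {0..<N}" for p
    by (rule B_prod_diff) (use that b s b0 in \<open>auto dest: permutes_in_image\<close>)
  then show ?thesis
    unfolding det_def'[OF A(1)] det_def'[OF A(2)] sum_subtractf[symmetric] right_diff_distrib[symmetric]
    by (intro B_sum B_signof) auto
qed

lemma B_cofactor:
  assumes A: "A \<in> carrier_mat N N" and b: "\<And>i j. i < N \<Longrightarrow> j < N \<Longrightarrow> B (- b) (A $$ (i,j))"
    and ij: "i < N" "j < N"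
  shows "B (- (int (N - 1) * b)) (cofactor A i j)"
proof -
  have "mat_delete A i j \<in> carrier_mat (N - 1) (N - 1)" using A by (rule mat_delete_carrier)
  then have "B (- (int (N - 1) * b)) (det (mat_delete A i j))"
    by (rule B_det) (use A b in \<open>auto simp: mat_delete_def\<close>)
  moreover have "(-1) ^ (i + j) = (1::'r) \<or> (-1) ^ (i + j) = (-1::'r)"
    by (cases "even (i + j)") auto
  ultimately show ?thesis unfolding cofactor_def by (auto intro: B_uminus)
qed

end

section \<open>Valuations of field elements and of polynomials\<close>

locale local_field =
  fixes val :: "'a::field \<Rightarrow> int"
  assumes nalf: "nonarch_local_field val"
begin

lemma val_mult: "x \<noteq> 0 \<Longrightarrow> y \<noteq> 0 \<Longrightarrow> val (x * y) = val x + val y"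
  using nalf by (auto simp: nonarch_local_field_def)

lemma val_add: "x \<noteq> 0 \<Longrightarrow> y \<noteq> 0 \<Longrightarrow> x + y \<noteq> 0 \<Longrightarrow> val (x + y) \<ge> min (val x) (val y)"
  using nalf by (auto simp: nonarch_local_field_def)

lemma val_1: "val 1 = 0"
  using val_mult[of 1 1] by simp

lemma val_uminus: "val (- x) = val x"
proof (cases "x = 0")
  case False
  have "val (-1) + val (-1) = 0" using val_mult[of "-1" "-1"] val_1 by simp
  then show ?thesis using val_mult[of "-1" x] False by simp
qed simp

lemma val_inverse: "x \<noteq> 0 \<Longrightarrow> val (inverse x) = - val x"
  using val_mult[of x "inverse x"] val_1 by simp

lemma val_power: "x \<noteq> 0 \<Longrightarrow> val (x ^ k) = int k * val x"
  by (induction k) (auto simp: val_1 val_mult algebra_simps)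

text \<open>Encodes the convention that 0 has infinite valuation, since \<open>val 0\<close> carries
  no information.\<close>

definition vge :: "int \<Rightarrow> 'a \<Rightarrow> bool" where
  "vge k x \<longleftrightarrow> x = 0 \<or> val x \<ge> k"

lemma vclose_vge: "vclose val k x y \<longleftrightarrow> vge k (x - y)"
  by (auto simp: vclose_def vge_def)

lemma integral_elt_vge: "integral_elt val x \<longleftrightarrow> vge 0 x"
  by (auto simp: integral_elt_def vge_def)

sublocale vf: filtration vge
proof
  fix k l :: int and x y :: 'a
  show "vge k x \<Longrightarrow> vge k y \<Longrightarrow> vge k (x + y)"
    using val_add[of x y] by (cases "x = 0"; cases "y = 0"; cases "x + y = 0") (auto simp: vge_def)
  show "vge k x \<Longrightarrow> vge l y \<Longrightarrow> vge (k + l) (x * y)"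
    using val_mult[of x y] by (cases "x = 0"; cases "y = 0") (auto simp: vge_def)
qed (auto simp: vge_def val_1 val_uminus)

lemma vge_nonzero: "x \<noteq> 0 \<Longrightarrow> vge k x \<longleftrightarrow> val x \<ge> k"
  by (auto simp: vge_def)

text \<open>The isosceles property of an ultrametric: an error smaller than \<open>y\<close> cannot
  change its size. It makes elements of congruence subgroups invertible.\<close>

lemma val_eqI: "y \<noteq> 0 \<Longrightarrow> vge k (x - y) \<Longrightarrow> val y < k \<Longrightarrow> x \<noteq> 0 \<and> val x = val y"
proof -
  assume a: "y \<noteq> 0" "vge k (x - y)" "val y < k"
  have x0: "x \<noteq> 0" using a by (auto simp: vge_def val_uminus)
  have "vge (val y) x" using vf.B_add[of "val y" "x - y" y] a by (auto simp: vge_def)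
  moreover have "\<not> val x > val y"
  proof
    assume "val x > val y"
    have "vge (min k (val x)) x" "vge (min k (val x)) (x - y)"
      using a by (auto simp: vge_def)
    from vf.B_diff[OF this] show False using a \<open>val x > val y\<close> by (auto simp: vge_def min_def split: if_splits)
  qed
  ultimately show ?thesis using x0 by (auto simp: vge_def)
qed

definition upi :: 'a where "upi = (SOME p. p \<noteq> 0 \<and> val p = 1)"

lemma upi: "upi \<noteq> 0" "val upi = 1"
proof -
  have "\<exists>p. p \<noteq> 0 \<and> val p = 1" using nalf by (auto simp: nonarch_local_field_def)
  from someI_ex[OF this] show "upi \<noteq> 0" "val upi = 1" by (auto simp: upi_def)
qed

definition scal :: "int \<Rightarrow> 'a" where
  "scal k = (if k \<ge> 0 then upi ^ nat k else inverse upi ^ nat (- k))"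

lemma scal: "scal k \<noteq> 0" "val (scal k) = k"
  by (auto simp: scal_def upi val_power val_inverse)

lemma finite_reps_unit:
  obtains S where "finite S" "\<And>s. s \<in> S \<Longrightarrow> vge 0 s" "\<And>x. vge 0 x \<Longrightarrow> \<exists>s\<in>S. vge 1 (x - s)"
proof -
  let ?cl = "\<lambda>x. {y. integral_elt val y \<and> vclose val 1 x y}"
  have fin: "finite (?cl ` {x. integral_elt val x})"
    using nalf by (auto simp: nonarch_local_field_def)
  define S where "S = (\<lambda>C. SOME y. y \<in> C) ` (?cl ` {x. integral_elt val x})"
  have *: "(SOME y. y \<in> ?cl x) \<in> ?cl x" if "integral_elt val x" for x
    by (rule someI[of _ x]) (use that in \<open>auto simp: vclose_def\<close>)
  show ?thesis
  proof
    show "finite S" unfolding S_def using fin by blast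
    show "vge 0 s" if "s \<in> S" for s
      using that * by (auto simp: S_def integral_elt_vge)
    show "\<exists>s\<in>S. vge 1 (x - s)" if "vge 0 x" for x
    proof
      show "(SOME y. y \<in> ?cl x) \<in> S" unfolding S_def using that by (intro imageI) (simp add: integral_elt_vge)
      show "vge 1 (x - (SOME y. y \<in> ?cl x))" using * that by (auto simp: integral_elt_vge vclose_vge)
    qed
  qed
qed

lemma finite_reps_step:
  "\<exists>S. finite S \<and> (\<forall>s\<in>S. vge k s) \<and> (\<forall>x. vge k x \<longrightarrow> (\<exists>s\<in>S. vge (k + 1) (x - s)))"
proof -
  obtain S where S: "finite S" "\<And>s. s \<in> S \<Longrightarrow> vge 0 s" "\<And>x. vge 0 x \<Longrightarrow> \<exists>s\<in>S. vge 1 (x - s)"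
    using finite_reps_unit by blast
  have vs: "vge k (scal k)" "vge (- k) (inverse (scal k))"
    using scal[of k] by (auto simp: vge_def val_inverse)
  show ?thesis
  proof (intro exI[of _ "(\<lambda>y. scal k * y) ` S"] conjI ballI allI impI)
    show "finite ((\<lambda>y. scal k * y) ` S)" using S by auto
    show "vge k s" if "s \<in> (\<lambda>y. scal k * y) ` S" for s
      using that S(2) vf.B_mult[OF vs(1)] by fastforce
    show "\<exists>s\<in>(\<lambda>y. scal k * y) ` S. vge (k + 1) (x - s)" if "vge k x" for x
    proof -
      have "vge 0 (inverse (scal k) * x)" using vf.B_mult[OF vs(2) that] by simp
      then obtain s where s: "s \<in> S" "vge 1 (inverse (scal k) * x - s)" using S(3) by blast
      have "vge (k + 1) (scal k * (inverse (scal k) * x - s))" by (rule vf.B_mult[OF vs(1) s(2)])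
      moreover have "scal k * (inverse (scal k) * x - s) = x - scal k * s"
        using scal(1)[of k] by (simp add: field_simps)
      ultimately show ?thesis using s by auto
    qed
  qed
qed

lemma finite_reps:
  "\<exists>S. finite S \<and> (\<forall>s\<in>S. vge k s) \<and> (\<forall>x. vge k x \<longrightarrow> (\<exists>s\<in>S. vge (k + int d) (x - s)))"
proof (induction d)
  case 0
  show ?case by (rule exI[of _ "{0}"]) (auto simp: vf.B_0)
next
  case (Suc d)
  then obtain S where S: "finite S" "\<forall>s\<in>S. vge k s" "\<And>x. vge k x \<Longrightarrow> \<exists>s\<in>S. vge (k + int d) (x - s)"
    by blast
  obtain S' where S': "finite S'" "\<forall>s\<in>S'. vge (k + int d) s"
    "\<And>x. vge (k + int d) x \<Longrightarrow> \<exists>s\<in>S'. vge (k + int d + 1) (x - s)"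
    using finite_reps_step[of "k + int d"] by blast
  show ?case
  proof (intro exI[of _ "(\<lambda>(a,b). a + b) ` (S \<times> S')"] conjI ballI allI impI)
    show "finite ((\<lambda>(a,b). a + b) ` (S \<times> S'))" using S S' by auto
    show "vge k s" if "s \<in> (\<lambda>(a,b). a + b) ` (S \<times> S')" for s
      using that S(2) S'(2) by (auto intro!: vf.B_add intro: vf.B_mono)
    show "\<exists>s\<in>(\<lambda>(a,b). a + b) ` (S \<times> S'). vge (k + int (Suc d)) (x - s)" if x: "vge k x" for x
    proof -
      obtain s where s: "s \<in> S" "vge (k + int d) (x - s)" using S(3)[OF x] by blast
      obtain t where t: "t \<in> S'" "vge (k + int d + 1) (x - s - t)" using S'(3)[OF s(2)] by blast
      show ?thesis using s t by (intro bexI[of _ "s + t"]) (auto simp: algebra_simps)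
    qed
  qed
qed

text \<open>In an ultrametric the later errors do not accumulate, so the limit is as close to
  \<open>s l\<close> as the next term is. This is the form of completeness that the Newton iteration
  needs.\<close>

lemma vge_complete:
  assumes "\<And>l. vge (k + int l) (s (Suc l) - s l)"
  obtains x where "\<And>l. vge (k + int l) (x - s l)"
proof -
  have d: "vge (k + int l) (s p - s l)" if "p \<ge> l" for l p
    using that
  proof (induction p rule: dec_induct)
    case (step m)
    have "vge (k + int l) (s (Suc m) - s m)" using assms[of m] by (rule vf.B_mono) (use step in auto)
    from vf.B_add[OF this step.IH] show ?case by simp
  qed (auto simp: vf.B_0)
  have "\<exists>N. \<forall>p\<ge>N. \<forall>q\<ge>N. vclose val k' (s p) (s q)" for k'
  proof (rule exI[of _ "nat (k' - k)"], intro allI impI)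
    fix p q assume pq: "p \<ge> nat (k' - k)" "q \<ge> nat (k' - k)"
    let ?N = "nat (k' - k)"
    have "vge (k + int ?N) ((s p - s ?N) - (s q - s ?N))" by (rule vf.B_diff[OF d[OF pq(1)] d[OF pq(2)]])
    then have "vge (k + int ?N) (s p - s q)" by simp
    then show "vclose val k' (s p) (s q)" unfolding vclose_vge by (rule vf.B_mono) auto
  qed
  moreover have "\<forall>s :: nat \<Rightarrow> 'a. (\<forall>k. \<exists>N. \<forall>p\<ge>N. \<forall>q\<ge>N. vclose val k (s p) (s q)) \<longrightarrow>
        (\<exists>l. \<forall>k. \<exists>N. \<forall>p\<ge>N. vclose val k (s p) l)"
    using nalf unfolding nonarch_local_field_def by (elim conjE)
  ultimately have "\<exists>l. \<forall>k. \<exists>N. \<forall>p\<ge>N. vclose val k (s p) l" by simp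
  then obtain x where x: "\<And>k'. \<exists>N. \<forall>p\<ge>N. vclose val k' (s p) x" by blast
  show ?thesis
  proof
    fix l
    obtain N where N: "\<And>p. p \<ge> N \<Longrightarrow> vge (k + int l) (s p - x)"
      using x[of "k + int l"] by (auto simp: vclose_vge)
    have "vge (k + int l) (s (max N l) - s l)" "vge (k + int l) (s (max N l) - x)"
      using d[of l "max N l"] N[of "max N l"] by auto
    from vf.B_diff[OF this] show "vge (k + int l) (x - s l)" by simp
  qed
qed

definition pge :: "int \<Rightarrow> 'a poly \<Rightarrow> bool" where
  "pge k p \<longleftrightarrow> (\<forall>i. vge k (coeff p i))"

sublocale pf: filtration pge
proof
  fix k l :: int and x y :: "'a poly"
  show "pge k x \<Longrightarrow> pge l y \<Longrightarrow> pge (k + l) (x * y)"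
    unfolding pge_def coeff_mult by (intro allI vf.B_sum vf.B_mult) auto
  show "pge 0 1" by (auto simp: pge_def coeff_1 vf.B_0 vf.B_1)
qed (auto simp: pge_def vf.B_0 intro: vf.B_add vf.B_uminus vf.B_mono)

lemma pge_pCons: "pge k (pCons c p) \<longleftrightarrow> vge k c \<and> pge k p"
  unfolding pge_def by (auto simp: coeff_pCons split: nat.splits)

text \<open>Integers are integral in every characteristic; this keeps the coefficients of a
  derivative under control.\<close>

lemma vge_of_nat: "vge 0 (of_nat k)"
  by (induction k) (auto simp: vf.B_0 intro: vf.B_add vf.B_1)

lemma pge_pderiv: "pge k p \<Longrightarrow> pge k (pderiv p)"
  unfolding pge_def coeff_pderiv using vf.B_mult[OF vge_of_nat, of k] by (simp del: of_nat_Suc)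

end

section \<open>Matrices over the field\<close>

locale gl = local_field val for val :: "'a::field \<Rightarrow> int" +
  fixes n :: nat
  assumes n_pos: "n \<ge> 1"
begin

abbreviation Mn :: "'a mat set" where "Mn \<equiv> carrier_mat n n"

abbreviation Gn :: "'a mat set" where "Gn \<equiv> GL n"

abbreviation One :: "'a mat" where "One \<equiv> 1\<^sub>m n"

abbreviation Zero :: "'a mat" where "Zero \<equiv> 0\<^sub>m n n"

text \<open>A copy of the entry function that the simplifier does not expand on products. With
  \<open>msimps\<close>, a matrix identity is normalised into words whose entries are atoms, so
  noncommutative identities reduce to linear ones in the field.\<close>

definition ent :: "nat \<Rightarrow> nat \<Rightarrow> 'a mat \<Rightarrow> 'a" where "ent i j A = A $$ (i,j)"

lemma ent_eqI: "A \<in> Mn \<Longrightarrow> B \<in> Mn \<Longrightarrow> (\<And>i j. i < n \<Longrightarrow> j < n \<Longrightarrow> ent i j A = ent i j B) \<Longrightarrow> A = B"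
  by (auto simp: ent_def)

lemma mcarr:
  "A \<in> Mn \<Longrightarrow> B \<in> Mn \<Longrightarrow> A * B \<in> Mn"
  "A \<in> Mn \<Longrightarrow> B \<in> Mn \<Longrightarrow> A + B \<in> Mn"
  "A \<in> Mn \<Longrightarrow> B \<in> Mn \<Longrightarrow> A - B \<in> Mn"
  "A \<in> Mn \<Longrightarrow> - A \<in> Mn"
  "A \<in> Mn \<Longrightarrow> c \<cdot>\<^sub>m A \<in> Mn"
  "One \<in> Mn" "Zero \<in> Mn"
  by auto

lemma massoc: "A \<in> Mn \<Longrightarrow> B \<in> Mn \<Longrightarrow> C \<in> Mn \<Longrightarrow> A * B * C = A * (B * C)"
  by (rule assoc_mult_mat)

lemma mring:
  "A \<in> Mn \<Longrightarrow> B \<in> Mn \<Longrightarrow> C \<in> Mn \<Longrightarrow> A * B * C = A * (B * C)"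
  "A \<in> Mn \<Longrightarrow> B \<in> Mn \<Longrightarrow> C \<in> Mn \<Longrightarrow> (A + B) * C = A * C + B * C"
  "A \<in> Mn \<Longrightarrow> B \<in> Mn \<Longrightarrow> C \<in> Mn \<Longrightarrow> A * (B + C) = A * B + A * C"
  "A \<in> Mn \<Longrightarrow> B \<in> Mn \<Longrightarrow> C \<in> Mn \<Longrightarrow> (A - B) * C = A * C - B * C"
  "A \<in> Mn \<Longrightarrow> B \<in> Mn \<Longrightarrow> C \<in> Mn \<Longrightarrow> A * (B - C) = A * B - A * C"
  "A \<in> Mn \<Longrightarrow> B \<in> Mn \<Longrightarrow> (c \<cdot>\<^sub>m A) * B = c \<cdot>\<^sub>m (A * B)"
  "A \<in> Mn \<Longrightarrow> B \<in> Mn \<Longrightarrow> A * (c \<cdot>\<^sub>m B) = c \<cdot>\<^sub>m (A * B)"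
  "A \<in> Mn \<Longrightarrow> B \<in> Mn \<Longrightarrow> (- A) * B = - (A * B)"
  "A \<in> Mn \<Longrightarrow> B \<in> Mn \<Longrightarrow> A * (- B) = - (A * B)"
  "A \<in> Mn \<Longrightarrow> One * A = A" "A \<in> Mn \<Longrightarrow> A * One = A"
  "A \<in> Mn \<Longrightarrow> Zero * A = Zero" "A \<in> Mn \<Longrightarrow> A * Zero = Zero"
  by (auto simp: assoc_mult_mat add_mult_distrib_mat mult_add_distrib_mat minus_mult_distrib_mat
      mult_minus_distrib_mat)

lemma ents:
  "i < n \<Longrightarrow> j < n \<Longrightarrow> A \<in> Mn \<Longrightarrow> B \<in> Mn \<Longrightarrow> ent i j (A + B) = ent i j A + ent i j B"
  "i < n \<Longrightarrow> j < n \<Longrightarrow> A \<in> Mn \<Longrightarrow> B \<in> Mn \<Longrightarrow> ent i j (A - B) = ent i j A - ent i j B"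
  "i < n \<Longrightarrow> j < n \<Longrightarrow> A \<in> Mn \<Longrightarrow> ent i j (- A) = - ent i j A"
  "i < n \<Longrightarrow> j < n \<Longrightarrow> A \<in> Mn \<Longrightarrow> ent i j (c \<cdot>\<^sub>m A) = c * ent i j A"
  "i < n \<Longrightarrow> j < n \<Longrightarrow> ent i j Zero = 0"
  by (auto simp: ent_def)

lemmas msimps = mring ents mcarr

subsection \<open>Entrywise valuation bounds\<close>

definition bd :: "int \<Rightarrow> 'a mat \<Rightarrow> bool" where
  "bd k A \<longleftrightarrow> (\<forall>i<n. \<forall>j<n. vge k (A $$ (i,j)))"

lemma bd_add: "A \<in> Mn \<Longrightarrow> B \<in> Mn \<Longrightarrow> bd k A \<Longrightarrow> bd k B \<Longrightarrow> bd k (A + B)"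
  by (auto simp: bd_def intro: vf.B_add)

lemma bd_diff: "A \<in> Mn \<Longrightarrow> B \<in> Mn \<Longrightarrow> bd k A \<Longrightarrow> bd k B \<Longrightarrow> bd k (A - B)"
  by (auto simp: bd_def intro: vf.B_diff)

lemma bd_uminus: "A \<in> Mn \<Longrightarrow> bd k A \<Longrightarrow> bd k (- A)"
  by (auto simp: bd_def intro: vf.B_uminus)

lemma bd_mono: "bd k A \<Longrightarrow> l \<le> k \<Longrightarrow> bd l A"
  by (auto simp: bd_def intro: vf.B_mono)

lemma bd_smult: "A \<in> Mn \<Longrightarrow> vge k c \<Longrightarrow> bd l A \<Longrightarrow> bd (k + l) (c \<cdot>\<^sub>m A)"
  by (auto simp: bd_def intro: vf.B_mult)

lemma bd_Zero: "bd k Zero"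
  by (auto simp: bd_def vf.B_0)

lemma bd_One: "bd 0 One"
  by (auto simp: bd_def vf.B_0 vf.B_1 one_mat_def)

lemma bd_mult: "A \<in> Mn \<Longrightarrow> B \<in> Mn \<Longrightarrow> bd k A \<Longrightarrow> bd l B \<Longrightarrow> bd (k + l) (A * B)"
  unfolding bd_def by (auto simp: scalar_prod_def intro!: vf.B_sum vf.B_mult)

lemma bd_mult3: "A \<in> Mn \<Longrightarrow> B \<in> Mn \<Longrightarrow> C \<in> Mn \<Longrightarrow> bd k A \<Longrightarrow> bd l B \<Longrightarrow> bd m C \<Longrightarrow> bd (k + l + m) (A * B * C)"
  by (intro bd_mult mcarr)

lemma bd_exists: "\<exists>b\<ge>0. bd (- b) A"
proof -
  have "\<exists>b\<ge>0. \<forall>x\<in>S. vge (- b) (f x)" if "finite S" for S :: "(nat \<times> nat) set" and f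
    using that
  proof (induction S)
    case (insert x S)
    then obtain b where b: "b \<ge> 0" "\<forall>x\<in>S. vge (- b) (f x)" by blast
    have "vge (- max b (- val (f x))) (f x)" by (auto simp: vge_def)
    moreover have "\<forall>x'\<in>S. vge (- max b (- val (f x))) (f x')" using b by (auto intro: vf.B_mono)
    ultimately show ?case using b(1) by (intro exI[of _ "max b (- val (f x))"]) auto
  qed auto
  from this[of "{..<n} \<times> {..<n}" "\<lambda>p. A $$ p"] show ?thesis by (auto simp: bd_def)
qed

lemma bd_deep: "\<forall>l. bd l (X - Y) \<Longrightarrow> X \<in> Mn \<Longrightarrow> Y \<in> Mn \<Longrightarrow> X = Y"
proof (rule ent_eqI)
  fix i j assume a: "\<forall>l. bd l (X - Y)" "i < n" "j < n" "X \<in> Mn" "Y \<in> Mn"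
  have "vge (val (X $$ (i,j) - Y $$ (i,j)) + 1) (X $$ (i,j) - Y $$ (i,j))"
    using a by (fastforce simp: bd_def)
  then show "ent i j X = ent i j Y" by (auto simp: vge_def ent_def)
qed

lemma bd_finite_reps:
  "\<exists>S. finite S \<and> (\<forall>s\<in>S. s \<in> Mn \<and> bd k s) \<and> (\<forall>A\<in>Mn. bd k A \<longrightarrow> (\<exists>s\<in>S. bd (k + int d) (A - s)))"
proof -
  obtain S where S: "finite S" "\<forall>s\<in>S. vge k s" "\<And>x. vge k x \<Longrightarrow> \<exists>s\<in>S. vge (k + int d) (x - s)"
    using finite_reps[of k d] by blast
  let ?F = "PiE ({..<n} \<times> {..<n}) (\<lambda>_. S)"
  show ?thesis
  proof (intro exI[of _ "mat n n ` ?F"] conjI ballI impI)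
    show "finite (mat n n ` ?F)" using S(1) by (intro finite_imageI finite_PiE) auto
    show "s \<in> Mn" "bd k s" if "s \<in> mat n n ` ?F" for s
      using that S(2) by (auto simp: bd_def PiE_def Pi_def)
    show "\<exists>s\<in>mat n n ` ?F. bd (k + int d) (A - s)" if A: "A \<in> Mn" "bd k A" for A
    proof -
      have "\<forall>p\<in>{..<n} \<times> {..<n}. \<exists>s\<in>S. vge (k + int d) (A $$ p - s)"
        using A S(3) by (auto simp: bd_def)
      then obtain f where f: "\<forall>p\<in>{..<n} \<times> {..<n}. f p \<in> S \<and> vge (k + int d) (A $$ p - f p)"
        using bchoice[of "{..<n} \<times> {..<n}" "\<lambda>p s. s \<in> S \<and> vge (k + int d) (A $$ p - s)"] by blast
      let ?f = "restrict f ({..<n} \<times> {..<n})"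
      have "?f \<in> ?F" using f by auto
      moreover have "bd (k + int d) (A - mat n n ?f)" using f A by (auto simp: bd_def)
      ultimately show ?thesis by blast
    qed
  qed
qed

lemma bd_complete:
  assumes T: "\<And>l. T l \<in> Mn" and d: "\<And>l. bd (k + int l) (T (Suc l) - T l)"
  obtains X where "X \<in> Mn" "\<And>l. bd (k + int l) (X - T l)"
proof -
  have "\<exists>x. \<forall>l. vge (k + int l) (x - T l $$ p)" if "p \<in> {..<n} \<times> {..<n}" for p
  proof -
    have "vge (k + int l) (T (Suc l) $$ p - T l $$ p)" for l
      using d[of l] T[of l] T[of "Suc l"] that by (auto simp: bd_def)
    from vge_complete[of k "\<lambda>l. T l $$ p", OF this] show ?thesis by blast
  qed
  then have "\<forall>p\<in>{..<n} \<times> {..<n}. \<exists>x. \<forall>l. vge (k + int l) (x - T l $$ p)" by blast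
  from bchoice[OF this] obtain f
    where f: "\<And>p l. p \<in> {..<n} \<times> {..<n} \<Longrightarrow> vge (k + int l) (f p - T l $$ p)" by blast
  show ?thesis
  proof
    show "mat n n f \<in> Mn" by auto
    show "bd (k + int l) (mat n n f - T l)" for l unfolding bd_def
    proof (intro allI impI)
      fix i j assume "i < n" "j < n"
      then show "vge (k + int l) ((mat n n f - T l) $$ (i,j))" using f[of "(i,j)" l] T[of l] by simp
    qed
  qed
qed

text \<open>Compactness of the balls of matrices, as an induction principle over properties of sets.\<close>

lemma bd_heine_borel:
  assumes loc: "\<And>x. x \<in> Mn \<Longrightarrow> \<exists>k. P {y \<in> Mn. bd k (y - x)}"
    and un: "\<And>A B. P A \<Longrightarrow> P B \<Longrightarrow> P (A \<union> B)" and sub: "\<And>A B. P B \<Longrightarrow> A \<subseteq> B \<Longrightarrow> P A"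
  shows "P {y \<in> Mn. bd t y}"
proof (rule ccontr)
  let ?b = "\<lambda>x k. {y \<in> Mn. bd k (y - x)}"
  assume neg: "\<not> P {y \<in> Mn. bd t y}"
  have fin: "P (\<Union>(f ` S))" if "finite S" "\<forall>s\<in>S. P (f s)" for S and f :: "'a mat \<Rightarrow> _"
    using that
  proof (induction S)
    case empty
    obtain k where k: "P {y \<in> Mn. bd k (y - Zero)}" using loc[OF mcarr(7)] by blast
    show ?case by (rule sub[OF k]) auto
  qed (simp add: un)
  have step: "\<exists>x'. x' \<in> Mn \<and> bd k (x' - x) \<and> \<not> P (?b x' (k + 1))" if x: "x \<in> Mn" "\<not> P (?b x k)" for x k
  proof (rule ccontr)
    assume no: "\<not> ?thesis"
    obtain S where S: "finite S" "\<forall>s\<in>S. s \<in> Mn \<and> bd k s" "\<And>A. A \<in> Mn \<Longrightarrow> bd k A \<Longrightarrow> \<exists>s\<in>S. bd (k + 1) (A - s)"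
      using bd_finite_reps[of k 1] by (metis int_ops(2))
    have "P (?b (x + s) (k + 1))" if "s \<in> S" for s
    proof -
      have "x + s - x = s" using x S that by (intro ent_eqI) (auto simp: msimps)
      then show ?thesis using no S that x by (auto simp: mcarr)
    qed
    then have "P (\<Union>((\<lambda>s. ?b (x + s) (k + 1)) ` S))" using S(1) by (intro fin) auto
    moreover have "?b x k \<subseteq> (\<Union>((\<lambda>s. ?b (x + s) (k + 1)) ` S))"
    proof
      fix y assume y: "y \<in> ?b x k"
      then obtain s where s: "s \<in> S" "bd (k + 1) (y - x - s)" using S(3)[of "y - x"] x by (auto simp: mcarr)
      have "y - x - s = y - (x + s)" using x y S s by (intro ent_eqI) (auto simp: msimps)
      then show "y \<in> (\<Union>((\<lambda>s. ?b (x + s) (k + 1)) ` S))" using s y by auto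
    qed
    ultimately show False using x sub by blast
  qed
  have z: "y - Zero = y" if "y \<in> Mn" for y using that by (intro ent_eqI) (auto simp: msimps)
  have "\<exists>f. \<forall>l. (f l \<in> Mn \<and> \<not> P (?b (f l) (t + int l))) \<and> bd (t + int l) (f (Suc l) - f l)"
  proof (rule dependent_nat_choice)
    have "{y \<in> Mn. bd t (y - Zero)} = {y \<in> Mn. bd t y}" using z by auto
    then show "\<exists>x. x \<in> Mn \<and> \<not> P (?b x (t + int 0))" using neg by (intro exI[of _ Zero]) (auto simp: mcarr)
    show "\<exists>y. (y \<in> Mn \<and> \<not> P (?b y (t + int (Suc l)))) \<and> bd (t + int l) (y - x)"
      if "x \<in> Mn \<and> \<not> P (?b x (t + int l))" for x l
      using step[of x "t + int l"] that by (auto simp: algebra_simps)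
  qed
  then obtain f where f: "\<And>l. f l \<in> Mn" "\<And>l. \<not> P (?b (f l) (t + int l))"
    "\<And>l. bd (t + int l) (f (Suc l) - f l)" by blast
  obtain x where x: "x \<in> Mn" "\<And>l. bd (t + int l) (x - f l)" using bd_complete[OF f(1,3)] by blast
  obtain k where k: "P (?b x k)" using loc[OF x(1)] by blast
  let ?l = "nat (k - t)"
  have "?b (f ?l) (t + int ?l) \<subseteq> ?b x k"
  proof
    fix y assume y: "y \<in> ?b (f ?l) (t + int ?l)"
    have "bd (t + int ?l) ((y - f ?l) - (x - f ?l))" by (rule bd_diff) (use y x(1) x(2)[of ?l] f in \<open>auto simp: mcarr simp del: int_nat_eq\<close>)
    moreover have "(y - f ?l) - (x - f ?l) = y - x"
      using y x(1) f(1)[of ?l] by (intro ent_eqI) (auto simp: msimps)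
    ultimately show "y \<in> ?b x k" using y bd_mono[of "t + int ?l" "y - x" k] by auto
  qed
  then show False using sub k f(2) by blast
qed

subsection \<open>Inverses and congruence subgroups\<close>

lemma GL_iff: "g \<in> Gn \<longleftrightarrow> g \<in> Mn \<and> det g \<noteq> 0"
  by (auto simp: GL_def)

lemma GL_Mn: "g \<in> Gn \<Longrightarrow> g \<in> Mn"
  by (simp add: GL_iff)

text \<open>\<open>minv\<close> is defined by choice; uniqueness of inverses identifies it with the
  adjugate divided by the determinant, the formula from which entry bounds are read off.\<close>

lemma minv_adj:
  assumes "g \<in> Gn"
  shows "minv n g = inverse (det g) \<cdot>\<^sub>m adj_mat g"
    and "minv n g \<in> Mn" "g * minv n g = One" "minv n g * g = One"
proof -
  have g: "g \<in> Mn" "det g \<noteq> 0" using assms by (auto simp: GL_iff)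
  let ?h = "inverse (det g) \<cdot>\<^sub>m adj_mat g"
  have h: "?h \<in> Mn \<and> g * ?h = One \<and> ?h * g = One"
    using adj_mat[OF g(1)] g by (auto simp: mring)
  then have "minv n g \<in> Mn \<and> g * minv n g = One \<and> minv n g * g = One"
    unfolding minv_def by (rule someI)
  then show 1: "minv n g \<in> Mn" "g * minv n g = One" "minv n g * g = One" by auto
  have "minv n g = minv n g * One" using 1 by simp
  also have "\<dots> = minv n g * (g * ?h)" using h by (simp only:)
  also have "\<dots> = minv n g * g * ?h" using h 1 g by (intro massoc[symmetric]) auto
  also have "\<dots> = One * ?h" using 1 by (simp only:)
  also have "\<dots> = ?h" using h by (intro mring) auto
  finally show "minv n g = ?h" .
qed

lemma minv_Mn: "g \<in> Gn \<Longrightarrow> minv n g \<in> Mn"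
  by (rule minv_adj)

lemma GL_mult: "g \<in> Gn \<Longrightarrow> h \<in> Gn \<Longrightarrow> g * h \<in> Gn"
  by (auto simp: GL_iff det_mult)

lemma GL_One: "One \<in> Gn"
  by (auto simp: GL_iff)

lemma minv_cancel:
  assumes "g \<in> Gn"
  shows "g * minv n g = One" "minv n g * g = One"
    "X \<in> Mn \<Longrightarrow> g * (minv n g * X) = X" "X \<in> Mn \<Longrightarrow> minv n g * (g * X) = X"
proof -
  note i = minv_adj[OF assms] GL_Mn[OF assms]
  show "g * minv n g = One" "minv n g * g = One" using i by auto
  show "g * (minv n g * X) = X" if "X \<in> Mn" using i that by (simp add: massoc[symmetric] mring(10))
  show "minv n g * (g * X) = X" if "X \<in> Mn" using i that by (simp add: massoc[symmetric] mring(10))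
qed

lemma inverse_GL: "g \<in> Mn \<Longrightarrow> h \<in> Mn \<Longrightarrow> g * h = One \<Longrightarrow> g \<in> Gn \<and> minv n g = h"
proof -
  assume a: "g \<in> Mn" "h \<in> Mn" "g * h = One"
  have "det g * det h = 1" using a det_mult[of g n h] by simp
  then have g: "g \<in> Gn" using a by (auto simp: GL_iff)
  have "minv n g * (g * h) = h" using minv_cancel(4)[OF g a(2)] .
  then show ?thesis using g a minv_Mn[OF g] by (simp add: mring)
qed

lemma GL_minv: "g \<in> Gn \<Longrightarrow> minv n g \<in> Gn"
  using inverse_GL[of "minv n g" g] by (auto simp: minv_Mn minv_cancel GL_Mn)

lemma minv_minv: "g \<in> Gn \<Longrightarrow> minv n (minv n g) = g"
  using inverse_GL[of "minv n g" g] by (auto simp: minv_Mn minv_cancel GL_Mn)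

lemmas gsimps = GL_Mn minv_Mn GL_mult GL_minv GL_One minv_cancel minv_minv

lemma minv_mult: "g \<in> Gn \<Longrightarrow> h \<in> Gn \<Longrightarrow> minv n (g * h) = minv n h * minv n g"
  by (rule inverse_GL[THEN conjunct2]) (simp_all add: gsimps mcarr massoc)

lemma minv_One: "minv n One = One"
  by (rule inverse_GL[THEN conjunct2]) (simp_all add: mcarr mring)

lemma GL_smult: "c \<noteq> 0 \<Longrightarrow> g \<in> Gn \<Longrightarrow> c \<cdot>\<^sub>m g \<in> Gn"
  by (auto simp: GL_iff)

lemma smult_smult: "a \<cdot>\<^sub>m (b \<cdot>\<^sub>m A) = (a * b :: 'a) \<cdot>\<^sub>m A"
  by (intro eq_matI) (auto simp: mult.assoc)

lemma one_smult: "(1::'a) \<cdot>\<^sub>m A = A"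
  by (intro eq_matI) auto

lemma minv_smult: "c \<noteq> 0 \<Longrightarrow> g \<in> Gn \<Longrightarrow> minv n (c \<cdot>\<^sub>m g) = inverse c \<cdot>\<^sub>m minv n g"
  by (rule inverse_GL[THEN conjunct2]) (simp_all add: gsimps mcarr mring smult_smult one_smult)

lemma det_minv: "g \<in> Gn \<Longrightarrow> det (minv n g) = inverse (det g)"
proof -
  assume g: "g \<in> Gn"
  have "det g * det (minv n g) = 1"
    using det_mult[of g n "minv n g"] g by (simp add: gsimps)
  then show ?thesis by (metis inverse_unique)
qed

lemma bd_det: "A \<in> Mn \<Longrightarrow> bd (- b) A \<Longrightarrow> vge (- (int n * b)) (det A)"
  by (rule vf.B_det) (auto simp: bd_def)

lemma bd_det_diff:
  assumes "A \<in> Mn" "B \<in> Mn" "b \<ge> 0" "bd (- b) A" "bd (- b) B" "bd s (A - B)"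
  shows "vge (s - int n * b) (det A - det B)"
proof (rule vf.B_det_diff[OF assms(1-3)])
  fix i j assume "i < n" "j < n"
  then show "vge (- b) (A $$ (i,j))" "vge (- b) (B $$ (i,j))" "vge s (A $$ (i,j) - B $$ (i,j))"
    using assms by (auto simp: bd_def)
qed

lemma bd_minv:
  assumes g: "g \<in> Gn" and b: "b \<ge> 0" "bd (- b) g" and d: "val (det g) \<le> d"
  shows "bd (- (int n * b + d)) (minv n g)"
proof -
  have gM: "g \<in> Mn" "det g \<noteq> 0" using g by (auto simp: GL_iff)
  have "bd (- (int n * b)) (adj_mat g)"
    unfolding bd_def
  proof (intro allI impI)
    fix i j assume ij: "i < n" "j < n"
    have "vge (- (int (n - 1) * b)) (cofactor g j i)"
      by (rule vf.B_cofactor[OF gM(1)]) (use b ij in \<open>auto simp: bd_def\<close>)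
    then have "vge (- (int n * b)) (cofactor g j i)"
      by (rule vf.B_mono) (use b n_pos in \<open>auto intro: mult_right_mono\<close>)
    then show "vge (- (int n * b)) (adj_mat g $$ (i,j))"
      using gM ij by (auto simp: adj_mat_def)
  qed
  moreover have "vge (- d) (inverse (det g))" using d gM by (auto simp: vge_def val_inverse)
  ultimately have "bd (- d + - (int n * b)) (minv n g)"
    unfolding minv_adj(1)[OF g] using adj_mat(1)[OF gM(1)] by (intro bd_smult)
  then show ?thesis by (simp add: algebra_simps)
qed

lemma GL_O_iff: "g \<in> GL_O val n \<longleftrightarrow> g \<in> Gn \<and> bd 0 g \<and> bd 0 (minv n g)"
proof
  assume g: "g \<in> GL_O val n"
  then have "g \<in> Gn" "bd 0 g" "val (det g) = 0" by (auto simp: GL_O_def bd_def integral_elt_vge)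
  then show "g \<in> Gn \<and> bd 0 g \<and> bd 0 (minv n g)" using bd_minv[of g 0 0] by simp
next
  assume g: "g \<in> Gn \<and> bd 0 g \<and> bd 0 (minv n g)"
  then have "vge 0 (det g)" "vge 0 (det (minv n g))"
    using bd_det[of g 0] bd_det[of "minv n g" 0] by (auto simp: gsimps)
  then have "val (det g) = 0" using g by (auto simp: det_minv vge_def val_inverse GL_iff)
  then show "g \<in> GL_O val n" using g by (auto simp: GL_O_def bd_def integral_elt_vge)
qed

lemma GL_O_bd: "g \<in> GL_O val n \<Longrightarrow> bd 0 g" "g \<in> GL_O val n \<Longrightarrow> bd 0 (minv n g)"
  and GL_O_GL: "g \<in> GL_O val n \<Longrightarrow> g \<in> Gn"
  by (auto simp: GL_O_iff)

lemma GL_O_mult: "g \<in> GL_O val n \<Longrightarrow> h \<in> GL_O val n \<Longrightarrow> g * h \<in> GL_O val n"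
  using bd_mult[of g h 0 0] bd_mult[of "minv n h" "minv n g" 0 0]
  by (auto simp: GL_O_iff gsimps minv_mult)

lemma GL_O_minv: "g \<in> GL_O val n \<Longrightarrow> minv n g \<in> GL_O val n"
  by (auto simp: GL_O_iff gsimps)

lemma GL_O_One: "One \<in> GL_O val n"
  by (auto simp: GL_O_iff GL_One bd_One minv_One)

definition Ks :: "int \<Rightarrow> 'a mat set" where
  "Ks s = {g \<in> Mn. bd s (g - One)}"

lemma Ks_One: "One \<in> Ks s"
  by (auto simp: Ks_def bd_def vf.B_0)

lemma Ks_mono: "s \<le> t \<Longrightarrow> Ks t \<subseteq> Ks s"
  by (auto simp: Ks_def intro: bd_mono)

lemma Ks_Mn: "g \<in> Ks s \<Longrightarrow> g \<in> Mn"
  by (auto simp: Ks_def)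

lemma Ks_bd: "s \<ge> 0 \<Longrightarrow> g \<in> Ks s \<Longrightarrow> bd 0 g"
proof -
  assume a: "s \<ge> 0" "g \<in> Ks s"
  then have "g = (g - One) + One" by (intro ent_eqI) (auto simp: msimps Ks_def)
  moreover have "bd 0 ((g - One) + One)" using a by (intro bd_add) (auto simp: mcarr Ks_def bd_One intro: bd_mono)
  ultimately show ?thesis by simp
qed

lemma Ks_GL_O: "s \<ge> 1 \<Longrightarrow> g \<in> Ks s \<Longrightarrow> g \<in> GL_O val n"
proof -
  assume a: "s \<ge> 1" "g \<in> Ks s"
  have b: "bd 0 g" using a Ks_bd[of s g] by simp
  have "vge (s - int n * 0) (det g - det One)"
    using a b by (intro bd_det_diff) (auto simp: Ks_def bd_One mcarr)
  then have "det g \<noteq> 0 \<and> val (det g) = 0" using val_eqI[of 1 s "det g"] a by (auto simp: val_1)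
  then show ?thesis using a b by (auto simp: GL_O_def GL_iff Ks_def bd_def integral_elt_vge)
qed

lemma Ks_GL: "s \<ge> 1 \<Longrightarrow> g \<in> Ks s \<Longrightarrow> g \<in> Gn"
  using Ks_GL_O GL_O_GL by blast

lemma Ks_mult: "s \<ge> 0 \<Longrightarrow> g \<in> Ks s \<Longrightarrow> h \<in> Ks s \<Longrightarrow> g * h \<in> Ks s"
proof -
  assume a: "s \<ge> 0" "g \<in> Ks s" "h \<in> Ks s"
  have "bd (s + 0) ((g - One) * h)" using a Ks_bd by (intro bd_mult) (auto simp: Ks_def mcarr)
  then have "bd s ((g - One) * h + (h - One))" using a by (intro bd_add) (auto simp: Ks_def mcarr)
  moreover have "(g - One) * h + (h - One) = g * h - One"
    using a by (intro ent_eqI) (auto simp: msimps Ks_def)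
  ultimately show ?thesis using a by (auto simp: Ks_def mcarr)
qed

lemma Ks_minv: "s \<ge> 1 \<Longrightarrow> g \<in> Ks s \<Longrightarrow> minv n g \<in> Ks s"
proof -
  assume a: "s \<ge> 1" "g \<in> Ks s"
  note g = Ks_GL_O[OF a] Ks_GL[OF a] Ks_Mn[OF a(2)]
  have "bd (0 + s) (minv n g * (g - One))" using a g by (intro bd_mult) (auto simp: Ks_def mcarr gsimps GL_O_bd)
  then have "bd s (- (minv n g * (g - One)))" using a g by (intro bd_uminus) (auto simp: Ks_def mcarr gsimps)
  moreover have "- (minv n g * (g - One)) = minv n g - One"
    using g by (intro ent_eqI) (auto simp: msimps gsimps)
  ultimately show ?thesis using g by (auto simp: Ks_def gsimps)
qed

lemma Ks_conj:
  assumes "k \<in> Gn" "bd (- c) k" "bd (- c) (minv n k)" "g \<in> Ks (s + 2 * c)"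
  shows "k * g * minv n k \<in> Ks s"
proof -
  have g: "g \<in> Mn" "bd (s + 2 * c) (g - One)" using assms by (auto simp: Ks_def)
  have "bd (- c + (s + 2 * c) + - c) (k * (g - One) * minv n k)"
    using assms g by (intro bd_mult3) (auto simp: gsimps mcarr)
  moreover have "k * (g - One) * minv n k = k * g * minv n k - One"
    using assms g by (intro ent_eqI) (auto simp: msimps gsimps)
  ultimately show ?thesis using assms g by (auto simp: Ks_def gsimps mcarr)
qed

lemma Ks_conj_GL_O: "k \<in> GL_O val n \<Longrightarrow> g \<in> Ks s \<Longrightarrow> k * g * minv n k \<in> Ks s"
  using Ks_conj[of k 0 g s] by (simp add: GL_O_bd GL_O_GL)

lemma Ks_left_diff:
  assumes "y \<in> Mn" "g \<in> Gn" "bd (- c) (minv n g)" "bd (s + c) (y - g)"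
  shows "minv n g * y \<in> Ks s"
proof -
  have "bd (- c + (s + c)) (minv n g * (y - g))"
    using assms by (intro bd_mult) (auto simp: gsimps mcarr)
  moreover have "minv n g * (y - g) = minv n g * y - One"
    using assms by (intro ent_eqI) (auto simp: msimps gsimps)
  ultimately show ?thesis using assms by (auto simp: Ks_def gsimps mcarr)
qed

text \<open>Matrices with bounded entries fall into finitely many residue classes, and the bound on
  the inverses turns closeness of entries into membership in a common coset of
  \<open>Ks s\<close>.\<close>

lemma GL_O_finite_cosets:
  assumes s: "s \<ge> 1" and D: "\<And>g. g \<in> D \<Longrightarrow> g \<in> Gn \<and> bd (- c) g \<and> bd (- c) (minv n g)" 
  shows "\<exists>S. finite S \<and> S \<subseteq> D \<and> (\<forall>y\<in>D. \<exists>g\<in>S. minv n g * y \<in> Ks s)"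
proof -
  obtain R where R: "finite R" "\<forall>r\<in>R. r \<in> Mn"
    "\<And>A. A \<in> Mn \<Longrightarrow> bd (- c) A \<Longrightarrow> \<exists>r\<in>R. bd (- c + int (nat (s + 2 * c))) (A - r)"
    using bd_finite_reps[of "- c" "nat (s + 2 * c)"] by metis
  have le: "s + c \<le> - c + int (nat (s + 2 * c))" by simp
  \<comment> \<open>A residue representative may be singular or lie outside \<open>D\<close>; it is
    replaced by an element of \<open>D\<close> in the same class.\<close>
  define R' where "R' = {r \<in> R. \<exists>g\<in>D. bd (s + c) (g - r)}"
  define f where "f r = (SOME g. g \<in> D \<and> bd (s + c) (g - r))" for r
  have f: "f r \<in> D \<and> bd (s + c) (f r - r)" if "r \<in> R'" for r
    using someI_ex[of "\<lambda>g. g \<in> D \<and> bd (s + c) (g - r)"] that by (auto simp: R'_def f_def)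
  show ?thesis
  proof (intro exI[of _ "f ` R'"] conjI ballI)
    show "finite (f ` R')" using R by (auto simp: R'_def)
    show "f ` R' \<subseteq> D" using f by auto
    fix y assume y: "y \<in> D"
    then obtain r where "r \<in> R" "bd (- c + int (nat (s + 2 * c))) (y - r)"
      using R(3)[of y] D[OF y] GL_Mn by blast
    then have r: "r \<in> R" "bd (s + c) (y - r)" using bd_mono[OF _ le] by auto
    then have r': "r \<in> R'" using y by (auto simp: R'_def)
    have c: "y \<in> Mn" "f r \<in> Mn" "r \<in> Mn" using D[OF y] f[OF r'] D[of "f r"] R(2) r(1) by (auto simp: GL_Mn)
    have "bd (s + c) ((y - r) - (f r - r))" by (rule bd_diff) (use r f[OF r'] c in \<open>auto simp: mcarr\<close>)
    moreover have "(y - r) - (f r - r) = y - f r" using c by (intro ent_eqI) (auto simp: msimps)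
    ultimately have "minv n (f r) * y \<in> Ks s"
      using D[of "f r"] f[OF r'] c(1) by (intro Ks_left_diff[of _ _ c]) simp_all
    then show "\<exists>g\<in>f ` R'. minv n g * y \<in> Ks s" using r' by auto
  qed
qed

end

section \<open>Block triangular determinants and the Bezout identity of the resultant\<close>

text \<open>Both determinants are the product of the determinants of the same two diagonal blocks.
  Integral domains are allowed so that characteristic matrices are covered.\<close>

lemma det_block_upper:
  fixes A B :: "'r::idom mat"
  assumes A: "A \<in> carrier_mat n n" and B: "B \<in> carrier_mat n n" and j: "j \<le> n"
    and z: "\<And>i k. j \<le> i \<Longrightarrow> i < n \<Longrightarrow> k < j \<Longrightarrow> A $$ (i,k) = 0"
    and eq: "\<And>i k. i < n \<Longrightarrow> k < n \<Longrightarrow> \<not> (i < j \<and> j \<le> k) \<Longrightarrow> A $$ (i,k) = B $$ (i,k)"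
  shows "det A = det B"
proof -
  define bl where "bl C = mat j j (\<lambda>p. C $$ p)" for C :: "'r mat"
  define br where "br C = mat j (n-j) (\<lambda>(i,k). C $$ (i,k+j))" for C :: "'r mat"
  define dr where "dr C = mat (n-j) (n-j) (\<lambda>(i,k). C $$ (i+j,k+j))" for C :: "'r mat"
  have *: "det C = det (bl C) * det (dr C)"
    if C: "C \<in> carrier_mat n n" and z: "\<And>i k. j \<le> i \<Longrightarrow> i < n \<Longrightarrow> k < j \<Longrightarrow> C $$ (i,k) = 0" for C
  proof -
    have "C = four_block_mat (bl C) (br C) (0\<^sub>m (n-j) j) (dr C)"
      using C j z by (intro eq_matI) (auto simp: bl_def br_def dr_def)
    then have "det C = det (four_block_mat (bl C) (br C) (0\<^sub>m (n-j) j) (dr C))" by simp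
    also have "\<dots> = det (bl C) * det (dr C)"
      by (rule det_four_block_mat_lower_left_zero) (auto simp: bl_def br_def dr_def)
    finally show ?thesis .
  qed
  have "bl A = bl B" "dr A = dr B" using eq j by (auto simp: bl_def dr_def intro!: eq_matI)
  moreover have "B $$ (i,k) = 0" if "j \<le> i" "i < n" "k < j" for i k using z[of i k] eq[of i k] that j by auto
  ultimately show ?thesis using *[OF A] *[OF B] z by simp
qed

lemma det_block_lower:
  fixes A B :: "'r::idom mat"
  assumes A: "A \<in> carrier_mat n n" and B: "B \<in> carrier_mat n n" and j: "j \<le> n"
    and z: "\<And>i k. j \<le> k \<Longrightarrow> k < n \<Longrightarrow> i < j \<Longrightarrow> A $$ (i,k) = 0"
    and eq: "\<And>i k. i < n \<Longrightarrow> k < n \<Longrightarrow> \<not> (k < j \<and> j \<le> i) \<Longrightarrow> A $$ (i,k) = B $$ (i,k)"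
  shows "det A = det B"
proof -
  have "det (transpose_mat A) = det (transpose_mat B)"
    by (rule det_block_upper[of _ n _ j]) (use assms in auto)
  then show ?thesis using det_transpose[OF A] det_transpose[OF B] by simp
qed

text \<open>The rows of the Sylvester matrix are coefficient vectors of shifts of \<open>p\<close>
  and \<open>q\<close>. The last row of the adjugate combines them to \<open>resultant p q\<close>
  times the last unit vector, which is the coefficient vector of a constant.\<close>

lemma resultant_bezout_sylvester:
  fixes p q :: "'r::comm_ring_1 poly"
  defines "N \<equiv> degree p + degree q"
  defines "c i \<equiv> adj_mat (sylvester_mat p q) $$ (N - 1, i)"
  defines "a \<equiv> \<Sum>i<degree q. monom (c i) (degree q - 1 - i)"
  defines "b \<equiv> \<Sum>i\<in>{degree q..<N}. monom (c i) (N - 1 - i)"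
  assumes N: "N > 0"
  shows "a * p + b * q = [:resultant p q:]"
proof -
  let ?S = "sylvester_mat p q" and ?n = "degree q"
  \<comment> \<open>The polynomial whose coefficients, in decreasing degree from
    \<open>N - 1\<close>, form row \<open>i\<close>.\<close>
  define rp where "rp i = (if i < ?n then monom 1 (?n - 1 - i) * p else monom 1 (N - 1 - i) * q)" for i
  have S: "?S \<in> carrier_mat N N" unfolding N_def by (rule sylvester_carrier_mat)
  have ent: "?S $$ (i,j) = coeff (rp i) (N - 1 - j)" if "i < N" "j < N" for i j
  proof -
    have 1: "N - j = Suc (N - 1 - j)" using that by simp
    have 2: "i < ?n \<Longrightarrow> ?n - i = Suc (?n - 1 - i)" "N - i = Suc (N - 1 - i)" using that by auto
    show ?thesis
      using sylvester_index_mat2[of i p q j] that unfolding N_def[symmetric] rp_def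
      by (cases "i < ?n") (simp_all add: 1 2 coeff_monom_mult)
  qed
  have deg: "coeff (rp i) k = 0" if "i < N" "k \<ge> N" for i k
  proof (cases "i < ?n")
    case True
    then have "k - (?n - 1 - i) > degree p" using that by (auto simp: N_def)
    then show ?thesis using True by (auto simp: rp_def coeff_monom_mult coeff_eq_0)
  next
    case False
    then have "k - (N - 1 - i) > degree q" using that by (auto simp: N_def)
    then show ?thesis using False by (auto simp: rp_def coeff_monom_mult coeff_eq_0)
  qed
  have m: "monom x k = Polynomial.smult x (monom 1 k)" for x :: 'r and k by (simp add: smult_monom)
  have "a * p + b * q = (\<Sum>i<?n. Polynomial.smult (c i) (rp i)) + (\<Sum>i\<in>{?n..<N}. Polynomial.smult (c i) (rp i))"
    unfolding a_def b_def sum_distrib_right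
    by (intro arg_cong2[of _ _ _ _ "(+)"] sum.cong refl; subst m) (auto simp: rp_def)
  also have "\<dots> = (\<Sum>i<N. Polynomial.smult (c i) (rp i))"
  proof -
    have "{..<N} = {..<?n} \<union> {?n..<N}" by (auto simp: N_def)
    then show ?thesis by (simp add: sum.union_disjoint ivl_disj_int)
  qed
  also have "\<dots> = [:resultant p q:]"
  proof (rule poly_eqI)
    fix k
    show "coeff (\<Sum>i<N. Polynomial.smult (c i) (rp i)) k = coeff [:resultant p q:] k"
    proof (cases "k < N")
      case False
      then show ?thesis using deg N by (auto simp: coeff_sum coeff_pCons split: nat.splits)
    next
      case True
      define j where "j = N - 1 - k"
      have j: "j < N" "k = N - 1 - j" using True N by (auto simp: j_def)
      have "coeff (\<Sum>i<N. Polynomial.smult (c i) (rp i)) k = (\<Sum>i<N. c i * ?S $$ (i,j))"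
        using ent j by (auto simp: coeff_sum intro!: sum.cong)
      also have "\<dots> = (adj_mat ?S * ?S) $$ (N - 1, j)"
        using S adj_mat(1)[OF S] N j by (auto simp: c_def scalar_prod_def lessThan_atLeast0)
      also have "\<dots> = (if N - 1 = j then resultant p q else 0)"
        using adj_mat(3)[OF S] N j by (auto simp: resultant_def)
      also have "\<dots> = coeff [:resultant p q:] k"
        using j by (auto simp: coeff_pCons split: nat.splits)
      finally show ?thesis .
    qed
  qed
  finally show ?thesis .
qed

context local_field
begin

text \<open>The coefficients of \<open>r\<close> and \<open>s\<close> are cofactors of the Sylvester
  matrix, hence minors of size \<open>N - 1\<close> in the coefficients of \<open>p\<close> and
  \<open>q\<close>. This gives the loss \<open>N * b\<close>.\<close>

lemma resultant_bezout:
  assumes N: "degree p + degree q = N" "N > 0" and b: "pge (- b) p" "pge (- b) q" "b \<ge> 0"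
  obtains r s where "r * p + s * q = [:resultant p q:]" "pge (- (int N * b)) r" "pge (- (int N * b)) s"
    "degree r < N" "degree s < N"
proof -
  let ?S = "sylvester_mat p q" and ?n = "degree q"
  let ?c = "\<lambda>i. adj_mat ?S $$ (N - 1, i)"
  let ?a = "\<Sum>i<?n. monom (?c i) (?n - 1 - i)" and ?b = "\<Sum>i\<in>{?n..<N}. monom (?c i) (N - 1 - i)"
  have S: "?S \<in> carrier_mat N N" using sylvester_carrier_mat[of p q] N by simp
  have c: "vge (- (int N * b)) (?c i)" if i: "i < N" for i
  proof -
    have e: "vge (- b) (?S $$ (i,j))" if "i < N" "j < N" for i j
      using that N b by (subst sylvester_index_mat) (auto simp: pge_def vf.B_0)
    have "vge (- (int (N - 1) * b)) (cofactor ?S i (N - 1))"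
      by (rule vf.B_cofactor[OF S]) (use e i N in auto)
    then have "vge (- (int N * b)) (cofactor ?S i (N - 1))"
      by (rule vf.B_mono) (use b in \<open>auto intro: mult_right_mono\<close>)
    moreover have "?c i = cofactor ?S i (N - 1)" using S i N by (auto simp: adj_mat_def)
    ultimately show ?thesis by simp
  qed
  have mo: "pge k (monom x l)" if "vge k x" for k x l
    using that by (auto simp: pge_def vf.B_0)
  show ?thesis
  proof
    show "?a * p + ?b * q = [:resultant p q:]"
      using resultant_bezout_sylvester[of p q] N by simp
    show "pge (- (int N * b)) ?a" using c N by (intro pf.B_sum mo) auto
    show "pge (- (int N * b)) ?b" using c by (intro pf.B_sum mo) auto
    show "degree ?a < N" using N
      by (intro degree_sum_less) (auto intro!: le_less_trans[OF degree_monom_le])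
    show "degree ?b < N" using N
      by (intro degree_sum_less) (auto intro!: le_less_trans[OF degree_monom_le])
  qed
qed

end

context gl
begin

subsection \<open>Polynomials in a matrix\<close>

definition meval :: "'a mat \<Rightarrow> 'a poly \<Rightarrow> 'a mat" where
  "meval A p = fold_coeffs (\<lambda>c B. c \<cdot>\<^sub>m One + A * B) p Zero"

lemma meval_0: "meval A 0 = Zero"
  by (simp add: meval_def)

lemma meval_pCons: "A \<in> Mn \<Longrightarrow> meval A (pCons c p) = c \<cdot>\<^sub>m One + A * meval A p"
proof (cases "c = 0 \<and> p = 0")
  case True
  assume "A \<in> Mn"
  then have "c \<cdot>\<^sub>m One + A * meval A p = Zero"
    using True by (intro ent_eqI) (auto simp: msimps meval_0)
  then show ?thesis using True by (simp add: meval_0)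
next
  case False
  then show ?thesis by (cases "c = 0") (auto simp: meval_def)
qed

lemma meval_Mn: "A \<in> Mn \<Longrightarrow> meval A p \<in> Mn"
  by (induction p) (auto simp: meval_0 meval_pCons mcarr)

lemma meval_add: "A \<in> Mn \<Longrightarrow> meval A (p + q) = meval A p + meval A q"
proof (induction p q rule: poly_induct2)
  case (pCons c p d q)
  then show ?case by (intro ent_eqI) (auto simp: meval_pCons meval_Mn msimps algebra_simps)
qed (auto simp: meval_0)

lemma meval_smult: "A \<in> Mn \<Longrightarrow> meval A (Polynomial.smult c p) = c \<cdot>\<^sub>m meval A p"
proof (induction p)
  case 0
  then show ?case by (intro ent_eqI) (auto simp: meval_0 msimps)
next
  case (pCons a p)
  then show ?case by (intro ent_eqI) (auto simp: meval_pCons meval_Mn msimps algebra_simps)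
qed

lemma meval_commute: "A \<in> Mn \<Longrightarrow> meval A p * A = A * meval A p"
proof (induction p)
  case (pCons a p)
  then show ?case by (intro ent_eqI) (auto simp: meval_pCons meval_Mn msimps)
qed (auto simp: meval_0 mring)

lemma meval_mult: "A \<in> Mn \<Longrightarrow> meval A (p * q) = meval A p * meval A q"
proof (induction p)
  case 0
  then show ?case by (auto simp: meval_0 mring meval_Mn)
next
  case (pCons a p)
  then show ?case
    by (intro ent_eqI) (auto simp: meval_pCons meval_add meval_smult meval_Mn msimps)
qed

lemma meval_const: "A \<in> Mn \<Longrightarrow> meval A [:c:] = c \<cdot>\<^sub>m One"
  by (intro ent_eqI) (auto simp: meval_pCons meval_0 msimps)

lemma bd_meval:
  assumes "A \<in> Mn" "bd (- b) A" "b \<ge> 0" "pge (- c) p" "degree p \<le> d"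
  shows "bd (- c - int d * b) (meval A p)"
  using assms(4,5)
proof (induction p arbitrary: d)
  case 0
  then show ?case by (simp add: meval_0 bd_Zero)
next
  case (pCons a p)
  have a: "bd (- c + 0) (a \<cdot>\<^sub>m One)" using pCons by (intro bd_smult) (auto simp: mcarr bd_One pge_pCons)
  have nn: "0 \<le> int d * b" for d using assms(3) by simp
  have 1: "bd (- c - int d * b) (a \<cdot>\<^sub>m One)" by (rule bd_mono[OF a]) (use nn[of d] in simp)
  have 2: "bd (- c - int d * b) (A * meval A p)"
  proof (cases "p = 0")
    case True
    then show ?thesis using assms by (simp add: meval_0 mring bd_Zero)
  next
    case False
    then obtain d' where d: "d = Suc d'" "degree p \<le> d'" using pCons by (cases d) auto
    have "bd (- b + (- c - int d' * b)) (A * meval A p)"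
      using pCons d assms by (intro bd_mult) (auto simp: meval_Mn pge_pCons)
    moreover have "- b + (- c - int d' * b) = - c - int d * b" by (simp add: d algebra_simps)
    ultimately show ?thesis by (simp only:)
  qed
  show ?case unfolding meval_pCons[OF assms(1)]
    using assms 1 2 by (intro bd_add) (auto simp: mcarr meval_Mn)
qed

text \<open>Comparing coefficients in \<open>(t - A) adj (t - A) = p(t)\<close> identifies the coefficient matrices of
  the adjugate with the values at \<open>A\<close> of the tails of \<open>p\<close> (Horner scheme).\<close>

lemma cayley_hamilton:
  assumes A: "A \<in> Mn"
  shows "meval A (char_poly A) = Zero"
proof -
  define p where "p = char_poly A"
  define C where "C = char_poly_matrix A"
  define B where "B k = mat n n (\<lambda>ij. coeff (adj_mat C $$ ij) k)" for k
  have C: "C \<in> carrier_mat n n" using A by (simp add: C_def)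
  note adj = adj_mat[OF C]
  have BM: "B k \<in> Mn" for k by (simp add: B_def)
  have rel: "coeff (pCons 0 (adj_mat C $$ (i,j))) k - ent i j (A * B k) = (if i = j then coeff p k else 0)"
    if ij: "i < n" "j < n" for i j k
  proof -
    have "(if i = j then p else 0) = (C * adj_mat C) $$ (i,j)"
      using adj(2) ij by (auto simp: p_def char_poly_def C_def)
    also have "\<dots> = (\<Sum>l<n. C $$ (i,l) * adj_mat C $$ (l,j))"
      using C adj(1) ij by (auto simp: scalar_prod_def lessThan_atLeast0)
    also have "\<dots> = (\<Sum>l<n. (if l = i then [:0,1:] * adj_mat C $$ (l,j) else 0) - Polynomial.smult (A $$ (i,l)) (adj_mat C $$ (l,j)))"
      using A ij by (intro sum.cong) (auto simp: C_def char_poly_matrix_def algebra_simps)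
    also have "\<dots> = pCons 0 (adj_mat C $$ (i,j)) - (\<Sum>l<n. Polynomial.smult (A $$ (i,l)) (adj_mat C $$ (l,j)))"
      using ij by (simp add: sum_subtractf)
    finally have "coeff (if i = j then p else 0) k =
        coeff (pCons 0 (adj_mat C $$ (i,j))) k - (\<Sum>l<n. A $$ (i,l) * coeff (adj_mat C $$ (l,j)) k)"
      by (simp add: coeff_sum)
    moreover have "(\<Sum>l<n. A $$ (i,l) * coeff (adj_mat C $$ (l,j)) k) = ent i j (A * B k)"
      using A ij by (auto simp: ent_def B_def scalar_prod_def lessThan_atLeast0)
    ultimately show ?thesis by (auto split: if_splits)
  qed
  have eOne: "ent i j One = (if i = j then 1 else 0)" if "i < n" "j < n" for i j
    using that by (auto simp: ent_def)
  have S: "B k = coeff p (Suc k) \<cdot>\<^sub>m One + A * B (Suc k)" for k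
  proof (rule ent_eqI)
    fix i j assume ij: "i < n" "j < n"
    have "ent i j (B k) = coeff (pCons 0 (adj_mat C $$ (i,j))) (Suc k)"
      using ij by (simp add: B_def ent_def)
    then show "ent i j (B k) = ent i j (coeff p (Suc k) \<cdot>\<^sub>m One + A * B (Suc k))"
      using rel[OF ij, of "Suc k"] ij A BM by (simp add: ents mcarr eOne algebra_simps)
  qed (auto simp: BM A mcarr)
  have Z: "Zero = coeff p 0 \<cdot>\<^sub>m One + A * B 0"
  proof (rule ent_eqI)
    fix i j assume ij: "i < n" "j < n"
    then show "ent i j Zero = ent i j (coeff p 0 \<cdot>\<^sub>m One + A * B 0)"
      using rel[OF ij, of 0] A BM by (auto simp: ents mcarr eOne algebra_simps neg_eq_iff_add_eq_0)
  qed (auto simp: BM A mcarr)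
  define N where "N = Max (insert (degree p) ((\<lambda>ij. degree (adj_mat C $$ ij)) ` ({..<n} \<times> {..<n})))"
  have N: "degree p \<le> N" "\<And>i j. i < n \<Longrightarrow> j < n \<Longrightarrow> degree (adj_mat C $$ (i,j)) \<le> N"
    by (auto simp: N_def intro: Max_ge)
  have step: "poly_shift k p = pCons (coeff p k) (poly_shift (Suc k) p)" for k
    by (intro poly_eqI) (auto simp: coeff_poly_shift coeff_pCons split: nat.splits)
  \<comment> \<open>Downward induction on \<open>k\<close>, starting above all degrees, where both
    sides vanish.\<close>
  have tail: "meval A (poly_shift (Suc k) p) = B k" if "k + d = Suc N" for k d
    using that
  proof (induction d arbitrary: k)
    case 0
    have "poly_shift (Suc k) p = 0"
      using 0 N(1) by (intro poly_eqI) (auto simp: coeff_poly_shift intro!: coeff_eq_0)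
    moreover have "B k = Zero"
      using 0 N(2) by (intro ent_eqI) (auto simp: B_def ent_def intro!: coeff_eq_0 le_less_trans[OF N(2)])
    ultimately show ?case by (simp add: meval_0)
  next
    case (Suc d)
    then have "meval A (poly_shift (Suc (Suc k)) p) = B (Suc k)" by simp
    then show ?case using S[of k] by (simp add: step[of "Suc k"] meval_pCons[OF A])
  qed
  have "meval A p = coeff p 0 \<cdot>\<^sub>m One + A * meval A (poly_shift (Suc 0) p)"
    using step[of 0] meval_pCons[OF A, of "coeff p 0" "poly_shift (Suc 0) p"]
    by (metis poly_shift_id)
  also have "\<dots> = Zero" using tail[of 0 "Suc N"] Z by simp
  finally show ?thesis by (simp add: p_def)
qed

subsection \<open>Parabolic algebras attached to an idempotent\<close>

text \<open>For an idempotent \<open>e\<close>, \<open>Par e\<close> is the stabiliser of the image of \<open>e\<close> and \<open>Rad e\<close> the Lie algebra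
  of its unipotent radical; \<open>1 - e\<close> gives the opposite parabolic.\<close>

definition Par :: "'a mat \<Rightarrow> 'a mat set" where
  "Par e = {x \<in> Mn. e * (x * e) = x * e}"

definition Rad :: "'a mat \<Rightarrow> 'a mat set" where
  "Rad e = {X \<in> Mn. e * X = X \<and> X * e = Zero}"

text \<open>The last condition is what links \<^term>\<open>Rad e\<close> to the spectral theory of \<^term>\<open>Par e\<close>.\<close>

definition splitting :: "'a mat \<Rightarrow> bool" where
  "splitting e \<longleftrightarrow> e \<in> Mn \<and> e * e = e \<and> bd 0 e \<and>
     (\<forall>x\<in>Par e. \<forall>Y\<in>Rad e. char_poly (x + Y) = char_poly x \<and> det (x + Y) = det x)"

lemma splittingD:
  assumes "splitting e"
  shows "e \<in> Mn" "e * e = e" "bd 0 e" "A \<in> Mn \<Longrightarrow> e * (e * A) = e * A"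
    "x \<in> Par e \<Longrightarrow> Y \<in> Rad e \<Longrightarrow> char_poly (x + Y) = char_poly x"
    "x \<in> Par e \<Longrightarrow> Y \<in> Rad e \<Longrightarrow> det (x + Y) = det x"
proof -
  show "e \<in> Mn" "e * e = e" "bd 0 e"
    "x \<in> Par e \<Longrightarrow> Y \<in> Rad e \<Longrightarrow> char_poly (x + Y) = char_poly x"
    "x \<in> Par e \<Longrightarrow> Y \<in> Rad e \<Longrightarrow> det (x + Y) = det x"
    using assms by (auto simp: splitting_def)
  then show "A \<in> Mn \<Longrightarrow> e * (e * A) = e * A" by (simp add: massoc[symmetric])
qed

lemma Par_Mn: "x \<in> Par e \<Longrightarrow> x \<in> Mn"
  and Rad_Mn: "x \<in> Rad e \<Longrightarrow> x \<in> Mn"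
  by (auto simp: Par_def Rad_def)

lemma ParI: "e \<in> Mn \<Longrightarrow> x \<in> Mn \<Longrightarrow> e * (x * e) = x * e \<Longrightarrow> x \<in> Par e"
  by (auto simp: Par_def)

lemma Par_mult:
  assumes "e \<in> Mn" "x \<in> Par e" "y \<in> Par e"
  shows "x * y \<in> Par e"
proof -
  have c: "x \<in> Mn" "y \<in> Mn" "e * (x * e) = x * e" "e * (y * e) = y * e" using assms by (auto simp: Par_def)
  have "e * (x * y * e) = e * (x * (e * (y * e)))" using c assms(1) by (simp add: massoc mcarr)
  also have "\<dots> = (e * (x * e)) * (y * e)" using c(1,2) assms(1) by (simp add: massoc mcarr)
  also have "\<dots> = x * (e * (y * e))" using c(1,2,3) assms(1) by (simp add: massoc mcarr)
  also have "\<dots> = x * y * e" using c assms(1) by (simp add: massoc mcarr)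
  finally show ?thesis using c by (auto simp: Par_def mcarr)
qed

lemma Par_add: "e \<in> Mn \<Longrightarrow> x \<in> Par e \<Longrightarrow> y \<in> Par e \<Longrightarrow> x + y \<in> Par e"
  by (auto simp: Par_def msimps)

lemma Par_smult: "e \<in> Mn \<Longrightarrow> x \<in> Par e \<Longrightarrow> c \<cdot>\<^sub>m x \<in> Par e"
  by (auto simp: Par_def msimps)

lemma Par_One: "splitting e \<Longrightarrow> One \<in> Par e"
  by (auto simp: Par_def msimps splittingD)

lemma Par_meval: "splitting e \<Longrightarrow> x \<in> Par e \<Longrightarrow> meval x p \<in> Par e"
proof (induction p)
  case 0
  then show ?case by (auto simp: meval_0 Par_def msimps splittingD)
next
  case (pCons a p)
  then show ?case
    by (simp add: meval_pCons Par_Mn Par_add Par_smult Par_One Par_mult splittingD)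
qed

lemma Rad_add: "e \<in> Mn \<Longrightarrow> X \<in> Rad e \<Longrightarrow> Y \<in> Rad e \<Longrightarrow> X + Y \<in> Rad e"
  by (auto simp: Rad_def msimps)

lemma Rad_diff: "e \<in> Mn \<Longrightarrow> X \<in> Rad e \<Longrightarrow> Y \<in> Rad e \<Longrightarrow> X - Y \<in> Rad e"
  by (auto simp: Rad_def msimps)

lemma Rad_uminus: "e \<in> Mn \<Longrightarrow> X \<in> Rad e \<Longrightarrow> - X \<in> Rad e"
  by (auto simp: Rad_def msimps)

lemma Rad_Zero: "e \<in> Mn \<Longrightarrow> Zero \<in> Rad e"
  by (auto simp: Rad_def msimps)

lemma Rad_Par_left:
  assumes "e \<in> Mn" "x \<in> Par e" "X \<in> Rad e"
  shows "x * X \<in> Rad e"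
proof -
  have c: "x \<in> Mn" "X \<in> Mn" "e * (x * e) = x * e" "e * X = X" "X * e = Zero" using assms by (auto simp: Par_def Rad_def)
  have "e * (x * X) = e * (x * (e * X))" using c by simp
  also have "\<dots> = (e * (x * e)) * X" using c(1,2) assms(1) by (simp add: massoc mcarr)
  also have "\<dots> = x * (e * X)" using c(1,2,3) assms(1) by (simp add: massoc mcarr)
  finally have "e * (x * X) = x * X" using c by simp
  moreover have "x * X * e = Zero" using c assms(1) by (simp add: massoc mring)
  ultimately show ?thesis using c by (auto simp: Rad_def mcarr)
qed

lemma Rad_Par_right:
  assumes "e \<in> Mn" "x \<in> Par e" "X \<in> Rad e"
  shows "X * x \<in> Rad e"
proof -
  have c: "x \<in> Mn" "X \<in> Mn" "e * (x * e) = x * e" "e * X = X" "X * e = Zero" using assms by (auto simp: Par_def Rad_def)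
  have "X * x * e = X * (e * (x * e))" using c(1,2,3) assms(1) by (simp add: massoc mcarr)
  also have "\<dots> = (X * e) * (x * e)" using c(1,2) assms(1) by (simp add: massoc mcarr)
  also have "\<dots> = Zero" unfolding c(5) using c(1) assms(1) by (simp add: mring mcarr)
  finally have "X * x * e = Zero" .
  moreover have "e * (X * x) = X * x" using c assms(1) massoc[of e X x] by simp
  ultimately show ?thesis using c by (auto simp: Rad_def mcarr)
qed

lemma Rad_mult_Zero:
  assumes "e \<in> Mn" "X \<in> Rad e" "Y \<in> Rad e"
  shows "X * Y = Zero"
proof -
  have c: "X \<in> Mn" "Y \<in> Mn" "e * Y = Y" "X * e = Zero" using assms by (auto simp: Rad_def)
  have "X * Y = X * (e * Y)" using c by simp
  also have "\<dots> = (X * e) * Y" using c(1,2) assms(1) by (simp add: massoc)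
  finally show ?thesis using c by (simp add: mring)
qed

text \<open>Replaces the exponential map: as products of radical elements vanish, \<open>X\<close>
  to \<open>1 + X\<close> turns addition into multiplication in any characteristic.\<close>

lemma Rad_unip_mult:
  assumes "e \<in> Mn" "X \<in> Rad e" "Y \<in> Rad e"
  shows "(One + X) * (One + Y) = One + (X + Y)"
  using assms Rad_mult_Zero[OF assms] Rad_Mn by (intro ent_eqI) (auto simp: msimps algebra_simps)

lemma Rad_unip_inv:
  assumes "e \<in> Mn" "X \<in> Rad e"
  shows "One + X \<in> Gn" "minv n (One + X) = One - X"
proof -
  have "(One + X) * (One - X) = One"
    using assms Rad_mult_Zero[OF assms assms(2)] Rad_Mn by (intro ent_eqI) (auto simp: msimps algebra_simps)
  then have "One + X \<in> Gn \<and> minv n (One + X) = One - X"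
    using assms Rad_Mn by (intro inverse_GL) (auto simp: mcarr)
  then show "One + X \<in> Gn" "minv n (One + X) = One - X" by auto
qed

text \<open>An invertible map that sends the image of \<open>e\<close> into itself sends it onto
  itself, by finite dimension. The matrices \<open>a\<close> and \<open>b\<close> are the blocks of
  the inverse and of \<open>w\<close> on this image, completed by the identity, so that a one-sided
  inverse of a square matrix is two-sided.\<close>

lemma Par_minv:
  assumes e: "splitting e" and w: "w \<in> Par e" "w \<in> Gn"
  shows "minv n w \<in> Par e"
proof -
  note eM = splittingD(1-4)[OF e]
  define u where "u = minv n w"
  have c: "w \<in> Mn" "u \<in> Mn" "e * (w * e) = w * e" "u * w = One" "w * u = One"
    using w by (auto simp: Par_def u_def gsimps)
  define a where "a = e * u * e + (One - e)"
  define b where "b = e * w * e + (One - e)"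
  have uw: "\<And>X. X \<in> Mn \<Longrightarrow> u * (w * X) = X" using c by (simp add: massoc[symmetric] mring(10))
  have ewe: "\<And>X. X \<in> Mn \<Longrightarrow> e * (w * (e * X)) = w * (e * X)"
  proof -
    fix X assume "X \<in> Mn"
    then have "e * (w * (e * X)) = (e * (w * e)) * X" "w * (e * X) = w * e * X" using c(1) eM(1) by (simp_all add: massoc mcarr)
    then show "e * (w * (e * X)) = w * (e * X)" using c(3) by simp
  qed
  have aM: "a \<in> Mn" and bM: "b \<in> Mn" using c(1,2) eM(1) by (auto simp: a_def b_def mcarr)
  have "a * b = One"
    by (intro ent_eqI) (simp_all add: a_def b_def msimps c(1-3) eM uw ewe)
  then have ba: "b * a = One" by (rule mat_mult_left_right_inverse[OF aM bM])
  have "e * (b * (a * e)) = e * (b * a) * e" using aM bM eM(1) by (simp add: massoc mcarr)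
  also have "\<dots> = e" using ba eM by (simp add: mring)
  finally have 1: "e * (b * (a * e)) = e" .
  have "e * (b * (a * e)) = w * (e * (u * e))"
    by (intro ent_eqI) (simp_all add: a_def b_def msimps c(1-3) eM ewe)
  then have "u * (w * (e * (u * e))) = u * e" using 1 by simp
  then have "e * (u * e) = u * e" using uw c(2) eM by (simp add: mcarr)
  then show ?thesis using c(2) by (auto simp: Par_def u_def)
qed

subsection \<open>The standard idempotents\<close>

definition Ej :: "nat \<Rightarrow> 'a mat" where
  "Ej j = mat n n (\<lambda>(i,k). if i = k \<and> i < j then 1 else 0)"

lemma Ej_Mn: "Ej j \<in> Mn"
  by (simp add: Ej_def)

lemma Ej_mult_left:
  assumes "A \<in> Mn" "i < n" "k < n"
  shows "(Ej j * A) $$ (i,k) = (if i < j then A $$ (i,k) else 0)"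
proof -
  have "(Ej j * A) $$ (i,k) = (\<Sum>l<n. Ej j $$ (i,l) * A $$ (l,k))"
    using assms by (auto simp: scalar_prod_def lessThan_atLeast0 Ej_def)
  also have "\<dots> = (\<Sum>l<n. if l = i then (if i < j then A $$ (l,k) else 0) else 0)"
    using assms by (intro sum.cong) (auto simp: Ej_def)
  finally show ?thesis using assms by simp
qed

lemma Ej_mult_right:
  assumes "A \<in> Mn" "i < n" "k < n"
  shows "(A * Ej j) $$ (i,k) = (if k < j then A $$ (i,k) else 0)"
proof -
  have "(A * Ej j) $$ (i,k) = (\<Sum>l<n. A $$ (i,l) * Ej j $$ (l,k))"
    using assms by (auto simp: scalar_prod_def lessThan_atLeast0 Ej_def)
  also have "\<dots> = (\<Sum>l<n. if l = k then (if k < j then A $$ (i,l) else 0) else 0)"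
    using assms by (intro sum.cong) (auto simp: Ej_def)
  finally show ?thesis using assms by simp
qed

lemma Ej_idem: "Ej j * Ej j = Ej j"
proof (rule eq_matI)
  fix i k assume "i < dim_row (Ej j)" "k < dim_col (Ej j)"
  then have "i < n" "k < n" by (auto simp: Ej_def)
  then show "(Ej j * Ej j) $$ (i,k) = Ej j $$ (i,k)"
    by (simp only: Ej_mult_left[OF Ej_Mn]) (auto simp: Ej_def)
qed (auto simp: Ej_def)

lemma all_index_cong:
  "(\<And>i k. i < n \<Longrightarrow> k < n \<Longrightarrow> P i k = Q i k) \<Longrightarrow> (\<forall>i<n. \<forall>k<n. P i k) = (\<forall>i<n. \<forall>k<n. Q i k)"
  by auto

lemma Rad_Ej_iff: "X \<in> Rad (Ej j) \<longleftrightarrow> X \<in> Mn \<and> (\<forall>i<n. \<forall>k<n. \<not> (i < j \<and> j \<le> k) \<longrightarrow> X $$ (i,k) = 0)"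
proof -
  have "X \<in> Rad (Ej j) \<longleftrightarrow> X \<in> Mn \<and> (\<forall>i<n. \<forall>k<n. (Ej j * X) $$ (i,k) = X $$ (i,k) \<and> (X * Ej j) $$ (i,k) = 0)"
    unfolding Rad_def by (auto simp del: index_mult_mat(1) intro!: eq_matI simp: Ej_def)
  also have "\<dots> \<longleftrightarrow> X \<in> Mn \<and> (\<forall>i<n. \<forall>k<n. \<not> (i < j \<and> j \<le> k) \<longrightarrow> X $$ (i,k) = 0)"
    by (intro conj_cong refl all_index_cong, simp only: Ej_mult_left Ej_mult_right) (auto split: if_splits)
  finally show ?thesis .
qed

lemma Par_Ej_iff: "X \<in> Par (Ej j) \<longleftrightarrow> X \<in> Mn \<and> (\<forall>i<n. \<forall>k<n. j \<le> i \<longrightarrow> k < j \<longrightarrow> X $$ (i,k) = 0)"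
proof -
  have "X \<in> Par (Ej j) \<longleftrightarrow> X \<in> Mn \<and> (\<forall>i<n. \<forall>k<n. (Ej j * (X * Ej j)) $$ (i,k) = (X * Ej j) $$ (i,k))"
    unfolding Par_def by (auto simp del: index_mult_mat(1) intro!: eq_matI simp: Ej_def)
  also have "\<dots> \<longleftrightarrow> X \<in> Mn \<and> (\<forall>i<n. \<forall>k<n. j \<le> i \<longrightarrow> k < j \<longrightarrow> X $$ (i,k) = 0)"
    by (intro conj_cong refl all_index_cong, simp only: Ej_mult_left Ej_mult_right Ej_Mn mcarr)
      (auto split: if_splits)
  finally show ?thesis .
qed

lemma Rad_compl_iff:
  assumes e: "e \<in> Mn"
  shows "X \<in> Rad (One - e) \<longleftrightarrow> X \<in> Mn \<and> e * X = Zero \<and> X * e = X"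
proof (cases "X \<in> Mn")
  case X: True
  have *: "X - Y = X \<longleftrightarrow> Y = Zero" "X - Y = Zero \<longleftrightarrow> Y = X" if Y: "Y \<in> Mn" for Y
  proof -
    show "X - Y = X \<longleftrightarrow> Y = Zero"
    proof
      assume a: "X - Y = X"
      show "Y = Zero"
      proof (rule ent_eqI)
        fix i k assume ik: "i < n" "k < n"
        have "ent i k (X - Y) = ent i k X" using a by simp
        then show "ent i k Y = ent i k Zero" using X Y ik by (simp add: ents)
      qed (auto simp: Y)
    qed (use X in \<open>auto intro!: ent_eqI simp: ents\<close>)
    show "X - Y = Zero \<longleftrightarrow> Y = X"
    proof
      assume a: "X - Y = Zero"
      show "Y = X"
      proof (rule ent_eqI)
        fix i k assume ik: "i < n" "k < n"
        have "ent i k (X - Y) = ent i k Zero" using a by simp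
        then show "ent i k Y = ent i k X" using X Y ik by (simp add: ents)
      qed (auto simp: X Y)
    qed (use X in \<open>auto intro!: ent_eqI simp: ents\<close>)
  qed
  have "(One - e) * X = X - e * X" "X * (One - e) = X - X * e" using X e by (simp_all add: mring mcarr)
  then show ?thesis using *(1)[of "e * X"] *(2)[of "X * e"] X e by (simp add: Rad_def mcarr)
qed (simp add: Rad_def)

lemma Rad_compl_Ej_iff:
  "X \<in> Rad (One - Ej j) \<longleftrightarrow> X \<in> Mn \<and> (\<forall>i<n. \<forall>k<n. \<not> (j \<le> i \<and> k < j) \<longrightarrow> X $$ (i,k) = 0)"
proof -
  have "X \<in> Rad (One - Ej j) \<longleftrightarrow> X \<in> Mn \<and> (\<forall>i<n. \<forall>k<n. (Ej j * X) $$ (i,k) = 0 \<and> (X * Ej j) $$ (i,k) = X $$ (i,k))"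
    unfolding Rad_compl_iff[OF Ej_Mn]
    by (auto simp del: index_mult_mat(1) intro!: eq_matI simp: Ej_def)
  also have "\<dots> \<longleftrightarrow> X \<in> Mn \<and> (\<forall>i<n. \<forall>k<n. \<not> (j \<le> i \<and> k < j) \<longrightarrow> X $$ (i,k) = 0)"
    by (intro conj_cong refl all_index_cong, simp only: Ej_mult_left Ej_mult_right) (auto split: if_splits)
  finally show ?thesis .
qed

lemma Par_compl_Ej:
  assumes "X \<in> Par (One - Ej j)" "i < n" "k < n" "i < j" "j \<le> k"
  shows "X $$ (i,k) = 0"
proof -
  have X: "X \<in> Mn" "(One - Ej j) * (X * (One - Ej j)) = X * (One - Ej j)" using assms by (auto simp: Par_def)
  have "ent i k ((One - Ej j) * (X * (One - Ej j))) = ent i k (X * (One - Ej j))" using X by simp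
  then have "ent i k (Ej j * X) = ent i k (Ej j * (X * Ej j)) "
    using X(1) assms by (simp add: msimps Ej_Mn)
  then show ?thesis using X(1) assms
    by (simp del: index_mult_mat(1) add: ent_def Ej_mult_left Ej_mult_right Ej_Mn mcarr)
qed

lemma compl_idem:
  assumes "e \<in> Mn" "e * e = e"
  shows "(One - e) * (One - e) = One - e"
  using assms by (intro ent_eqI) (auto simp: msimps)

lemma compl_compl: "e \<in> Mn \<Longrightarrow> One - (One - e) = e"
  by (intro ent_eqI) (auto simp: msimps)

lemma splitting_Ej: assumes "j \<le> n" shows "splitting (Ej j)"
  unfolding splitting_def
proof (intro conjI ballI)
  show "bd 0 (Ej j)" by (auto simp: bd_def Ej_def vf.B_0 vf.B_1)
  fix x Y assume a: "x \<in> Par (Ej j)" "Y \<in> Rad (Ej j)"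
  have c: "x \<in> Mn" "Y \<in> Mn" using a by (auto simp: Par_def Rad_def)
  show "det (x + Y) = det x"
    by (rule det_block_upper[of _ n _ j]) (use a c assms in \<open>auto simp: Par_Ej_iff Rad_Ej_iff\<close>)
  show "char_poly (x + Y) = char_poly x" unfolding char_poly_def
    by (rule det_block_upper[of _ n _ j])
      (use a c assms in \<open>auto simp: Par_Ej_iff Rad_Ej_iff char_poly_matrix_def\<close>)
qed (auto simp: Ej_Mn Ej_idem)

lemma splitting_compl_Ej: assumes "j \<le> n" shows "splitting (One - Ej j)"
  unfolding splitting_def
proof (intro conjI ballI)
  show "bd 0 (One - Ej j)" using splittingD(3)[OF splitting_Ej[OF assms]] by (intro bd_diff bd_One) (auto simp: Ej_Mn)
  fix x Y assume a: "x \<in> Par (One - Ej j)" "Y \<in> Rad (One - Ej j)"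
  have c: "x \<in> Mn" "Y \<in> Mn" using a by (auto simp: Par_def Rad_def)
  show "det (x + Y) = det x"
    by (rule det_block_lower[of _ n _ j]) (use a c assms in \<open>auto simp: Par_compl_Ej Rad_compl_Ej_iff\<close>)
  show "char_poly (x + Y) = char_poly x" unfolding char_poly_def
    by (rule det_block_lower[of _ n _ j])
      (use a c assms in \<open>auto simp: Par_compl_Ej Rad_compl_Ej_iff char_poly_matrix_def\<close>)
qed (auto simp: Ej_Mn Ej_idem compl_idem mcarr)

subsection \<open>The Sylvester equation\<close>

lemma meval_pCons_0: "A \<in> Mn \<Longrightarrow> meval A (pCons 0 p) = A * meval A p"
  using meval_pCons[of A 0 p] meval_Mn[of A p] by (intro ent_eqI) (auto simp: msimps)

lemma mzero:
  "A \<in> Mn \<Longrightarrow> A - A = Zero" "A \<in> Mn \<Longrightarrow> A + Zero = A" "A \<in> Mn \<Longrightarrow> Zero + A = A"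
  "A \<in> Mn \<Longrightarrow> A - Zero = A"
  by (intro ent_eqI; simp add: msimps)+

text \<open>\<open>Q\<close> is the first-order Taylor term of \<open>p\<close> at \<open>x\<close> in direction \<open>Z\<close>; it differs from
  \<open>p'(x) Z\<close> by a commutator with \<open>x\<close>.\<close>

lemma taylor_rad:
  assumes e: "splitting e" and x: "x \<in> Par e" and Z: "Z \<in> Rad e"
    and b: "b \<ge> 0" "bd (- b) x" "bd t Z"
  shows "pge (- c) p \<Longrightarrow> degree p \<le> d \<Longrightarrow> \<exists>Q\<in>Rad e. \<exists>R\<in>Rad e.
    meval (x + Z) p = meval x p + Q \<and>
    Z * meval x p - meval x p * Z = Q * x - x * Q \<and>
    Q - meval x (pderiv p) * Z = R * x - x * R \<and>
    bd (t - c - int d * b) Q \<and> bd (t - c - int d * b) R"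
proof (induction p arbitrary: d)
  case 0
  note eM = splittingD(1)[OF e] and xM = Par_Mn[OF x] and ZM = Rad_Mn[OF Z]
  show ?case
    by (intro bexI[of _ Zero] conjI)
      (use eM xM ZM in \<open>simp_all add: meval_0 bd_Zero Rad_Zero mcarr mring mzero\<close>)
next
  case (pCons a p)
  note eM = splittingD(1)[OF e] and xM = Par_Mn[OF x] and ZM = Rad_Mn[OF Z]
  note pM = meval_Mn[OF xM, of p] and dM = meval_Mn[OF xM, of "pderiv p"]
  show ?case
  proof (cases "p = 0")
    case True
    then have "meval (x + Z) (pCons a p) = meval x (pCons a p)"
      using xM ZM by (simp add: meval_const mcarr)
    moreover have "pderiv (pCons a p) = 0" using True by (simp add: pderiv_pCons)
    ultimately show ?thesis using True xM ZM eM
      by (intro bexI[of _ Zero] conjI)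
        (simp_all add: meval_0 meval_const bd_Zero Rad_Zero mcarr mring mzero)
  next
    case False
    then obtain d' where d: "d = Suc d'" "degree p \<le> d'" using pCons by (cases d) auto
    from pCons.IH[OF _ d(2)] pCons.prems obtain Q R where Q: "Q \<in> Rad e" and R: "R \<in> Rad e"
      and 1: "meval (x + Z) p = meval x p + Q"
      and 2: "Z * meval x p - meval x p * Z = Q * x - x * Q"
      and 3: "Q - meval x (pderiv p) * Z = R * x - x * R"
      and bQ: "bd (t - c - int d' * b) Q" and bR: "bd (t - c - int d' * b) R"
      by (auto simp: pge_pCons)
    note QM = Rad_Mn[OF Q] and RM = Rad_Mn[OF R]
    \<comment> \<open>The Horner step from \<open>p\<close> to \<open>a + t p\<close>: expanding
      \<open>(x + Z) (p(x) + Q)\<close> gives \<open>Q'\<close>. The commutator relation for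
      \<open>Z p(x) - p(x) Z\<close>, carried along in the induction, makes the error in the product
      rule again a commutator, namely with \<open>R'\<close>.\<close>
    define Q' where "Q' = Z * meval x p + x * Q"
    define R' where "R' = Q + x * R"
    have bd': "t - c - int d * b = - b + (t - c - int d' * b)" by (simp add: d algebra_simps)
    have le: "t - c - int d * b \<le> t - c - int d' * b" using b(1) by (simp add: d algebra_simps)
    have com: "meval x p * x = x * meval x p" by (rule meval_commute[OF xM])
    \<comment> \<open>The reason why the expansion is exact after the linear term.\<close>
    have ZQ: "Z * Q = Zero" by (rule Rad_mult_Zero[OF eM Z Q])
    show ?thesis
    proof (rule bexI[of _ Q'], rule bexI[of _ R'], intro conjI)
      show "Q' \<in> Rad e" unfolding Q'_def
        using Rad_Par_left[OF eM x Q] Rad_Par_right[OF eM Par_meval[OF e x] Z] by (intro Rad_add eM)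
      show "R' \<in> Rad e" unfolding R'_def using Rad_Par_left[OF eM x R] Q by (intro Rad_add eM)
      show "meval (x + Z) (pCons a p) = meval x (pCons a p) + Q'"
        using xM ZM QM pM unfolding Q'_def
        by (intro ent_eqI) (auto simp: meval_pCons 1 msimps ZQ algebra_simps)
      show "Z * meval x (pCons a p) - meval x (pCons a p) * Z = Q' * x - x * Q'"
      proof (rule ent_eqI)
        fix i j assume ij: "i < n" "j < n"
        have "ent i j (x * (Z * meval x p - meval x p * Z)) = ent i j (x * (Q * x - x * Q))" using 2 by simp
        then have "ent i j (x * (Z * meval x p)) - ent i j (x * (meval x p * Z))
            = ent i j (x * (Q * x)) - ent i j (x * (x * Q))"
          using xM ZM QM pM ij by (simp add: msimps)
        then show "ent i j (Z * meval x (pCons a p) - meval x (pCons a p) * Z) = ent i j (Q' * x - x * Q')"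
          using xM ZM QM pM ij unfolding Q'_def by (simp add: meval_pCons msimps com algebra_simps)
      qed (use xM ZM QM pM in \<open>auto simp: Q'_def mcarr meval_pCons\<close>)
      show "Q' - meval x (pderiv (pCons a p)) * Z = R' * x - x * R'"
      proof (rule ent_eqI)
        fix i j assume ij: "i < n" "j < n"
        have "ent i j (x * (Q - meval x (pderiv p) * Z)) = ent i j (x * (R * x - x * R))" using 3 by simp
        then have e3: "ent i j (x * Q) - ent i j (x * (meval x (pderiv p) * Z))
            = ent i j (x * (R * x)) - ent i j (x * (x * R))"
          using xM ZM QM RM dM ij by (simp add: msimps)
        have "ent i j (Z * meval x p - meval x p * Z) = ent i j (Q * x - x * Q)" using 2 by simp
        then have "ent i j (Z * meval x p) - ent i j (meval x p * Z) = ent i j (Q * x) - ent i j (x * Q)"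
          using xM ZM QM pM ij by (simp add: msimps)
        then show "ent i j (Q' - meval x (pderiv (pCons a p)) * Z) = ent i j (R' * x - x * R')"
          using e3 xM ZM QM RM pM dM ij unfolding Q'_def R'_def
          by (simp add: pderiv_pCons meval_add meval_pCons_0 msimps algebra_simps)
      qed (use xM ZM QM RM pM dM in \<open>auto simp: Q'_def R'_def mcarr meval_Mn\<close>)
      have 4: "bd (t - c - int d * b) (x * Q)" "bd (t - c - int d * b) (x * R)"
        unfolding bd' by (rule bd_mult[OF xM QM b(2) bQ] bd_mult[OF xM RM b(2) bR])+
      have "bd (- c - int d' * b) (meval x p)" using pCons.prems d xM b by (intro bd_meval) (auto simp: pge_pCons)
      then have "bd (t + (- c - int d' * b)) (Z * meval x p)" using ZM pM b by (intro bd_mult)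
      then have 5: "bd (t - c - int d * b) (Z * meval x p)" by (rule bd_mono) (use le in simp)
      show "bd (t - c - int d * b) Q'" unfolding Q'_def using 4 5 xM ZM pM QM
        by (intro bd_add mcarr)
      show "bd (t - c - int d * b) R'" unfolding R'_def using 4 xM RM QM bd_mono[OF bQ le]
        by (intro bd_add mcarr)
    qed
  qed
qed

text \<open>If \<open>Z\<close> commutes with \<open>x\<close>, the correction by a commutator
  disappears and the linear term is the usual one.\<close>

lemma taylor_commuting:
  assumes e: "splitting e" and x: "x \<in> Par e" and Z: "Z \<in> Rad e" and com: "Z * x = x * Z"
  shows "meval (x + Z) p = meval x p + meval x (pderiv p) * Z"
proof (induction p)
  case 0
  note xM = Par_Mn[OF x] and ZM = Rad_Mn[OF Z]
  show ?case using xM ZM by (intro ent_eqI) (auto simp: meval_0 msimps)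
next
  case (pCons a p)
  note eM = splittingD(1)[OF e] and xM = Par_Mn[OF x] and ZM = Rad_Mn[OF Z]
  note pM = meval_Mn[OF xM, of p] and dM = meval_Mn[OF xM, of "pderiv p"]
  have c: "Z * meval x q = meval x q * Z" for q
  proof (induction q)
    case (pCons a q)
    note qM = meval_Mn[OF xM, of q]
    have "Z * (x * meval x q) = Z * x * meval x q" using xM ZM qM by (simp add: massoc)
    also have "\<dots> = x * (Z * meval x q)" unfolding com using xM ZM qM by (simp add: massoc)
    also have "\<dots> = x * (meval x q * Z)" using pCons.IH by simp
    finally show ?case using xM ZM qM by (simp add: meval_pCons mring mcarr)
  qed (use ZM in \<open>simp add: meval_0 mring\<close>)
  have z: "Z * (meval x (pderiv p) * Z) = Zero"
    by (rule Rad_mult_Zero[OF eM Z Rad_Par_left[OF eM Par_meval[OF e x] Z]])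
  have 1: "meval (x + Z) (pCons a p) = a \<cdot>\<^sub>m One + (x + Z) * (meval x p + meval x (pderiv p) * Z)"
    using pCons.IH xM ZM by (simp add: meval_pCons mcarr)
  have 2: "meval x (pderiv (pCons a p)) = meval x p + x * meval x (pderiv p)"
    using xM by (simp add: pderiv_pCons meval_add meval_pCons_0)
  show ?case unfolding 1 2 using xM ZM pM dM
    by (intro ent_eqI) (simp_all add: meval_pCons msimps z c algebra_simps)
qed

text \<open>Take \<open>Z = V Y\<close>, so that \<open>p'(x) Z = Y\<close>. Adding a radical
  element does not change the characteristic polynomial \<open>p\<close>, so Cayley-Hamilton kills
  both \<open>p(x)\<close> and \<open>p(x + Z)\<close>, and the linear term \<open>Q\<close> is
  zero. The relation between \<open>Q\<close> and \<open>p'(x) Z\<close> is then a Sylvester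
  equation for \<open>Y\<close>, solved by \<open>- R\<close>.\<close>

lemma sylvester_solve:
  assumes e: "splitting e" and x: "x \<in> Par e" and b: "b \<ge> 0" "bd (- b) x" and c: "pge (- c) (char_poly x)"
    and V: "V \<in> Par e" "bd v V" "V * meval x (pderiv (char_poly x)) = One"
    and Y: "Y \<in> Rad e" "bd t Y"
  shows "\<exists>X\<in>Rad e. X * x - x * X = Y \<and> bd (v + t - c - int n * b) X"
proof -
  note eM = splittingD(1)[OF e] and xM = Par_Mn[OF x] and VM = Par_Mn[OF V(1)] and YM = Rad_Mn[OF Y(1)]
  let ?p = "char_poly x"
  have Z: "V * Y \<in> Rad e" by (rule Rad_Par_left[OF eM V(1) Y(1)])
  have bZ: "bd (v + t) (V * Y)" using VM YM V Y by (intro bd_mult)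
  have deg: "degree ?p \<le> n" using degree_monic_char_poly[OF xM] by simp
  from taylor_rad[OF e x Z b bZ c deg] obtain Q R where QR: "Q \<in> Rad e" "R \<in> Rad e"
    "meval (x + V * Y) ?p = meval x ?p + Q"
    "Q - meval x (pderiv ?p) * (V * Y) = R * x - x * R" "bd (v + t - c - int n * b) R" by blast
  have "char_poly (x + V * Y) = ?p" by (rule splittingD(5)[OF e x Z])
  then have "meval (x + V * Y) ?p = Zero" using cayley_hamilton[of "x + V * Y"] xM VM YM by (simp add: mcarr)
  then have Q0: "Q = Zero" using QR(3) cayley_hamilton[OF xM] Rad_Mn[OF QR(1)] by (simp add: left_add_zero_mat)
  have dM: "meval x (pderiv ?p) \<in> Mn" by (rule meval_Mn[OF xM])
  have "meval x (pderiv ?p) * V = One" by (rule mat_mult_left_right_inverse[OF VM dM V(3)])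
  then have "meval x (pderiv ?p) * (V * Y) = Y" using VM YM dM by (simp add: massoc[symmetric] mring(10))
  then have eq: "Zero - Y = R * x - x * R" using QR(4) Q0 by simp
  show ?thesis
  proof (intro bexI[of _ "- R"] conjI)
    show "- R * x - x * - R = Y"
    proof (rule ent_eqI)
      fix i j assume ij: "i < n" "j < n"
      have "ent i j (Zero - Y) = ent i j (R * x - x * R)" using eq by simp
      then show "ent i j (- R * x - x * - R) = ent i j Y"
        using ij xM YM Rad_Mn[OF QR(2)] by (simp add: msimps algebra_simps)
    qed (use xM YM Rad_Mn[OF QR(2)] in \<open>auto simp: mcarr\<close>)
    show "- R \<in> Rad e" by (rule Rad_uminus[OF eM QR(2)])
    show "bd (v + t - c - int n * b) (- R)" by (rule bd_uminus[OF Rad_Mn[OF QR(2)] QR(5)])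
  qed
qed

text \<open>The same comparison of \<open>p(x)\<close> and \<open>p(x + X)\<close>, now with the
  exact linear term, yields \<open>p'(x) X = 0\<close>.\<close>

lemma sylvester_unique:
  assumes e: "splitting e" and x: "x \<in> Par e"
    and V: "V \<in> Mn" "V * meval x (pderiv (char_poly x)) = One" and X: "X \<in> Rad e" "X * x = x * X"
  shows "X = Zero"
proof -
  note xM = Par_Mn[OF x] and XM = Rad_Mn[OF X(1)]
  let ?p = "char_poly x"
  have dM: "meval x (pderiv ?p) \<in> Mn" by (rule meval_Mn[OF xM])
  have "char_poly (x + X) = ?p" by (rule splittingD(5)[OF e x X(1)])
  then have "meval (x + X) ?p = Zero" using cayley_hamilton[of "x + X"] xM XM by (simp add: mcarr)
  then have "meval x (pderiv ?p) * X = Zero"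
    using taylor_commuting[OF e x X, of ?p] cayley_hamilton[OF xM] dM XM by (simp add: left_add_zero_mat mcarr)
  then have "V * (meval x (pderiv ?p) * X) = Zero" using V by (simp add: mring)
  then show ?thesis using V dM XM by (simp add: massoc[symmetric] mring(10))
qed

lemma pge_char_poly_matrix:
  assumes "x \<in> Mn" "bd (- b) x" "b \<ge> 0" "i < n" "j < n"
  shows "pge (- b) (char_poly_matrix x $$ (i,j))"
proof -
  have "pge (- b) 1" by (rule pf.B_mono[OF pf.B_1]) (use assms in simp)
  moreover have "vge (- b) (- x $$ (i,j))" using assms by (auto simp: bd_def intro: vf.B_uminus)
  ultimately show ?thesis using assms by (auto simp: char_poly_matrix_def pge_pCons pf.B_0)
qed

lemma pge_char_poly: "x \<in> Mn \<Longrightarrow> bd (- b) x \<Longrightarrow> b \<ge> 0 \<Longrightarrow> pge (- (int n * b)) (char_poly x)"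
  unfolding char_poly_def by (intro pf.B_det[of _ n] pge_char_poly_matrix) auto

lemma pge_char_poly_diff:
  assumes "x \<in> Mn" "y \<in> Mn" "bd (- b) x" "bd (- b) y" "b \<ge> 0" "bd s (x - y)"
  shows "pge (s - int n * b) (char_poly x - char_poly y)"
  unfolding char_poly_def
proof (rule pf.B_det_diff)
  fix i j assume ij: "i < n" "j < n"
  have "char_poly_matrix x $$ (i,j) - char_poly_matrix y $$ (i,j) = - [:x $$ (i,j) - y $$ (i,j):]"
    using assms ij by (auto simp: char_poly_matrix_def)
  moreover have "pge s [:x $$ (i,j) - y $$ (i,j):]" using assms ij by (auto simp: pge_pCons bd_def pf.B_0)
  ultimately show "pge s (char_poly_matrix x $$ (i,j) - char_poly_matrix y $$ (i,j))"
    by (simp add: pf.B_uminus del: minus_pCons)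
qed (use assms pge_char_poly_matrix in auto)

text \<open>The precision lost in solving a Sylvester equation.\<close>

definition kap :: "int \<Rightarrow> int" where "kap \<rho> = 7 * int n * int n * \<rho>"

lemma n_sq: "\<rho> \<ge> 0 \<Longrightarrow> int n * \<rho> \<le> int n * int n * \<rho>" "\<rho> \<ge> 0 \<Longrightarrow> \<rho> \<le> int n * int n * \<rho>"
proof -
  assume r: "\<rho> \<ge> 0"
  have "int n * 1 \<le> int n * int n" using n_pos by (intro mult_left_mono) auto
  from mult_right_mono[OF this r] show 1: "int n * \<rho> \<le> int n * int n * \<rho>" by simp
  have "1 * \<rho> \<le> int n * \<rho>" using n_pos r by (intro mult_right_mono) auto
  then show "\<rho> \<le> int n * int n * \<rho>" using 1 by simp
qed

lemma kap_ge: "\<rho> \<ge> 0 \<Longrightarrow> kap \<rho> \<ge> 7 * \<rho>"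
  using n_sq(2)[of \<rho>] by (simp add: kap_def)

text \<open>The discriminant is controlled at \<open>x\<close> only, while the derivative has to be
  inverted at the nearby \<open>y\<close>. The Bezout identity of the characteristic polynomial of
  \<open>x\<close> is carried over to that of \<open>y\<close> with an error that the precision
  \<open>s\<close> makes smaller than the resultant. Membership of \<open>V\<close> in
  \<open>Par e\<close> ensures that multiplication by \<open>V\<close> preserves
  \<open>Rad e\<close>.\<close>

lemma derivative_inverse:
  assumes x: "x \<in> Mn" "bd (- \<rho>) x" "\<rho> \<ge> 0" "Delta x \<noteq> 0" "val (Delta x) \<le> \<rho>"
    and y: "y \<in> Par e" "splitting e" "bd (- \<rho>) y" "bd s (y - x)" "s \<ge> 1 + kap \<rho>"
  shows "\<exists>V\<in>Par e. bd (- (5 * int n * int n * \<rho>)) V \<and> V * meval y (pderiv (char_poly y)) = One"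
proof -
  note eM = splittingD(1)[OF y(2)] and yM = Par_Mn[OF y(1)]
  let ?p = "char_poly x" and ?q = "char_poly y"
  let ?D = "resultant ?p (pderiv ?p)"
  let ?m = "2 * int n * int n * \<rho>"
  have deg: "degree ?p = n" "lead_coeff ?p = 1" using degree_monic_char_poly[OF x(1)] by auto
  have D: "?D \<noteq> 0" "val ?D \<le> \<rho>"
  proof -
    have "Delta x = ?D \<or> Delta x = - ?D"
      using deg(2) by (cases "even (degree ?p * (degree ?p - 1) div 2)") (auto simp: Delta_def discr_def)
    then show "?D \<noteq> 0" "val ?D \<le> \<rho>" using x by (auto simp: val_uminus)
  qed
  have dd: "degree (pderiv ?p) < n"
    using deg n_pos degree_pderiv_le[of ?p] by simp
  have A: "degree ?p + degree (pderiv ?p) = n + degree (pderiv ?p)" "n + degree (pderiv ?p) > 0"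
    "pge (- (int n * \<rho>)) ?p" "pge (- (int n * \<rho>)) (pderiv ?p)" "int n * \<rho> \<ge> 0"
    using deg n_pos x(3) pge_char_poly[OF x(1-3)] pge_pderiv by auto
  from resultant_bezout[OF A] obtain r u where ru: "r * ?p + u * pderiv ?p = [:?D:]"
    "pge (- (int (n + degree (pderiv ?p)) * (int n * \<rho>))) r" "pge (- (int (n + degree (pderiv ?p)) * (int n * \<rho>))) u"
    "degree r < n + degree (pderiv ?p)" "degree u < n + degree (pderiv ?p)" by blast
  have le: "int (n + degree (pderiv ?p)) * (int n * \<rho>) \<le> ?m"
  proof -
    have "int (n + degree (pderiv ?p)) * (int n * \<rho>) \<le> (2 * int n) * (int n * \<rho>)"
      using dd x(3) by (intro mult_right_mono) auto
    then show ?thesis by (simp add: algebra_simps)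
  qed
  have ru': "pge (- ?m) r" "pge (- ?m) u" "degree r < 2 * n" "degree u < 2 * n"
    using ru(2-5) le dd by (auto intro: pf.B_mono)
  define h where "h = ?q - ?p"
  have h: "pge (s - int n * \<rho>) h" unfolding h_def by (rule pge_char_poly_diff) (use x y yM in auto)
  have degh: "degree h \<le> n" unfolding h_def
    using deg degree_monic_char_poly[OF yM] by (intro degree_diff_le) auto
  define eta where "eta = r * h + u * pderiv h"
  have "pge (- ?m + (s - int n * \<rho>)) eta"
    unfolding eta_def using ru' h by (intro pf.B_add pf.B_mult pge_pderiv)
  then have eta: "pge (- (?m - (s - int n * \<rho>))) eta" by simp
  have degeta: "degree eta \<le> 3 * n"
  proof -
    have "degree (r * h) \<le> 3 * n" using degree_mult_le[of r h] ru' degh by simp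
    moreover have "degree (u * pderiv h) \<le> 3 * n"
      using degree_mult_le[of u "pderiv h"] ru' degh degree_pderiv_le[of h] by simp
    ultimately show ?thesis unfolding eta_def by (rule degree_add_le)
  qed
  have id: "r * ?q + u * pderiv ?q = [:?D:] + eta"
  proof -
    have "?q = ?p + h" by (simp add: h_def)
    then show ?thesis unfolding eta_def by (simp add: pderiv_add algebra_simps flip: ru(1))
  qed
  let ?c = "inverse ?D"
  have vc: "vge (- \<rho>) ?c" using D by (auto simp: vge_def val_inverse)
  \<comment> \<open>By Cayley-Hamilton the multiple of \<open>?q\<close> vanishes at
    \<open>y\<close>, so \<open>W\<close> is the identity up to \<open>eta\<close> divided by the
    resultant; it therefore lies in \<open>Ks 1\<close>.\<close>
  define W where "W = ?c \<cdot>\<^sub>m (meval y u * meval y (pderiv ?q))"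
  have "meval y (r * ?q + u * pderiv ?q) = meval y ([:?D:] + eta)" using id by simp
  then have "meval y u * meval y (pderiv ?q) = ?D \<cdot>\<^sub>m One + meval y eta"
    using yM cayley_hamilton[OF yM]
    by (simp add: meval_add meval_mult meval_const meval_Mn mring mcarr left_add_zero_mat)
  then have W: "W = One + ?c \<cdot>\<^sub>m meval y eta"
    using yM D(1) unfolding W_def by (intro ent_eqI) (auto simp: msimps meval_Mn algebra_simps)
  have WM: "W \<in> Mn" using yM by (simp add: W_def mcarr meval_Mn)
  have "bd (- (?m - (s - int n * \<rho>)) - int (3 * n) * \<rho>) (meval y eta)"
    by (rule bd_meval[OF yM y(3) x(3) eta degeta])
  then have "bd (- \<rho> + (- (?m - (s - int n * \<rho>)) - int (3 * n) * \<rho>)) (?c \<cdot>\<^sub>m meval y eta)"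
    using vc yM by (intro bd_smult) (auto simp: meval_Mn)
  then have "bd 1 (?c \<cdot>\<^sub>m meval y eta)"
  proof (rule bd_mono)
    show "1 \<le> - \<rho> + (- (?m - (s - int n * \<rho>)) - int (3 * n) * \<rho>)"
      using n_sq[OF x(3)] y(5) by (simp add: kap_def algebra_simps)
  qed
  moreover have "W - One = ?c \<cdot>\<^sub>m meval y eta"
    unfolding W using yM by (intro ent_eqI) (auto simp: msimps meval_Mn)
  ultimately have WK: "W \<in> Ks 1" using WM by (simp add: Ks_def)
  have WG: "W \<in> Gn" "bd 0 (minv n W)" using Ks_GL[OF _ WK] GL_O_bd(2)[OF Ks_GL_O[OF _ WK]] by auto
  have mu: "meval y u \<in> Par e" "meval y (pderiv ?q) \<in> Par e" using Par_meval y by auto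
  have WP: "W \<in> Par e" unfolding W_def using mu eM by (intro Par_smult Par_mult)
  show ?thesis
  proof (intro bexI[of _ "minv n W * (?c \<cdot>\<^sub>m meval y u)"] conjI)
    show "minv n W * (?c \<cdot>\<^sub>m meval y u) \<in> Par e"
      using Par_minv[OF y(2) WP WG(1)] mu eM by (intro Par_mult Par_smult)
    show "minv n W * (?c \<cdot>\<^sub>m meval y u) * meval y (pderiv ?q) = One"
    proof -
      have "minv n W * (?c \<cdot>\<^sub>m meval y u) * meval y (pderiv ?q) = minv n W * W"
        using WG(1) yM unfolding W_def by (simp add: massoc mring gsimps mcarr meval_Mn)
      then show ?thesis using WG by (simp add: gsimps)
    qed
    \<comment> \<open>The losses are \<open>2 n^2 \<rho>\<close> from the Bezout coefficients,
      \<open>2 n \<rho>\<close> from evaluation in degree below \<open>2 n\<close>, and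
      \<open>\<rho>\<close> from dividing by the resultant; together at most
      \<open>5 n^2 \<rho>\<close>.\<close>
    have "bd (- ?m - int (2 * n) * \<rho>) (meval y u)"
      by (rule bd_meval[OF yM y(3) x(3) ru'(2)]) (use ru'(4) in simp)
    then have "bd (- \<rho> + (- ?m - int (2 * n) * \<rho>)) (?c \<cdot>\<^sub>m meval y u)"
      using vc yM by (intro bd_smult) (auto simp: meval_Mn)
    then have "bd (0 + (- \<rho> + (- ?m - int (2 * n) * \<rho>))) (minv n W * (?c \<cdot>\<^sub>m meval y u))"
      using WG yM by (intro bd_mult) (auto simp: gsimps mcarr meval_Mn)
    then show "bd (- (5 * int n * int n * \<rho>)) (minv n W * (?c \<cdot>\<^sub>m meval y u))"
      by (rule bd_mono) (use n_sq[OF x(3)] in \<open>simp add: algebra_simps\<close>)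
  qed
qed

lemma sylvester_near:
  assumes x: "x \<in> Mn" "bd (- \<rho>) x" "\<rho> \<ge> 0" "Delta x \<noteq> 0" "val (Delta x) \<le> \<rho>"
    and y: "y \<in> Par e" "splitting e" "bd (- \<rho>) y" "bd s (y - x)" "s \<ge> 1 + kap \<rho>"
  shows "Y \<in> Rad e \<Longrightarrow> bd t Y \<Longrightarrow> \<exists>X\<in>Rad e. X * y - y * X = Y \<and> bd (t - kap \<rho>) X"
    and "X \<in> Rad e \<Longrightarrow> X * y = y * X \<Longrightarrow> X = Zero"
proof -
  obtain V where V: "V \<in> Par e" "bd (- (5 * int n * int n * \<rho>)) V" "V * meval y (pderiv (char_poly y)) = One"
    using derivative_inverse[OF x y] by blast
  show "X \<in> Rad e \<Longrightarrow> X * y = y * X \<Longrightarrow> X = Zero"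
    by (rule sylvester_unique[OF y(2,1) Par_Mn[OF V(1)] V(3)])
  assume Y: "Y \<in> Rad e" "bd t Y"
  have c: "pge (- (int n * \<rho>)) (char_poly y)" by (rule pge_char_poly[OF Par_Mn[OF y(1)] y(3) x(3)])
  \<comment> \<open>Origin of the 7 in \<open>kap\<close>: 5 for the inverse of the derivative and
    at most 1 each for the coefficients of the characteristic polynomial and for its evaluation in
    degree \<open>n\<close>.\<close>
  have "t - kap \<rho> \<le> - (5 * int n * int n * \<rho>) + t - int n * \<rho> - int n * \<rho>"
    using n_sq[OF x(3)] by (simp add: kap_def algebra_simps)
  then show "\<exists>X\<in>Rad e. X * y - y * X = Y \<and> bd (t - kap \<rho>) X"
    using sylvester_solve[OF y(2,1) x(3) y(3) c V Y] bd_mono by blast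
qed

subsection \<open>Lifting an approximately stable subspace\<close>

text \<open>If \<open>e y (1 - e)\<close> is very small, Newton iteration for the quadratic equation
  \<open>(1 - e) (1 + T) y (1 - T) e = 0\<close> converges, because its linear part is a Sylvester operator.\<close>

lemma newton_stable:
  assumes e: "splitting e" and e': "splitting (One - e)"
    and y: "y \<in> Mn" "bd (- \<rho>) y" "\<rho> \<ge> 0" "Delta y \<noteq> 0" "val (Delta y) \<le> \<rho>"
    and s: "bd s (e * y * (One - e))" "s \<ge> 2 * kap \<rho> + \<rho> + 1"
  shows "\<exists>T\<in>Rad (One - e). bd (- (kap \<rho> + \<rho>)) T \<and> (One + T) * y * (One - T) \<in> Par e"
proof -
  note eM = splittingD(1)[OF e]
  define f where "f = One - e"
  have fM: "f \<in> Mn" using eM by (simp add: f_def mcarr)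
  \<comment> \<open>\<open>u\<close> is the tiny block, in the direction of \<open>Rad e\<close>.
    The opposite block \<open>l\<close> has no smallness and is the one to be removed; without
    \<open>u\<close> the matrix is block triangular for \<open>f\<close>.\<close>
  define u where "u = e * y * f"
  define l where "l = f * y * e"
  define z where "z = y - u"
  have uM: "u \<in> Mn" and lM: "l \<in> Mn" and zM: "z \<in> Mn" using y eM fM by (auto simp: u_def l_def z_def mcarr)
  have kap0: "kap \<rho> \<ge> 0" using kap_ge[OF y(3)] y(3) by simp
  have bu: "bd s u" using s by (simp add: u_def f_def)
  have bz: "bd (- \<rho>) z" unfolding z_def using y uM bd_mono[OF bu] s(2) kap0 by (intro bd_diff) auto
  have zy: "bd s (z - y)"
  proof -
    have "z - y = - u" using uM y by (intro ent_eqI) (auto simp: z_def msimps)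
    then show ?thesis using bu uM by (simp add: bd_uminus)
  qed
  note eids = splittingD(2)[OF e] splittingD(4)[OF e]
  have zP: "z \<in> Par f" unfolding z_def u_def f_def using y eM
    by (intro ParI ent_eqI) (simp_all add: msimps eids)
  have lR: "l \<in> Rad f" unfolding f_def Rad_compl_iff[OF eM] l_def using y eM
    by (auto simp: mring mcarr eids mzero)
  have RadD: "T \<in> Mn" "e * T = Zero" "T * e = T" "\<And>X. X \<in> Mn \<Longrightarrow> e * (T * X) = Zero"
    "\<And>X. X \<in> Mn \<Longrightarrow> T * (e * X) = T * X" if "T \<in> Rad f" for T
  proof -
    show T: "T \<in> Mn" "e * T = Zero" "T * e = T" using that Rad_compl_iff[OF eM] by (auto simp: f_def)
    show "e * (T * X) = Zero" if "X \<in> Mn" for X using T that eM massoc[of e T X] by (simp add: mring)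
    show "T * (e * X) = T * X" if "X \<in> Mn" for X using T that eM massoc[of T e X] by (simp add: mring)
  qed
  \<comment> \<open>For \<open>T\<close> in \<open>Rad f\<close> this is minus the block
    \<open>f (1 + T) y (1 - T) e\<close>. The linear part may be written with \<open>z\<close>
    because \<open>T z\<close> and \<open>z T\<close> are the parts \<open>T y e\<close> and
    \<open>f y T\<close> of that block.\<close>
  define res where "res T = T * (y * T) - l - (T * z - z * T)" for T
  have resR: "res T \<in> Rad f" if "T \<in> Rad f" for T
  proof -
    have "T * (y * T) \<in> Rad f"
      unfolding f_def Rad_compl_iff[OF eM] using RadD[OF that] y eM by (auto simp: mring mcarr)
    then show ?thesis unfolding res_def using Rad_Par_left[OF fM zP that] Rad_Par_right[OF fM zP that] lR
      by (intro Rad_diff fM)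
  qed
  have cross: "A * (y * B) = A * (u * B)" if "A \<in> Rad f" "B \<in> Rad f" for A B
  proof -
    have "u * B = e * (y * B)" using RadD[OF that(2)] y eM uM
      by (simp add: u_def f_def mring mcarr mzero)
    then show ?thesis using RadD[OF that(1)] RadD(1)[OF that(2)] y by (simp add: mcarr)
  qed
  have diff: "res (T + d) = res T + (d * (u * T) + T * (u * d) + d * (u * d)) - (d * z - z * d)"
    if "T \<in> Rad f" "d \<in> Rad f" for T d
  proof -
    note TM = RadD(1)[OF that(1)] and dM = RadD(1)[OF that(2)]
    show ?thesis unfolding res_def cross[OF that, symmetric] cross[OF that(2,1), symmetric] cross[OF that(2,2), symmetric]
      using TM dM y zM lM by (intro ent_eqI) (simp_all add: msimps algebra_simps)
  qed
  \<comment> \<open>The iterates need not be small, only bounded by \<open>c\<close>: every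
    quadratic term contains a factor \<open>u\<close>, whose precision \<open>s\<close> pays for the
    size of \<open>T\<close> and for the loss in the Sylvester equation.\<close>
  define c where "c = kap \<rho> + \<rho>"
  have c0: "c \<ge> 0" using kap0 y(3) by (simp add: c_def)
  have cross_bd: "bd (k + s - c) (A * (u * B) + B * (u * A) + A * (u * A))"
    if "A \<in> Rad f" "B \<in> Rad f" "bd k A" "bd (- c) A" "bd (- c) B" for A B k
  proof -
    note AM = RadD(1)[OF that(1)] and BM = RadD(1)[OF that(2)]
    have 1: "bd (k + (s + - c)) (A * (u * B))" "bd (k + (s + - c)) (A * (u * A))"
      using AM BM uM that bu by (auto intro!: bd_mult mcarr simp del: add_uminus_conv_diff)
    have "bd (- c + (s + k)) (B * (u * A))"
      by (intro bd_mult AM BM uM mcarr that bu)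
    then have "bd (k + (s + - c)) (B * (u * A))" by (simp add: algebra_simps)
    then have "bd (k + (s + - c)) (A * (u * B) + B * (u * A) + A * (u * A))"
      using 1 by (intro bd_add mcarr AM BM uM)
    then show ?thesis by (simp add: algebra_simps)
  qed
  have s': "s \<ge> 1 + kap \<rho>" using s(2) kap0 y(3) by simp
  note syl = sylvester_near(1)[OF y zP e'[folded f_def] bz zy s']
  let ?inv = "\<lambda>k T. T \<in> Rad f \<and> bd (- c) T \<and> bd (- \<rho> + int k) (res T)"
  \<comment> \<open>The linear part stays frozen at \<open>z\<close> during the iteration, so each
    step is only guaranteed to gain one digit, which suffices.\<close>
  have "\<exists>g. \<forall>k. ?inv k (g k) \<and> bd (- c + int k) (g (Suc k) - g k)"
  proof (rule dependent_nat_choice)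
    have "res Zero = - l" using y zM lM unfolding res_def by (intro ent_eqI) (auto simp: msimps)
    moreover have "bd (0 + - \<rho> + 0) l" unfolding l_def
      using splittingD(3)[OF e] splittingD(3)[OF e'] y eM by (intro bd_mult3) (auto simp: f_def mcarr)
    ultimately show "\<exists>T. ?inv 0 T" using lM fM by (intro exI[of _ Zero]) (auto simp: bd_Zero Rad_Zero bd_uminus)
    fix T k assume T: "?inv k T"
    obtain d where d: "d \<in> Rad f" "d * z - z * d = res T" "bd (- \<rho> + int k - kap \<rho>) d"
      using syl[OF resR, of T "- \<rho> + int k"] T by auto
    have dc: "bd (- c + int k) d" using d(3) by (simp add: c_def algebra_simps)
    have dc0: "bd (- c) d" by (rule bd_mono[OF dc]) simp
    note M = RadD(1)[OF d(1)] RadD(1)[of T]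
    have "res (T + d) = d * (u * T) + T * (u * d) + d * (u * d)"
      using diff[of T d] T d M uM Rad_Mn[OF resR[of T]] by (intro ent_eqI) (auto simp: msimps)
    moreover have "bd (- c + int k + s - c) (d * (u * T) + T * (u * d) + d * (u * d))"
      by (rule cross_bd) (use T d dc dc0 in auto)
    \<comment> \<open>With \<open>c = kap \<rho> + \<rho>\<close> this inequality is exactly the
      assumed lower bound on \<open>s\<close>.\<close>
    moreover have "- \<rho> + int (Suc k) \<le> - c + int k + s - c" using s(2) by (simp add: c_def)
    ultimately have "bd (- \<rho> + int (Suc k)) (res (T + d))" using bd_mono by simp
    moreover have "bd (- c) (T + d)" using T dc0 M by (intro bd_add) auto
    moreover have "T + d - T = d" using T M by (intro ent_eqI) (auto simp: msimps)
    ultimately show "\<exists>T'. ?inv (Suc k) T' \<and> bd (- c + int k) (T' - T)"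
      using T d(1) dc fM by (intro exI[of _ "T + d"]) (auto simp: Rad_add)
  qed
  then obtain g where g: "\<And>k. g k \<in> Rad f" "\<And>k. bd (- c) (g k)" "\<And>k. bd (- \<rho> + int k) (res (g k))"
    "\<And>k. bd (- c + int k) (g (Suc k) - g k)" by blast
  note gM = RadD(1)[OF g(1)]
  obtain T where TM: "T \<in> Mn" and T: "\<And>k. bd (- c + int k) (T - g k)"
    using bd_complete[OF gM g(4)] by blast
  have deep: "X = Zero" if X: "X \<in> Mn" "\<And>k. bd (a + int k) X" for X a
  proof (rule bd_deep)
    show "\<forall>l. bd l (X - Zero)"
    proof
      fix l
      have "bd l X" by (rule bd_mono[OF X(2)[of "nat (l - a)"]]) simp
      then show "bd l (X - Zero)" using X by (simp add: mzero)
    qed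
  qed (use X in \<open>auto simp: mcarr\<close>)
  have TR: "T \<in> Rad f"
  proof -
    have "e * T = Zero"
    proof (rule deep[of _ "- c"])
      fix k
      have "e * T = e * (T - g k)" using TM gM[of k] eM RadD(2)[OF g(1)[of k]] by (simp add: mring mzero mcarr)
      moreover have "bd (0 + (- c + int k)) (e * (T - g k))"
        using splittingD(3)[OF e] TM gM[of k] eM T[of k] by (intro bd_mult mcarr)
      ultimately show "bd (- c + int k) (e * T)" by simp
    qed (use TM eM in \<open>auto simp: mcarr\<close>)
    moreover have "T * e - T = Zero"
    proof (rule deep[of _ "- c"])
      fix k
      have "T * e - T = (T - g k) * e - (T - g k)"
        using TM gM[of k] eM RadD(3)[OF g(1)[of k]] by (intro ent_eqI) (auto simp: msimps)
      moreover have "bd ((- c + int k) + 0) ((T - g k) * e)"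
        using splittingD(3)[OF e] TM gM[of k] eM T[of k] by (intro bd_mult mcarr)
      ultimately show "bd (- c + int k) (T * e - T)" using TM gM[of k] eM T[of k]
        by (simp add: bd_diff mcarr)
    qed (use TM eM in \<open>auto simp: mcarr\<close>)
    then have "T * e = T"
    proof -
      assume a: "T * e - T = Zero"
      show ?thesis
      proof (rule ent_eqI)
        fix i j assume "i < n" "j < n"
        then show "ent i j (T * e) = ent i j T"
          using arg_cong[OF a, of "ent i j"] TM eM by (simp add: ents mcarr)
      qed (use TM eM in \<open>auto simp: mcarr\<close>)
    qed
    ultimately show ?thesis unfolding f_def Rad_compl_iff[OF eM] using TM by simp
  qed
  have Tc: "bd (- c) T"
  proof -
    have "T = (T - g 0) + g 0" using TM gM[of 0] by (intro ent_eqI) (auto simp: msimps)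
    moreover have "bd (- c) ((T - g 0) + g 0)" using T[of 0] g(2)[of 0] TM gM[of 0] by (intro bd_add) (auto simp: mcarr)
    ultimately show ?thesis by simp
  qed
  have "res T = Zero"
  proof (rule deep[of _ "- c - \<rho>"])
    show "res T \<in> Mn" using Rad_Mn[OF resR[OF TR]] .
    fix k
    define d where "d = T - g k"
    have d: "d \<in> Rad f" unfolding d_def by (rule Rad_diff[OF fM TR g(1)])
    note dM = RadD(1)[OF d] and rM = Rad_Mn[OF resR[OF g(1)[of k]]]
    have dk: "bd (- c + int k) d" using T by (simp add: d_def)
    have dc: "bd (- c) d" by (rule bd_mono[OF dk]) simp
    have "g k + d = T" unfolding d_def using TM gM[of k] by (intro ent_eqI) (auto simp: msimps)
    then have "res T = res (g k) + (d * (u * g k) + g k * (u * d) + d * (u * d)) - (d * z - z * d)"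
      using diff[OF g(1)[of k] d] by simp
    moreover have "bd (- c - \<rho> + int k) (res (g k))" by (rule bd_mono[OF g(3)]) (use c0 in simp)
    moreover have "bd (- c - \<rho> + int k) (d * (u * g k) + g k * (u * d) + d * (u * d))"
      by (rule bd_mono[OF cross_bd[OF d g(1) dk dc g(2)]]) (use s(2) c0 y(3) kap0 in \<open>simp add: c_def\<close>)
    moreover have "bd (- c - \<rho> + int k) (d * z - z * d)"
    proof -
      have "bd (- c + int k + - \<rho>) (d * z)" "bd (- \<rho> + (- c + int k)) (z * d)"
        by (rule bd_mult[OF dM zM dk bz] bd_mult[OF zM dM bz dk])+
      then have "bd (- c - \<rho> + int k) (d * z)" "bd (- c - \<rho> + int k) (z * d)" by (simp_all add: algebra_simps)
      then show ?thesis by (intro bd_diff mcarr dM zM)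
    qed
    ultimately show "bd (- c - \<rho> + int k) (res T)"
      using dM uM zM gM[of k] rM by (simp add: bd_diff bd_add mcarr)
  qed
  have "(One + T) * y * (One - T) \<in> Par e"
  proof (rule ParI[OF eM])
    show "(One + T) * y * (One - T) \<in> Mn" using TM y by (simp add: mcarr)
    note R = RadD[OF TR]
    show "e * ((One + T) * y * (One - T) * e) = (One + T) * y * (One - T) * e"
    proof (rule ent_eqI)
      fix i j assume ij: "i < n" "j < n"
      have "ent i j (res T) = 0" using \<open>res T = Zero\<close> ij by (simp add: ents)
      then show "ent i j (e * ((One + T) * y * (One - T) * e)) = ent i j ((One + T) * y * (One - T) * e)"
        using ij y eM R unfolding res_def z_def u_def l_def f_def
        by (simp add: msimps R eids algebra_simps)
    qed (use TM y eM in \<open>auto simp: mcarr\<close>)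
  qed
  then show ?thesis using TR Tc by (auto simp: c_def f_def)
qed

text \<open>An element close to 1 has an invertible diagonal block on the image of \<open>e\<close>,
  and one elimination step with its inverse clears the block below. \<open>A\<close> is this block
  completed by the identity, which puts it into \<open>Ks s\<close>.\<close>

lemma block_LU:
  assumes e: "e \<in> Mn" "e * e = e" "bd 0 e" and k: "k \<in> Ks s" "s \<ge> 1"
  shows "\<exists>T\<in>Rad (One - e). \<exists>p\<in>Par e. bd s T \<and> p \<in> Ks s \<and> k = (One + T) * p"
proof -
  have kM: "k \<in> Mn" "bd s (k - One)" using k by (auto simp: Ks_def)
  have eids: "\<And>X. X \<in> Mn \<Longrightarrow> e * (e * X) = e * X" using e by (simp add: massoc[symmetric])
  define A where "A = e * k * e + (One - e)"
  have AM: "A \<in> Mn" using e kM by (simp add: A_def mcarr)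
  have be': "bd 0 (One - e)" using e by (intro bd_diff bd_One) (auto simp: mcarr)
  have "A - One = e * (k - One) * e"
    using e kM by (intro ent_eqI) (auto simp: A_def msimps)
  moreover have "bd (0 + s + 0) (e * (k - One) * e)" using e kM by (intro bd_mult3) (auto simp: mcarr)
  ultimately have A: "A \<in> Ks s" using AM by (simp add: Ks_def)
  note AG = Ks_GL[OF k(2) A]
  define B where "B = minv n A"
  have B: "B \<in> Mn" "bd 0 B" "A * B = One" "B * A = One"
    using GL_O_bd(2)[OF Ks_GL_O[OF k(2) A]] AG by (auto simp: B_def gsimps)
  have Ae: "A * e = e * (k * e)" "e * A = e * (k * e)"
    using e kM by (auto simp: A_def mring mcarr eids mzero intro!: ent_eqI) 
  have Be: "e * B = B * e"
  proof -
    have "B * (A * e) * B = B * (e * A) * B" using Ae by simp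
    moreover have "B * (A * e) * B = e * B" using B(1,4) AM e massoc[of B A "e * B"] by (simp add: massoc mcarr mring)
    moreover have "B * (e * A) * B = B * e" using B(1,3) AM e by (simp add: massoc mcarr mring)
    ultimately show ?thesis by simp
  qed
  define T where "T = (One - e) * (k * (e * B))"
  have TM: "T \<in> Mn" using e kM B by (simp add: T_def mcarr)
  have TR: "T \<in> Rad (One - e)"
    unfolding Rad_compl_iff[OF e(1)]
  proof (intro conjI TM)
    show "e * T = Zero" unfolding T_def using e kM B(1) by (simp add: mring mcarr eids mzero)
    have "T * e = (One - e) * (k * (e * (B * e)))" unfolding T_def using e kM B(1) by (simp add: massoc mcarr)
    also have "B * e = e * B" using Be by simp
    also have "e * (e * B) = e * B" using B(1) by (rule eids)
    finally show "T * e = T" by (simp add: T_def)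
  qed
  have T_bd: "bd s T"
  proof -
    have "T = (One - e) * (k - One) * (e * B)"
      using e kM B(1) eids by (intro ent_eqI) (auto simp: T_def msimps)
    moreover have "bd (0 + s + (0 + 0)) ((One - e) * (k - One) * (e * B))"
      using e kM B be' by (intro bd_mult3 bd_mult mcarr)
    ultimately show ?thesis by simp
  qed
  have T0: "T * T = Zero"
    by (rule Rad_mult_Zero[OF _ TR TR]) (use e in \<open>simp add: mcarr\<close>)
  have TK: "One - T \<in> Ks s"
  proof -
    have "One - T - One = - T" using TM by (intro ent_eqI) (auto simp: msimps)
    then show ?thesis using TM T_bd by (simp add: Ks_def bd_uminus mcarr)
  qed
  define p where "p = (One - T) * k"
  have pM: "p \<in> Mn" using TM kM by (simp add: p_def mcarr)
  have "(One + T) * p = ((One + T) * (One - T)) * k" using TM kM by (simp add: p_def massoc mcarr)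
  also have "(One + T) * (One - T) = One" using TM T0 by (intro ent_eqI) (auto simp: msimps)
  finally have kp: "k = (One + T) * p" using kM by (simp add: mring)
  have "e * (p * e) = p * e"
  proof -
    have eT: "e * T = Zero" "T * e = T" using TR Rad_compl_iff[OF e(1)] by auto
    have "T * (k * e) = T * (e * (k * e))"
      using eT(2) TM kM e massoc[of T e "k * e"] by (simp add: mcarr)
    also have "\<dots> = T * (A * e)" using Ae by simp
    also have "\<dots> = (One - e) * (k * (e * (B * (A * e))))"
      unfolding T_def using e kM B(1) AM by (simp add: massoc mcarr)
    also have "B * (A * e) = e" using B AM e massoc[of B A e] by (simp add: mring)
    finally have Tke: "T * (k * e) = (One - e) * (k * e)" using e by simp
    have eTX: "e * (T * X) = Zero" if "X \<in> Mn" for X using that eT TM e massoc[of e T X] by (simp add: mring)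
    have "p * e = k * e - T * (k * e)" using TM kM e by (simp add: p_def mring mcarr)
    also have "\<dots> = e * (k * e)" unfolding Tke using kM e by (intro ent_eqI) (auto simp: msimps)
    finally have "p * e = e * (k * e)" .
    then show ?thesis using kM e eids by (simp add: mcarr)
  qed
  then have "p \<in> Par e" using pM e by (simp add: ParI)
  moreover have "p \<in> Ks s" unfolding p_def using TK k by (intro Ks_mult) auto
  ultimately show ?thesis using TR T_bd kp by blast
qed

subsection \<open>Cartan decomposition\<close>

lemma GL_OI: "g \<in> Mn \<Longrightarrow> h \<in> Mn \<Longrightarrow> g * h = One \<Longrightarrow> bd 0 g \<Longrightarrow> bd 0 h \<Longrightarrow> g \<in> GL_O val n"
  using inverse_GL[of g h] by (auto simp: GL_O_iff)

text \<open>The second clause says that each pivot divides everything to the right of it and below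
  it. At the end it orders the diagonal entries by valuation, as the Cartan decomposition
  requires.\<close>

definition diag_upto :: "nat \<Rightarrow> 'a mat \<Rightarrow> bool" where
  "diag_upto r h \<longleftrightarrow> (\<forall>i<n. \<forall>k<n. i \<noteq> k \<longrightarrow> i < r \<or> k < r \<longrightarrow> h $$ (i,k) = 0) \<and>
     (\<forall>i<r. \<forall>p<n. \<forall>q<n. i \<le> p \<longrightarrow> i \<le> q \<longrightarrow> vge (val (h $$ (i,i))) (h $$ (p,q)))"

lemma GL_row_nonzero:
  assumes h: "h \<in> Gn" and r: "r < n"
  shows "\<exists>k<n. h $$ (r,k) \<noteq> 0"
proof (rule ccontr)
  assume "\<not> ?thesis"
  then have "(h * minv n h) $$ (r,r) = 0"
    using h r GL_Mn[OF h] minv_Mn[OF h] by (auto simp: scalar_prod_def)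
  then show False using h r by (simp add: gsimps)
qed

lemma unip_single_GL_O:
  assumes T: "T \<in> Mn" "bd 0 T" "T * T = Zero"
  shows "One + T \<in> GL_O val n"
proof (rule GL_OI[of _ "One - T"])
  show "(One + T) * (One - T) = One" using T by (intro ent_eqI) (auto simp: msimps)
  show "bd 0 (One + T)" "bd 0 (One - T)" using T by (auto intro!: bd_add bd_diff bd_One mcarr)
qed (use T in \<open>auto simp: mcarr\<close>)

text \<open>An entry of least valuation in the remaining block is moved to \<open>(r,r)\<close> by
  one row and one column transposition. Both fix all indices below \<open>r\<close>, so the earlier
  pivots survive.\<close>

lemma diag_upto_pivot:
  assumes h: "h \<in> Gn" "diag_upto r h" and r: "r < n"
  shows "\<exists>k1\<in>GL_O val n. \<exists>k2\<in>GL_O val n. diag_upto r (k1 * h * k2) \<and> (k1 * h * k2) $$ (r,r) \<noteq> 0 \<and>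
     (\<forall>i k. r \<le> i \<longrightarrow> r \<le> k \<longrightarrow> i < n \<longrightarrow> k < n \<longrightarrow> vge (val ((k1 * h * k2) $$ (r,r))) ((k1 * h * k2) $$ (i,k)))"
proof -
  note hM = GL_Mn[OF h(1)]
  define S where "S = {pq \<in> {r..<n} \<times> {r..<n}. h $$ pq \<noteq> 0}"
  have fin: "finite S" unfolding S_def by (rule finite_subset[of _ "{r..<n} \<times> {r..<n}"]) auto
  obtain k where k: "k < n" "h $$ (r,k) \<noteq> 0" using GL_row_nonzero[OF h(1) r] by blast
  have "r \<le> k" using h(2) r k by (cases "r \<le> k") (auto simp: diag_upto_def)
  then have ne: "S \<noteq> {}" using k r by (auto simp: S_def)
  obtain pq where pq: "pq \<in> S" "\<And>x. x \<in> S \<Longrightarrow> val (h $$ pq) \<le> val (h $$ x)"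
    using ex_min_if_finite[of "(\<lambda>x. val (h $$ x)) ` S"] fin ne by (auto simp: not_less)
  obtain p q where pqeq: "pq = (p,q)" by (cases pq)
  have p: "r \<le> p" "p < n" "r \<le> q" "q < n" "h $$ (p,q) \<noteq> 0" using pq(1) by (auto simp: S_def pqeq)
  have swO: "swaprows_mat n r l \<in> GL_O val n" if "l < n" for l
    by (rule GL_OI[OF _ _ swaprows_mat_inv]) (use r that in \<open>auto simp: bd_def vf.B_0 vf.B_1\<close>)
  define P :: "'a mat" where "P = swaprows_mat n r p"
  define Q :: "'a mat" where "Q = swaprows_mat n r q"
  have PQ: "P \<in> GL_O val n" "Q \<in> GL_O val n" "P \<in> Mn" "Q \<in> Mn"
    using swO p unfolding P_def Q_def by auto
  define sw where "sw l i = (if i = r then l else if i = l then r else i)" for l i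
  have sw: "sw l i < n" "i < r \<Longrightarrow> sw l i = i" "i \<ge> r \<Longrightarrow> sw l i \<ge> r" "sw l r = l"
    "sw l i = sw l k \<Longrightarrow> i = k"
    if "r \<le> l" "l < n" "i < n" for l i k
    using that r by (auto simp: sw_def split: if_splits)
  have entry: "(P * h * Q) $$ (i,k) = h $$ (sw p i, sw q k)" if ik: "i < n" "k < n" for i k
  proof -
    have Qe: "Q $$ (l,k) = (if l = sw q k then 1 else 0)" if "l < n" for l
      using that ik p r unfolding Q_def sw_def by auto
    have Pe: "P $$ (i,l) = (if l = sw p i then 1 else 0)" if "l < n" for l
      using that ik p r unfolding P_def sw_def by auto
    have 1: "(P * h) $$ (i,l) = h $$ (sw p i, l)" if l: "l < n" for l
    proof -
      have "(P * h) $$ (i,l) = (\<Sum>t<n. P $$ (i,t) * h $$ (t,l))"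
        using PQ hM ik l by (auto simp: scalar_prod_def lessThan_atLeast0)
      also have "\<dots> = (\<Sum>t<n. if t = sw p i then h $$ (t,l) else 0)"
        by (intro sum.cong) (auto simp: Pe)
      finally show ?thesis using l sw(1)[of p i] p ik by simp
    qed
    have "(A * Q) $$ (i,k) = (\<Sum>t<n. A $$ (i,t) * Q $$ (t,k))" if "A \<in> Mn" for A
      using PQ that ik by (auto simp: scalar_prod_def lessThan_atLeast0)
    from this[of "P * h"] have "(P * h * Q) $$ (i,k) = (\<Sum>t<n. (P * h) $$ (i,t) * Q $$ (t,k))"
      using PQ hM by (simp only: mcarr)
    also have "\<dots> = (\<Sum>t<n. if t = sw q k then (P * h) $$ (i,t) else 0)"
      by (intro sum.cong) (auto simp: Qe simp del: index_mult_mat(1))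
    also have "\<dots> = (P * h) $$ (i, sw q k)" using sw(1)[of q k] p ik by (simp del: index_mult_mat(1))
    finally show ?thesis using 1[of "sw q k"] sw(1)[of q k] p ik by simp
  qed
  let ?h = "P * h * Q"
  have rr: "?h $$ (r,r) = h $$ (p,q)" using entry[OF r r] by (simp add: sw_def)
  have h0: "h $$ (i,k) = 0" if "i < n" "k < n" "i \<noteq> k" "i < r \<or> k < r" for i k
    using h(2) that by (auto simp: diag_upto_def)
  have hb: "vge (val (h $$ (i,i))) (h $$ (s,t))" if "i < r" "s < n" "t < n" "i \<le> s" "i \<le> t" for i s t
    using h(2) that by (auto simp: diag_upto_def)
  have "diag_upto r ?h" unfolding diag_upto_def
  proof (intro conjI allI impI)
    fix i k assume ik: "i < n" "k < n" "i \<noteq> k" "i < r \<or> k < r"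
    have "sw p i \<noteq> sw q k \<and> (sw p i < r \<or> sw q k < r)"
      using sw(2)[of p i] sw(2)[of q k] sw(3)[of p i] sw(3)[of q k] p ik by (metis leD not_le)
    then show "?h $$ (i,k) = 0"
      using h0[of "sw p i" "sw q k"] sw(1)[of p i] sw(1)[of q k] p ik by (simp add: entry del: index_mult_mat(1))
  next
    fix i s t assume a: "i < r" "s < n" "t < n" "i \<le> s" "i \<le> t"
    have "sw p i = i" "sw q i = i" using sw(2)[of p i] sw(2)[of q i] a p by auto
    moreover have "i \<le> sw p s" "i \<le> sw q t"
      using sw(2)[of p s] sw(3)[of p s] sw(2)[of q t] sw(3)[of q t] a p by (metis leI less_imp_le order.trans)+
    ultimately show "vge (val (?h $$ (i,i))) (?h $$ (s,t))"
      using hb[of i "sw p s" "sw q t"] sw(1)[of p s] sw(1)[of q t] a p r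
      by (simp add: entry del: index_mult_mat(1))
  qed
  moreover have "vge (val (?h $$ (r,r))) (?h $$ (i,k))" if "r \<le> i" "r \<le> k" "i < n" "k < n" for i k
  proof -
    have "sw p i \<in> {r..<n}" "sw q k \<in> {r..<n}" using sw(1,3)[of p i] sw(1,3)[of q k] p that by auto
    then have "h $$ (sw p i, sw q k) \<noteq> 0 \<Longrightarrow> val (h $$ (p,q)) \<le> val (h $$ (sw p i, sw q k))"
      using pq(2)[of "(sw p i, sw q k)"] by (auto simp: S_def pqeq)
    then show ?thesis using that unfolding rr by (auto simp: entry vge_def simp del: index_mult_mat(1))
  qed
  moreover have "?h $$ (r,r) \<noteq> 0" using rr p by simp
  ultimately show ?thesis using PQ by blast
qed

text \<open>Minimality of the pivot makes all quotients integral. Clearing column and row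
  \<open>r\<close> is then multiplication by \<open>1 + T\<close> and \<open>1 + S\<close> with
  \<open>T\<close> and \<open>S\<close> integral of square zero.\<close>

lemma diag_upto_eliminate:
  assumes h: "h \<in> Mn" "diag_upto r h" and r: "r < n" "h $$ (r,r) \<noteq> 0"
    and min: "\<And>i k. r \<le> i \<Longrightarrow> r \<le> k \<Longrightarrow> i < n \<Longrightarrow> k < n \<Longrightarrow> vge (val (h $$ (r,r))) (h $$ (i,k))"
  shows "\<exists>k1\<in>GL_O val n. \<exists>k2\<in>GL_O val n. diag_upto (Suc r) (k1 * h * k2)"
proof -
  define c where "c i = - (h $$ (i,r) / h $$ (r,r))" for i
  define d where "d k = - (h $$ (r,k) / h $$ (r,r))" for k
  have quot: "vge 0 (- (x / h $$ (r,r)))" if "vge (val (h $$ (r,r))) x" for x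
  proof -
    have "vge (val (h $$ (r,r)) + - val (h $$ (r,r))) (x * inverse (h $$ (r,r)))"
      using r by (intro vf.B_mult that) (simp add: vge_def val_inverse)
    then show ?thesis by (auto simp: divide_inverse intro: vf.B_uminus)
  qed
  have c: "vge 0 (c i)" if "r \<le> i" "i < n" for i unfolding c_def by (rule quot) (use that min r in auto)
  have d: "vge 0 (d i)" if "r \<le> i" "i < n" for i unfolding d_def by (rule quot) (use that min r in auto)
  define T where "T = mat n n (\<lambda>(i,k). if k = r \<and> i > r then c i else 0)"
  define S where "S = mat n n (\<lambda>(i,k). if i = r \<and> k > r then d k else 0)"
  have TM: "T \<in> Mn" "S \<in> Mn" by (auto simp: T_def S_def)
  have Tmul: "(T * A) $$ (i,k) = (if i > r then c i * A $$ (r,k) else 0)" if "A \<in> Mn" "i < n" "k < n" for A i k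
  proof -
    have "(T * A) $$ (i,k) = (\<Sum>l<n. T $$ (i,l) * A $$ (l,k))"
      using that by (auto simp: T_def scalar_prod_def lessThan_atLeast0)
    also have "\<dots> = (\<Sum>l<n. if l = r then (if i > r then c i * A $$ (r,k) else 0) else 0)"
      using that by (intro sum.cong) (auto simp: T_def)
    finally show ?thesis using r by simp
  qed
  have Smul: "(A * S) $$ (i,k) = (if k > r then A $$ (i,r) * d k else 0)" if "A \<in> Mn" "i < n" "k < n" for A i k
  proof -
    have "(A * S) $$ (i,k) = (\<Sum>l<n. A $$ (i,l) * S $$ (l,k))"
      using that by (auto simp: S_def scalar_prod_def lessThan_atLeast0)
    also have "\<dots> = (\<Sum>l<n. if l = r then (if k > r then A $$ (i,r) * d k else 0) else 0)"
      using that by (intro sum.cong) (auto simp: S_def)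
    finally show ?thesis using r by simp
  qed
  have "T * T = Zero"
    by (intro ent_eqI) (auto simp: ent_def Tmul TM mcarr T_def[symmetric] simp del: index_mult_mat(1), auto simp: T_def r)
  moreover have "bd 0 T" using c by (auto simp: bd_def T_def vf.B_0)
  ultimately have TO: "One + T \<in> GL_O val n" using TM by (intro unip_single_GL_O)
  have "S * S = Zero"
    by (intro ent_eqI) (auto simp: ent_def Smul TM mcarr simp del: index_mult_mat(1), auto simp: S_def r)
  moreover have "bd 0 S" using d by (auto simp: bd_def S_def vf.B_0)
  ultimately have SO: "One + S \<in> GL_O val n" using TM by (intro unip_single_GL_O)
  define h2 where "h2 = h + T * h"
  define h3 where "h3 = h2 + h2 * S"
  have h2M: "h2 \<in> Mn" "h3 \<in> Mn" using h TM by (auto simp: h2_def h3_def mcarr)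
  have h2: "h2 $$ (i,k) = h $$ (i,k) + (if i > r then c i * h $$ (r,k) else 0)" if "i < n" "k < n" for i k
    using that h TM Tmul[of h i k] by (simp add: h2_def del: index_mult_mat(1))
  have h3: "h3 $$ (i,k) = h2 $$ (i,k) + (if k > r then h2 $$ (i,r) * d k else 0)" if "i < n" "k < n" for i k
    using that h2M TM Smul[of h2 i k] by (simp add: h3_def del: index_mult_mat(1))
  have eq: "(One + T) * h * (One + S) = h3"
    unfolding h3_def h2_def using h TM by (intro ent_eqI) (auto simp: msimps)
  have cr: "h $$ (i,r) + c i * h $$ (r,r) = 0" for i using r by (simp add: c_def)
  have dr: "h $$ (r,k) + h $$ (r,r) * d k = 0" for k using r by (simp add: d_def)
  have h0: "h $$ (i,k) = 0" if "i < n" "k < n" "i \<noteq> k" "i < r \<or> k < r" for i k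
    using h(2) that by (auto simp: diag_upto_def)
  have diag: "h3 $$ (i,i) = h $$ (i,i)" if "i \<le> r" "i < n" for i
    using that r by (auto simp: h3 h2)
  have "diag_upto (Suc r) h3"
    unfolding diag_upto_def
  proof (intro conjI allI impI)
    fix i k assume ik: "i < n" "k < n" "i \<noteq> k" "i < Suc r \<or> k < Suc r"
    show "h3 $$ (i,k) = 0"
    proof (cases "i < r \<or> k < r")
      case True
      then show ?thesis using ik r h0[of i k] h0[of r k] h0[of i r] by (auto simp: h3 h2)
    next
      case False
      then have "(i = r \<and> k > r) \<or> (k = r \<and> i > r)" using ik by auto
      then show ?thesis using ik r cr[of i] dr[of k] by (auto simp: h3 h2)
    qed
  next
    fix i p q assume a: "i < Suc r" "p < n" "q < n" "i \<le> p" "i \<le> q"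
    let ?v = "val (h $$ (i,i))"
    have hb: "vge ?v (h $$ (p,q))" if "i \<le> p" "i \<le> q" "p < n" "q < n" for p q
      using that a h(2) min[of p q] by (cases "i = r") (auto simp: diag_upto_def)
    have h2b: "vge ?v (h2 $$ (p,q))" if "i \<le> p" "i \<le> q" "p < n" "q < n" for p q
      using that a r hb[of p q] hb[of r q] vf.B_mult[of 0 "c p" ?v "h $$ (r,q)"] c[of p]
      by (auto simp: h2 intro: vf.B_add)
    have "vge ?v (h3 $$ (p,q))"
      using a r h2b[of p q] h2b[of p r] vf.B_mult[of ?v "h2 $$ (p,r)" 0 "d q"] d[of q]
      by (auto simp: h3 intro: vf.B_add)
    then show "vge (val (h3 $$ (i,i))) (h3 $$ (p,q))" using diag[of i] a by simp
  qed
  then show ?thesis using TO SO eq by metis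
qed

definition dg :: "(nat \<Rightarrow> 'a) \<Rightarrow> 'a mat" where
  "dg d = mat n n (\<lambda>(i,k). if i = k then d i else 0)"

lemma dg_Mn: "dg d \<in> Mn"
  by (simp add: dg_def)

lemma dg_mult_left:
  assumes "A \<in> Mn" "i < n" "k < n"
  shows "(dg d * A) $$ (i,k) = d i * A $$ (i,k)"
proof -
  have "(dg d * A) $$ (i,k) = (\<Sum>l<n. dg d $$ (i,l) * A $$ (l,k))"
    using assms by (auto simp: dg_def scalar_prod_def lessThan_atLeast0)
  also have "\<dots> = (\<Sum>l<n. if l = i then d i * A $$ (i,k) else 0)"
    using assms by (intro sum.cong) (auto simp: dg_def)
  finally show ?thesis using assms by simp
qed

lemma dg_mult_right:
  assumes "A \<in> Mn" "i < n" "k < n"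
  shows "(A * dg d) $$ (i,k) = A $$ (i,k) * d k"
proof -
  have "(A * dg d) $$ (i,k) = (\<Sum>l<n. A $$ (i,l) * dg d $$ (l,k))"
    using assms by (auto simp: dg_def scalar_prod_def lessThan_atLeast0)
  also have "\<dots> = (\<Sum>l<n. if l = k then A $$ (i,k) * d k else 0)"
    using assms by (intro sum.cong) (auto simp: dg_def)
  finally show ?thesis using assms by simp
qed

lemma dg_inv:
  assumes "\<And>i. i < n \<Longrightarrow> d i \<noteq> 0"
  shows "dg d \<in> Gn" "minv n (dg d) = dg (\<lambda>i. inverse (d i))"
proof -
  have "dg d * dg (\<lambda>i. inverse (d i)) = One"
    by (rule ent_eqI) (use assms in \<open>auto simp: ent_def dg_mult_left dg_Mn mcarr simp del: index_mult_mat(1)\<close>,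
      auto simp: dg_def assms)
  then have "dg d \<in> Gn \<and> minv n (dg d) = dg (\<lambda>i. inverse (d i))" by (intro inverse_GL dg_Mn)
  then show "dg d \<in> Gn" "minv n (dg d) = dg (\<lambda>i. inverse (d i))" by auto
qed

lemma cartan_decomposition:
  assumes g: "g \<in> Gn"
  shows "\<exists>k1\<in>GL_O val n. \<exists>k2\<in>GL_O val n. \<exists>d. (\<forall>i<n. d i \<noteq> 0) \<and>
    (\<forall>k<n. \<forall>i\<le>k. val (d i) \<le> val (d k)) \<and> g = k1 * dg d * k2"
proof -
  have "\<exists>k1\<in>GL_O val n. \<exists>k2\<in>GL_O val n. diag_upto r (k1 * g * k2)" if "r \<le> n" for r
    using that
  proof (induction r)
    case 0
    show ?case by (intro bexI[of _ One]) (auto simp: diag_upto_def GL_O_One)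
  next
    case (Suc r)
    then obtain k1 k2 where k: "k1 \<in> GL_O val n" "k2 \<in> GL_O val n" "diag_upto r (k1 * g * k2)" by auto
    have hG: "k1 * g * k2 \<in> Gn" using k g by (simp add: GL_O_GL GL_mult)
    have rn: "r < n" using Suc by simp
    from diag_upto_pivot[OF hG k(3) rn] obtain l1 l2 where l: "l1 \<in> GL_O val n" "l2 \<in> GL_O val n"
      and p: "diag_upto r (l1 * (k1 * g * k2) * l2)" "(l1 * (k1 * g * k2) * l2) $$ (r,r) \<noteq> 0"
       "\<And>i k. r \<le> i \<Longrightarrow> r \<le> k \<Longrightarrow> i < n \<Longrightarrow> k < n \<Longrightarrow>
          vge (val ((l1 * (k1 * g * k2) * l2) $$ (r,r))) ((l1 * (k1 * g * k2) * l2) $$ (i,k))" by blast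
    note kM = GL_Mn[OF GL_O_GL[OF k(1)]] GL_Mn[OF GL_O_GL[OF k(2)]] GL_Mn[OF GL_O_GL[OF l(1)]] GL_Mn[OF GL_O_GL[OF l(2)]] GL_Mn[OF g]
    have "l1 * (k1 * g * k2) * l2 \<in> Mn" using kM by (simp add: mcarr)
    from diag_upto_eliminate[OF this p(1) rn p(2,3)] obtain m1 m2
      where m: "m1 \<in> GL_O val n" "m2 \<in> GL_O val n" "diag_upto (Suc r) (m1 * (l1 * (k1 * g * k2) * l2) * m2)" by blast
    have "m1 * (l1 * (k1 * g * k2) * l2) * m2 = (m1 * (l1 * k1)) * g * (k2 * (l2 * m2))"
      using kM GL_Mn[OF GL_O_GL[OF m(1)]] GL_Mn[OF GL_O_GL[OF m(2)]] by (simp add: massoc mcarr)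
    then show ?case using m k l by (metis GL_O_mult)
  qed
  then obtain k1 k2 where k: "k1 \<in> GL_O val n" "k2 \<in> GL_O val n" "diag_upto n (k1 * g * k2)" by blast
  define h where "h = k1 * g * k2"
  have kG: "k1 \<in> Gn" "k2 \<in> Gn" using k GL_O_GL by auto
  have hG: "h \<in> Gn" unfolding h_def using kG g by (simp add: GL_mult)
  define d where "d i = h $$ (i,i)" for i
  have hd: "h = dg d"
    using k(3) GL_Mn[OF hG] unfolding h_def[symmetric]
    by (intro ent_eqI dg_Mn) (auto simp: ent_def dg_def d_def diag_upto_def)
  have "g = minv n k1 * h * minv n k2" unfolding h_def using kG g by (simp add: massoc mcarr gsimps mring)
  moreover have d0: "\<forall>i<n. d i \<noteq> 0"
  proof (intro allI impI)
    fix i assume "i < n"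
    then obtain k where "k < n" "h $$ (i,k) \<noteq> 0" using GL_row_nonzero[OF hG] by blast
    then show "d i \<noteq> 0" using \<open>i < n\<close> k(3) unfolding h_def[symmetric]
      by (cases "i = k") (auto simp: d_def diag_upto_def)
  qed
  moreover have "\<forall>k<n. \<forall>i\<le>k. val (d i) \<le> val (d k)"
  proof (intro allI impI)
    fix k i assume "k < n" "i \<le> k"
    then have "vge (val (d i)) (d k)" using k(3) unfolding h_def[symmetric] by (simp add: diag_upto_def d_def)
    then show "val (d i) \<le> val (d k)" using d0 \<open>k < n\<close> by (simp add: vge_def)
  qed
  ultimately show ?thesis using k GL_O_minv unfolding hd by blast
qed

section \<open>Strongly expanding elements of a Levi subgroup\<close>

text \<open>Commuting with \<open>e\<close> places \<open>a\<close> in the Levi subgroup. For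
  \<open>M \<ge> 0\<close> the first bound, phrased with the inverse of \<open>a\<close>, says that
  \<open>a\<close> expands \<open>Rad e\<close> by at least \<open>M\<close>; the second says that
  it contracts the opposite radical.\<close>

definition contracting :: "'a mat \<Rightarrow> 'a mat \<Rightarrow> int \<Rightarrow> bool" where
  "contracting a e M \<longleftrightarrow> a \<in> Gn \<and> a * e = e * a \<and>
     (\<forall>Y\<in>Rad e. \<forall>t. bd t Y \<longrightarrow> bd (t + M) (minv n a * (Y * a))) \<and>
     (\<forall>T\<in>Rad (One - e). \<forall>t. bd t T \<longrightarrow> bd (t + M) (a * (T * minv n a)))"

lemma contracting_dg:
  assumes d: "\<And>i. i < n \<Longrightarrow> d i \<noteq> 0" and gap: "\<And>i k. i < j \<Longrightarrow> j \<le> k \<Longrightarrow> k < n \<Longrightarrow> val (d i) + M \<le> val (d k)"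
  shows "contracting (dg d) (Ej j) M"
  unfolding contracting_def
proof (intro conjI ballI allI impI)
  show "dg d \<in> Gn" using dg_inv(1)[of d] d by simp
  show "dg d * Ej j = Ej j * dg d"
    by (rule ent_eqI)
      (simp_all add: ent_def dg_mult_left dg_mult_right Ej_Mn dg_Mn mcarr del: index_mult_mat(1), simp add: Ej_def)
  have sh: "vge (t + M) (x * (c * inverse b))"
    if "vge t x" "b \<noteq> 0" "c \<noteq> 0" "val b + M \<le> val c" for t x b c
    by (rule vf.B_mult[OF that(1)]) (use that in \<open>auto simp: vge_def val_mult val_inverse\<close>)
  fix Y t assume Y: "bd t Y"
  {
    assume "Y \<in> Rad (Ej j)"
    then have YM: "Y \<in> Mn" and Y0: "\<And>i k. i < n \<Longrightarrow> k < n \<Longrightarrow> \<not> (i < j \<and> j \<le> k) \<Longrightarrow> Y $$ (i,k) = 0"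
      by (auto simp: Rad_Ej_iff)
    show "bd (t + M) (minv n (dg d) * (Y * dg d))"
      unfolding bd_def
    proof (intro allI impI)
      fix i k assume ik: "i < n" "k < n"
      have "(minv n (dg d) * (Y * dg d)) $$ (i,k) = Y $$ (i,k) * (d k * inverse (d i))"
        using ik YM d by (simp add: dg_inv(2) dg_mult_left dg_mult_right dg_Mn mcarr del: index_mult_mat(1))
      moreover have "vge (t + M) (Y $$ (i,k) * (d k * inverse (d i)))"
      proof (cases "i < j \<and> j \<le> k")
        case True
        then show ?thesis using Y ik d gap by (intro sh) (auto simp: bd_def)
      qed (use Y0 ik in \<open>simp add: vf.B_0\<close>)
      ultimately show "vge (t + M) ((minv n (dg d) * (Y * dg d)) $$ (i,k))" by simp
    qed
  }
  {
    assume "Y \<in> Rad (One - Ej j)"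
    then have YM: "Y \<in> Mn" and Y0: "\<And>i k. i < n \<Longrightarrow> k < n \<Longrightarrow> \<not> (j \<le> i \<and> k < j) \<Longrightarrow> Y $$ (i,k) = 0"
      by (auto simp: Rad_compl_Ej_iff)
    show "bd (t + M) (dg d * (Y * minv n (dg d)))"
      unfolding bd_def
    proof (intro allI impI)
      fix i k assume ik: "i < n" "k < n"
      have "(dg d * (Y * minv n (dg d))) $$ (i,k) = Y $$ (i,k) * (d i * inverse (d k))"
        using ik YM d by (simp add: dg_inv(2) dg_mult_left dg_mult_right dg_Mn mcarr del: index_mult_mat(1))
      moreover have "vge (t + M) (Y $$ (i,k) * (d i * inverse (d k)))"
      proof (cases "j \<le> i \<and> k < j")
        case True
        then show ?thesis using Y ik d gap by (intro sh) (auto simp: bd_def)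
      qed (use Y0 ik in \<open>simp add: vf.B_0\<close>)
      ultimately show "vge (t + M) ((dg d * (Y * minv n (dg d))) $$ (i,k))" by simp
    qed
  }
qed

lemma G_le_iff: "g \<in> G_le val n i \<longleftrightarrow> g \<in> Gn \<and> bd (- i) g \<and> val (det g) \<le> i"
proof (cases "g \<in> Gn")
  case g: True
  let ?S = "{- val (g $$ (i,j)) | i j. i < n \<and> j < n \<and> g $$ (i,j) \<noteq> 0}"
  have "?S \<subseteq> (\<lambda>(i,j). - val (g $$ (i,j))) ` ({..<n} \<times> {..<n})" by auto
  then have fin: "finite ?S" by (rule finite_subset) auto
  obtain k where k: "k < n" "g $$ (0,k) \<noteq> 0" using GL_row_nonzero[OF g, of 0] n_pos by auto
  have "- val (g $$ (0,k)) \<in> ?S"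
    by (rule CollectI, rule exI[of _ 0], rule exI[of _ k]) (use k n_pos in auto)
  then have ne: "?S \<noteq> {}" by blast
  have "(\<forall>x\<in>?S. x \<le> i) = bd (- i) g" by (fastforce simp: bd_def vge_def)
  then show ?thesis using g fin ne by (auto simp: G_le_def ov_G_def Max_le_iff)
qed (simp add: G_le_def)

text \<open>Without a gap of size \<open>M\<close> all diagonal valuations lie within
  \<open>n M\<close> of the first. Scaling the first to valuation 0 gives an integral multiple of
  \<open>g\<close> whose inverse is bounded by \<open>n M\<close>, so its determinant has valuation
  at most \<open>n^2 M\<close>. This explains the threshold for \<open>i\<close>.\<close>

lemma cartan_gap:
  assumes g: "g \<in> Gn" and M: "M \<ge> 0" and i: "i \<ge> int n * int n * M"
    and out: "\<And>c. c \<noteq> 0 \<Longrightarrow> c \<cdot>\<^sub>m g \<notin> G_le val n i"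
  shows "\<exists>j k1 a k2. 0 < j \<and> j < n \<and> k1 \<in> GL_O val n \<and> k2 \<in> GL_O val n \<and> contracting a (Ej j) M \<and> g = k1 * a * k2"
proof -
  obtain k1 k2 d where k: "k1 \<in> GL_O val n" "k2 \<in> GL_O val n" and d: "\<And>i. i < n \<Longrightarrow> d i \<noteq> 0"
    "\<And>i k. k < n \<Longrightarrow> i \<le> k \<Longrightarrow> val (d i) \<le> val (d k)" and gk: "g = k1 * dg d * k2"
    using cartan_decomposition[OF g] by blast
  show ?thesis
  proof (cases "\<exists>j. 0 < j \<and> j < n \<and> val (d (j - 1)) + M \<le> val (d j)")
    case True
    then obtain j where j: "0 < j" "j < n" "val (d (j - 1)) + M \<le> val (d j)" by blast
    have "contracting (dg d) (Ej j) M"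
    proof (rule contracting_dg)
      fix i k assume "i < j" "j \<le> k" "k < n"
      then show "val (d i) + M \<le> val (d k)" using d(2)[of "j - 1" i] d(2)[of k j] j by fastforce
    qed (use d in auto)
    then show ?thesis using j k gk by blast
  next
    case False
    have gap: "val (d i) \<le> val (d 0) + int i * M" if "i < n" for i
      using that
    proof (induction i)
      case (Suc i)
      then have "val (d (Suc i)) \<le> val (d i) + M" using False by (metis diff_Suc_1 linear zero_less_Suc)
      then show ?case using Suc by (auto simp: algebra_simps)
    qed simp
    have 0: "(0::nat) < n" using n_pos by simp
    define c where "c = scal (- val (d 0))"
    have c: "c \<noteq> 0" "val c = - val (d 0)" using scal by (auto simp: c_def)
    have kG: "k1 \<in> Gn" "k2 \<in> Gn" using k GL_O_GL by auto
    have dG: "dg d \<in> Gn" using dg_inv(1)[of d] d by simp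
    have cd: "c \<cdot>\<^sub>m dg d = dg (\<lambda>i. c * d i)" by (intro eq_matI) (auto simp: dg_def)
    have cg: "c \<cdot>\<^sub>m g = k1 * (c \<cdot>\<^sub>m dg d) * k2" using kG dG unfolding gk by (simp add: mring mcarr gsimps)
    have nM: "int i * M \<le> int n * M" if "i < n" for i using that M by (intro mult_right_mono) auto
    have "bd 0 (dg (\<lambda>i. c * d i))"
      using c d(1) d(2)[of _ 0] by (auto simp: bd_def dg_def vf.B_0 vge_def val_mult)
    then have "bd (0 + 0 + 0) (c \<cdot>\<^sub>m g)"
      unfolding cg cd using k kG by (intro bd_mult3) (auto simp: GL_O_bd gsimps dg_Mn)
    moreover have "val (det (c \<cdot>\<^sub>m g)) \<le> int n * int n * M"
    proof -
      have cdG: "dg (\<lambda>i. c * d i) \<in> Gn" "minv n (dg (\<lambda>i. c * d i)) = dg (\<lambda>i. inverse (c * d i))"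
        using dg_inv[of "\<lambda>i. c * d i"] c d by auto
      have "vge (- (int n * M)) (inverse (c * d i))" if "i < n" for i
        using c d(1)[OF that] gap[OF that] nM[OF that] by (auto simp: vge_def val_mult val_inverse)
      then have "bd (- (int n * M)) (dg (\<lambda>i. inverse (c * d i)))"
        by (auto simp: bd_def dg_def vf.B_0)
      then have "bd (0 + - (int n * M) + 0) (minv n k2 * minv n (dg (\<lambda>i. c * d i)) * minv n k1)"
        using k kG cdG(1) unfolding cdG(2) by (intro bd_mult3) (auto simp: GL_O_bd gsimps dg_Mn)
      moreover have "minv n (c \<cdot>\<^sub>m g) = minv n k2 * minv n (dg (\<lambda>i. c * d i)) * minv n k1"
        unfolding cg cd using kG cdG(1) by (simp add: minv_mult gsimps massoc)
      ultimately have "bd (- (int n * M)) (minv n (c \<cdot>\<^sub>m g))" by simp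
      moreover have cgG: "c \<cdot>\<^sub>m g \<in> Gn" using c g by (simp add: GL_smult)
      ultimately have "vge (- (int n * (int n * M))) (det (minv n (c \<cdot>\<^sub>m g)))" by (intro bd_det) (auto simp: gsimps)
      then show ?thesis using cgG det_minv[OF cgG] by (auto simp: vge_def val_inverse GL_iff simp del: det_smult)
    qed
    moreover have "i \<ge> 0" using i M by (meson mult_nonneg_nonneg of_nat_0_le_iff order_trans)
    ultimately have "c \<cdot>\<^sub>m g \<in> G_le val n i"
      unfolding G_le_iff using i c g by (auto simp: GL_smult intro: bd_mono)
    then show ?thesis using out c by blast
  qed
qed

subsection \<open>Topology and measurable sets\<close>

lemma mbox_eq: "x \<in> Mn \<Longrightarrow> mbox val n x k = {y \<in> Mn. bd k (y - x)}"
  by (auto simp: mbox_def bd_def vclose_vge)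

lemma openin_Mtop: "openin (Mtop val n) U \<longleftrightarrow> (\<forall>x\<in>U. x \<in> Mn \<and> (\<exists>k. {y \<in> Mn. bd k (y - x)} \<subseteq> U))"
proof -
  let ?P = "\<lambda>U. \<forall>x\<in>U. x \<in> Mn \<and> (\<exists>k. mbox val n x k \<subseteq> U)"
  have "istopology ?P"
    unfolding istopology_def
  proof (intro conjI allI impI)
    fix S T assume S: "?P S" and T: "?P T"
    show "?P (S \<inter> T)"
    proof (intro ballI conjI)
      fix x assume x: "x \<in> S \<inter> T"
      then obtain k l where "mbox val n x k \<subseteq> S" "mbox val n x l \<subseteq> T" using S T by blast
      moreover have "mbox val n x (max k l) \<subseteq> mbox val n x k" "mbox val n x (max k l) \<subseteq> mbox val n x l"
        by (auto simp: mbox_def vclose_def)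
      ultimately show "\<exists>k. mbox val n x k \<subseteq> S \<inter> T" by (intro exI[of _ "max k l"]) blast
    qed (use S in auto)
  next
    fix \<K> assume K: "\<forall>K\<in>\<K>. ?P K"
    show "?P (\<Union>\<K>)"
    proof (intro ballI conjI)
      fix x assume "x \<in> \<Union>\<K>"
      then obtain K where "K \<in> \<K>" "x \<in> K" by blast
      then have "x \<in> Mn \<and> (\<exists>k. mbox val n x k \<subseteq> K)" using K by blast
      then show "x \<in> Mn" "\<exists>k. mbox val n x k \<subseteq> \<Union>\<K>" using \<open>K \<in> \<K>\<close> by (simp, meson Sup_upper order_trans)
    qed
  qed
  then have "openin (Mtop val n) = ?P" unfolding Mtop_def by (rule topology_inverse')
  then have "openin (Mtop val n) U = ?P U" by simp
  also have "\<dots> \<longleftrightarrow> (\<forall>x\<in>U. x \<in> Mn \<and> (\<exists>k. {y \<in> Mn. bd k (y - x)} \<subseteq> U))"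
    by (intro ball_cong refl conj_cong ex_cong1) (simp add: mbox_eq)
  finally show ?thesis .
qed

lemma topspace_Mtop: "topspace (Mtop val n) = Mn"
proof -
  have "openin (Mtop val n) Mn" by (auto simp: openin_Mtop)
  then have "Mn \<subseteq> topspace (Mtop val n)" by (rule openin_subset)
  moreover have "topspace (Mtop val n) \<subseteq> Mn" using openin_topspace[of "Mtop val n"] openin_Mtop by blast
  ultimately show ?thesis by blast
qed

lemma open_coset:
  assumes g: "g \<in> Gn" "h \<in> Gn" and s: "s \<ge> 1"
  shows "openin (Mtop val n) {g * k * h | k. k \<in> Ks s}"
  unfolding openin_Mtop
proof (intro ballI conjI)
  fix x assume "x \<in> {g * k * h | k. k \<in> Ks s}"
  then obtain k where k: "k \<in> Ks s" "x = g * k * h" by blast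
  note kM = Ks_Mn[OF k(1)]
  show x: "x \<in> Mn" using k kM g by (simp add: gsimps mcarr)
  obtain b where b: "b \<ge> 0" "bd (- b) (minv n g)" using bd_exists by blast
  obtain c where c: "c \<ge> 0" "bd (- c) (minv n h)" using bd_exists by blast
  have "{y \<in> Mn. bd (s + b + c) (y - x)} \<subseteq> {g * k * h | k. k \<in> Ks s}"
  proof
    fix y assume y: "y \<in> {y \<in> Mn. bd (s + b + c) (y - x)}"
    define k' where "k' = minv n g * y * minv n h"
    have "bd (- b + (s + b + c) + - c) (minv n g * (y - x) * minv n h)"
      using y x b c g by (intro bd_mult3) (auto simp: gsimps mcarr)
    then have "bd s (minv n g * (y - x) * minv n h)" by simp
    then have "bd s (minv n g * (y - x) * minv n h + (k - One))"
      using k kM x y g by (intro bd_add) (auto simp: Ks_def gsimps mcarr)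
    moreover have "minv n g * (y - x) * minv n h + (k - One) = k' - One"
      unfolding k'_def k(2) using y g kM by (intro ent_eqI) (auto simp: msimps gsimps)
    ultimately have "k' \<in> Ks s" using y g by (simp add: Ks_def k'_def gsimps mcarr)
    moreover have "y = g * k' * h" unfolding k'_def using y g by (simp add: massoc mcarr gsimps mring)
    ultimately show "y \<in> {g * k * h | k. k \<in> Ks s}" by blast
  qed
  then show "\<exists>k. {y \<in> Mn. bd k (y - x)} \<subseteq> {g * k * h | k. k \<in> Ks s}" by blast
qed

definition lcos :: "'a mat \<Rightarrow> int \<Rightarrow> 'a mat set" where
  "lcos g s = (\<lambda>k. g * k) ` Ks s"

lemma open_lcos: "g \<in> Gn \<Longrightarrow> s \<ge> 1 \<Longrightarrow> openin (Mtop val n) (lcos g s)"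
proof -
  assume a: "g \<in> Gn" "s \<ge> 1"
  have "lcos g s = (\<lambda>k. g * k * One) ` Ks s"
    unfolding lcos_def by (intro image_cong refl) (use a Ks_Mn in \<open>simp add: mring mcarr gsimps\<close>)
  then have "lcos g s = {g * k * One | k. k \<in> Ks s}" by blast
  then show ?thesis using open_coset[OF a(1) GL_One a(2)] by simp
qed

lemma lcos_iff: "g \<in> Gn \<Longrightarrow> y \<in> lcos g s \<longleftrightarrow> y \<in> Mn \<and> minv n g * y \<in> Ks s"
proof
  assume g: "g \<in> Gn" and "y \<in> lcos g s"
  then obtain k where "k \<in> Ks s" "y = g * k" by (auto simp: lcos_def)
  then show "y \<in> Mn \<and> minv n g * y \<in> Ks s" using g Ks_Mn[of k s] by (auto simp: gsimps mcarr)
next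
  assume g: "g \<in> Gn" and y: "y \<in> Mn \<and> minv n g * y \<in> Ks s"
  then have "y = g * (minv n g * y)" by (simp add: gsimps)
  then show "y \<in> lcos g s" using y by (auto simp: lcos_def)
qed

lemma lcos_GL: "g \<in> Gn \<Longrightarrow> s \<ge> 1 \<Longrightarrow> lcos g s \<subseteq> Gn"
  unfolding lcos_def using Ks_GL GL_mult by blast

lemma borel_sets_subtopology:
  assumes "S \<subseteq> Mn"
  shows "borel_sets (subtopology (Mtop val n) S) = sigma_sets S {A. openin (subtopology (Mtop val n) S) A}"
proof -
  have "topspace (Mtop val n) \<inter> S = S" using assms by (auto simp: topspace_Mtop)
  then show ?thesis by (simp add: borel_sets_def)
qed

text \<open>Finitely many open cosets \<open>lcos g 1\<close> cover the compact set, and right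
  multiplication by \<open>Ks 1\<close> preserves the entry bounds of \<open>g\<close> and of its
  inverse.\<close>

lemma compactin_bounded:
  assumes "compactin (subtopology (Mtop val n) Gn) C"
  shows "C \<subseteq> Gn \<and> (\<exists>b\<ge>0. \<forall>y\<in>C. bd (- b) y \<and> bd (- b) (minv n y))"
proof -
  have CG: "C \<subseteq> Gn" using compactin_subset_topspace[OF assms] by auto
  let ?U = "(\<lambda>g. lcos g 1) ` C"
  have "compactin (Mtop val n) C" using assms by (simp add: compactin_subtopology)
  moreover have "\<forall>U\<in>?U. openin (Mtop val n) U" using CG open_lcos by auto
  moreover have "C \<subseteq> \<Union>?U"
  proof
    fix x assume x: "x \<in> C"
    then have "x \<in> lcos x 1" using CG by (auto simp: lcos_iff gsimps Ks_One)
    then show "x \<in> \<Union>?U" using x by blast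
  qed
  ultimately obtain F where F: "finite F" "F \<subseteq> ?U" "C \<subseteq> \<Union>F"
    unfolding compactin_def by metis
  obtain S where S: "finite S" "S \<subseteq> C" "F = (\<lambda>g. lcos g 1) ` S"
    using finite_subset_image[OF F(1,2)] by blast
  have "\<exists>b\<ge>0. \<forall>g\<in>S. bd (- b) g \<and> bd (- b) (minv n g)" using S(1)
  proof (induction S)
    case (insert x S)
    then obtain b where b: "b \<ge> 0" "\<forall>g\<in>S. bd (- b) g \<and> bd (- b) (minv n g)" by blast
    obtain c d where c: "c \<ge> 0" "bd (- c) x" and d: "d \<ge> 0" "bd (- d) (minv n x)" using bd_exists by metis
    have "bd (- max b (max c d)) x" by (rule bd_mono[OF c(2)]) simp
    moreover have "bd (- max b (max c d)) (minv n x)" by (rule bd_mono[OF d(2)]) simp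
    moreover have "\<forall>g\<in>S. bd (- max b (max c d)) g \<and> bd (- max b (max c d)) (minv n g)"
    proof
      fix g assume "g \<in> S"
      then have "bd (- b) g" "bd (- b) (minv n g)" using b(2) by auto
      then show "bd (- max b (max c d)) g \<and> bd (- max b (max c d)) (minv n g)"
        using bd_mono[of "- b" g "- max b (max c d)"] bd_mono[of "- b" "minv n g" "- max b (max c d)"] by simp
    qed
    ultimately show ?case using b(1) by (intro exI[of _ "max b (max c d)"]) simp
  qed auto
  then obtain b where b: "b \<ge> 0" "\<forall>g\<in>S. bd (- b) g \<and> bd (- b) (minv n g)" by blast
  have "bd (- b) y \<and> bd (- b) (minv n y)" if y: "y \<in> C" for y
  proof -
    obtain g where g: "g \<in> S" "y \<in> lcos g 1" using F(3) S(3) y by blast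
    then obtain k where k: "k \<in> Ks 1" "y = g * k" by (auto simp: lcos_def)
    have kO: "k \<in> GL_O val n" using Ks_GL_O[OF _ k(1)] by simp
    have gG: "g \<in> Gn" "k \<in> Gn" using g S CG kO GL_O_GL by auto
    have "bd (- b + 0) (g * k)"
      by (rule bd_mult) (use b(2) g gG kO in \<open>simp_all add: gsimps GL_O_bd\<close>)
    moreover have "bd (0 + - b) (minv n k * minv n g)"
      by (rule bd_mult) (use b(2) g gG kO in \<open>simp_all add: gsimps GL_O_bd\<close>)
    ultimately show ?thesis using k gG by (simp add: minv_mult)
  qed
  then show ?thesis using CG b(1) by blast
qed

lemma haar_G_open: "haar_G val n \<mu> \<Longrightarrow> openin (Mtop val n) A \<Longrightarrow> A \<subseteq> Gn \<Longrightarrow> A \<in> sets \<mu>"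
proof -
  assume a: "haar_G val n \<mu>" "openin (Mtop val n) A" "A \<subseteq> Gn"
  have "openin (subtopology (Mtop val n) Gn) A"
    using a(2,3) by (auto simp: openin_subtopology)
  then show ?thesis using a(1) by (auto simp: haar_G_def haar_on_def borel_sets_def)
qed

lemma haar_G_invariant:
  "haar_G val n \<mu> \<Longrightarrow> h \<in> Gn \<Longrightarrow> A \<in> sets \<mu> \<Longrightarrow> emeasure \<mu> ((\<lambda>y. h * y) ` A) = emeasure \<mu> A"
  by (auto simp: haar_G_def haar_on_def)

lemma haar_G_lcos:
  assumes "haar_G val n \<mu>" "g \<in> Gn" "s \<ge> 1"
  shows "lcos g s \<in> sets \<mu>" "emeasure \<mu> (lcos g s) = emeasure \<mu> (Ks s)"
proof -
  show "lcos g s \<in> sets \<mu>" by (rule haar_G_open) (use assms open_lcos lcos_GL in auto)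
  have "lcos One s = Ks s" using Ks_Mn by (force simp: lcos_def mring)
  then have "Ks s \<in> sets \<mu>" using haar_G_open[OF assms(1) open_lcos[of One s] lcos_GL[of One s]] assms GL_One by auto
  then show "emeasure \<mu> (lcos g s) = emeasure \<mu> (Ks s)"
    unfolding lcos_def using haar_G_invariant assms by blast
qed

lemma haar_G_finite:
  assumes mu: "haar_G val n \<mu>" and D: "\<And>g. g \<in> D \<Longrightarrow> g \<in> Gn \<and> bd (- c) g \<and> bd (- c) (minv n g)"
  shows "emeasure \<mu> D < \<infinity>"
proof -
  have "\<exists>S. finite S \<and> S \<subseteq> D \<and> (\<forall>y\<in>D. \<exists>g\<in>S. minv n g * y \<in> Ks 1)"
    by (rule GL_O_finite_cosets[where s = 1 and D = D and c = c, OF order_refl]) (rule D)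
  then obtain S where S: "finite S" "S \<subseteq> D" "\<forall>y\<in>D. \<exists>g\<in>S. minv n g * y \<in> Ks 1" by (elim exE conjE)
  have K: "emeasure \<mu> (Ks 1) \<le> 1"
  proof -
    have 1: "emeasure \<mu> (GL_O val n) = 1" using mu by (simp add: haar_G_def)
    then have "GL_O val n \<in> sets \<mu>" using emeasure_notin_sets[of "GL_O val n" \<mu>] by auto
    then have "emeasure \<mu> (Ks 1) \<le> emeasure \<mu> (GL_O val n)" using Ks_GL_O by (intro emeasure_mono) auto
    then show ?thesis using 1 by simp
  qed
  have SG: "g \<in> Gn" if "g \<in> S" for g using D[of g] S(2) that by blast
  have L: "lcos g 1 \<in> sets \<mu>" "emeasure \<mu> (lcos g 1) = emeasure \<mu> (Ks 1)" if "g \<in> S" for g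
    using haar_G_lcos[OF mu SG[OF that], of 1] by simp_all
  have "D \<subseteq> (\<Union>g\<in>S. lcos g 1)"
  proof
    fix y assume y: "y \<in> D"
    then obtain g where g: "g \<in> S" "minv n g * y \<in> Ks 1" using S(3) by blast
    then have "y \<in> lcos g 1" using D[OF y] by (simp add: lcos_iff SG GL_Mn)
    then show "y \<in> (\<Union>g\<in>S. lcos g 1)" using g(1) by blast
  qed
  then have "emeasure \<mu> D \<le> emeasure \<mu> (\<Union>g\<in>S. lcos g 1)"
    by (rule emeasure_mono) (rule sets.finite_UN[OF S(1) L(1)])
  also have "\<dots> \<le> (\<Sum>g\<in>S. emeasure \<mu> (lcos g 1))"
    by (rule emeasure_subadditive_finite[OF S(1)]) (use L(1) in blast)
  also have "\<dots> \<le> (\<Sum>g\<in>S. 1)" by (rule sum_mono) (simp add: L(2) K)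
  also have "\<dots> < \<infinity>" by (simp add: of_nat_less_top)
  finally show ?thesis .
qed

text \<open>Finitely many translates of \<open>Ks s\<close> cover \<open>GL_O val n\<close>, which
  has measure 1.\<close>

lemma haar_G_Ks_pos:
  assumes mu: "haar_G val n \<mu>" and s: "s \<ge> 1"
  shows "emeasure \<mu> (Ks s) > 0"
proof (rule ccontr)
  assume "\<not> ?thesis"
  then have z: "emeasure \<mu> (Ks s) = 0" by simp
  have D: "g \<in> Gn \<and> bd (- 0) g \<and> bd (- 0) (minv n g)" if "g \<in> GL_O val n" for g
    using that by (simp add: GL_O_iff)
  have "\<exists>S. finite S \<and> S \<subseteq> GL_O val n \<and> (\<forall>y\<in>GL_O val n. \<exists>g\<in>S. minv n g * y \<in> Ks s)"
    by (rule GL_O_finite_cosets[where s = s and D = "GL_O val n" and c = 0, OF s]) (rule D)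
  then obtain S where S: "finite S" "S \<subseteq> GL_O val n"
    "\<forall>y\<in>GL_O val n. \<exists>g\<in>S. minv n g * y \<in> Ks s" by (elim exE conjE)
  have SG: "g \<in> Gn" if "g \<in> S" for g using GL_O_GL[of g] S(2) that by blast
  have L: "lcos g s \<in> sets \<mu>" "emeasure \<mu> (lcos g s) = 0" if "g \<in> S" for g
    using haar_G_lcos[OF mu SG[OF that] s] z by simp_all
  have "GL_O val n \<subseteq> (\<Union>g\<in>S. lcos g s)"
  proof
    fix y assume y: "y \<in> GL_O val n"
    then obtain g where g: "g \<in> S" "minv n g * y \<in> Ks s" using S(3) by blast
    then have "y \<in> lcos g s" using D[OF y] by (simp add: lcos_iff SG GL_Mn)
    then show "y \<in> (\<Union>g\<in>S. lcos g s)" using g(1) by blast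
  qed
  then have "emeasure \<mu> (GL_O val n) \<le> emeasure \<mu> (\<Union>g\<in>S. lcos g s)"
    by (rule emeasure_mono) (rule sets.finite_UN[OF S(1) L(1)])
  also have "\<dots> \<le> (\<Sum>g\<in>S. emeasure \<mu> (lcos g s))"
    by (rule emeasure_subadditive_finite[OF S(1)]) (use L(1) in blast)
  also have "\<dots> = 0" by (simp add: L(2))
  finally show False using mu by (simp add: haar_G_def)
qed

subsection \<open>Haar measure on a unipotent radical\<close>

text \<open>The unipotent radical of the stabiliser of \<open>Wk k j\<close>, parametrised by its
  Lie algebra; \<open>unip_radical_Wk\<close> matches it with the definition by flags.\<close>

definition Uk :: "'a mat \<Rightarrow> nat \<Rightarrow> 'a mat set" where
  "Uk k j = (\<lambda>X. k * (One + X) * minv n k) ` Rad (Ej j)"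

lemma Uk_GL: "k \<in> Gn \<Longrightarrow> u \<in> Uk k j \<Longrightarrow> u \<in> Gn"
  using Rad_unip_inv(1)[OF Ej_Mn] by (auto simp: Uk_def intro!: GL_mult GL_minv)

lemma Uk_mult: "k \<in> Gn \<Longrightarrow> u \<in> Uk k j \<Longrightarrow> v \<in> Uk k j \<Longrightarrow> u * v \<in> Uk k j"
proof -
  assume k: "k \<in> Gn" and "u \<in> Uk k j" "v \<in> Uk k j"
  then obtain X Y where X: "X \<in> Rad (Ej j)" "u = k * (One + X) * minv n k"
    and Y: "Y \<in> Rad (Ej j)" "v = k * (One + Y) * minv n k" by (auto simp: Uk_def)
  have "u * v = k * ((One + X) * (One + Y)) * minv n k"
    using k Rad_Mn[OF X(1)] Rad_Mn[OF Y(1)] unfolding X(2) Y(2) by (simp add: massoc gsimps mcarr)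
  also have "\<dots> = k * (One + (X + Y)) * minv n k" by (simp add: Rad_unip_mult[OF Ej_Mn X(1) Y(1)])
  finally show ?thesis using Rad_add[OF Ej_Mn X(1) Y(1)] by (auto simp: Uk_def)
qed

lemma Uk_minv: "k \<in> Gn \<Longrightarrow> u \<in> Uk k j \<Longrightarrow> minv n u \<in> Uk k j"
proof -
  assume k: "k \<in> Gn" and "u \<in> Uk k j"
  then obtain X where X: "X \<in> Rad (Ej j)" "u = k * (One + X) * minv n k" by (auto simp: Uk_def)
  note inv = Rad_unip_inv[OF Ej_Mn X(1)]
  have "minv n u = k * (One - X) * minv n k"
    unfolding X(2) using k inv Rad_Mn[OF X(1)] by (simp add: minv_mult gsimps massoc mcarr)
  also have "One - X = One + - X" using Rad_Mn[OF X(1)] by (intro ent_eqI) (auto simp: msimps)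
  finally show ?thesis using Rad_uminus[OF Ej_Mn X(1)] by (auto simp: Uk_def)
qed

lemma Uk_One: "k \<in> Gn \<Longrightarrow> One \<in> Uk k j"
proof -
  assume k: "k \<in> Gn"
  have "One = k * (One + Zero) * minv n k" using k by (simp add: gsimps mring mzero mcarr)
  then show ?thesis unfolding Uk_def by (rule image_eqI) (rule Rad_Zero[OF Ej_Mn])
qed

lemma Uk_translate: "k \<in> Gn \<Longrightarrow> h \<in> Uk k j \<Longrightarrow> A \<subseteq> Uk k j \<Longrightarrow>
  (\<lambda>y. h * y) ` A = (\<lambda>y. minv n h * y) -` A \<inter> Uk k j"
proof -
  assume k: "k \<in> Gn" and h: "h \<in> Uk k j" and A: "A \<subseteq> Uk k j"
  note hG = Uk_GL[OF k h]
  show ?thesis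
  proof (intro equalityI subsetI)
    fix y assume "y \<in> (\<lambda>y. h * y) ` A"
    then obtain x where x: "x \<in> A" "y = h * x" by blast
    then have "minv n h * y = x" using hG A Uk_GL[OF k] by (auto simp: gsimps mcarr)
    then show "y \<in> (\<lambda>y. minv n h * y) -` A \<inter> Uk k j" using x A Uk_mult[OF k h] by auto
  next
    fix y assume y: "y \<in> (\<lambda>y. minv n h * y) -` A \<inter> Uk k j"
    then have "y = h * (minv n h * y)" using hG Uk_GL[OF k, of y] by (auto simp: gsimps mcarr)
    then show "y \<in> (\<lambda>y. h * y) ` A" using y by blast
  qed
qed

text \<open>A bounded piece of the opposite parabolic. Its boundedness makes the part of the big
  cell over a ball of the radical have finite measure.\<close>

definition Qg :: "nat \<Rightarrow> 'a mat set" where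
  "Qg j = {q \<in> Ks 1. q \<in> Par (One - Ej j)}"

text \<open>The big cell \<open>U k Q\<close> is open in \<open>GL\<^sub>n\<close>, so Haar measure of \<open>GL\<^sub>n\<close> restricted to it projects to a
  Haar measure of \<open>U\<close>.\<close>

definition cell :: "'a mat \<Rightarrow> nat \<Rightarrow> 'a mat set \<Rightarrow> 'a mat set" where
  "cell k j A = {u * (k * q) | u q. u \<in> A \<and> q \<in> Qg j}"

lemma Qg_GL: "q \<in> Qg j \<Longrightarrow> q \<in> Gn"
  using Ks_GL[of 1] by (auto simp: Qg_def)

lemma Qg_mult: "q \<in> Qg j \<Longrightarrow> r \<in> Qg j \<Longrightarrow> q * r \<in> Qg j"
  using Ks_mult[of 1] Par_mult[of "One - Ej j"] by (auto simp: Qg_def Ej_Mn mcarr)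

text \<open>\<open>block_LU\<close> for the complementary idempotent, which exchanges the radical
  and its opposite.\<close>

lemma Ks_Uk_Qg:
  assumes s: "s \<ge> 1" and j: "j \<le> n" and \<kappa>: "\<kappa> \<in> Ks s"
  obtains X q where "X \<in> Rad (Ej j)" "bd s X" "q \<in> Qg j" "\<kappa> = (One + X) * q"
proof -
  note sp = splitting_compl_Ej[OF j]
  have c: "One - (One - Ej j) = Ej j" by (rule compl_compl[OF Ej_Mn])
  obtain X q where "X \<in> Rad (Ej j)" "q \<in> Par (One - Ej j)" "bd s X" "q \<in> Ks s" "\<kappa> = (One + X) * q"
    using block_LU[OF splittingD(1-3)[OF sp] \<kappa> s] unfolding c by blast
  then show ?thesis using that Ks_mono[OF s] by (auto simp: Qg_def)
qed

text \<open>The quotient of the two radical parts yields an element \<open>1 + D\<close> lying both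
  in the radical and in the opposite parabolic, so \<open>D\<close> vanishes.\<close>

lemma cell_inj:
  assumes k: "k \<in> Gn" and j: "j \<le> n" and u: "u \<in> Uk k j" "u' \<in> Uk k j" and q: "q \<in> Qg j" "q' \<in> Qg j"
    and eq: "u * (k * q) = u' * (k * q')"
  shows "u = u'"
proof -
  obtain X Y where X: "X \<in> Rad (Ej j)" "u = k * (One + X) * minv n k"
    and Y: "Y \<in> Rad (Ej j)" "u' = k * (One + Y) * minv n k" using u by (auto simp: Uk_def)
  define D where "D = X - Y"
  have D: "D \<in> Rad (Ej j)" unfolding D_def by (rule Rad_diff[OF Ej_Mn X(1) Y(1)])
  note M = Rad_Mn[OF X(1)] Rad_Mn[OF Y(1)] Rad_Mn[OF D] Qg_GL[OF q(1)] Qg_GL[OF q(2)]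
  have 1: "minv n k * (u * (k * q)) = (One + X) * q" "minv n k * (u' * (k * q')) = (One + Y) * q'"
    unfolding X Y using k M by (simp_all add: massoc gsimps mcarr)
  then have 2: "(One + X) * q = (One + Y) * q'" using eq by simp
  have "One + D = (One - Y) * (One + X)"
    unfolding D_def using Rad_mult_Zero[OF Ej_Mn Y(1) X(1)] M(1,2)
    by (intro ent_eqI) (auto simp: msimps)
  then have "(One + D) * q = (One - Y) * ((One + X) * q)" using M by (simp add: massoc mcarr gsimps)
  also have "\<dots> = minv n (One + Y) * ((One + Y) * q')"
    unfolding 2 using Rad_unip_inv(2)[OF Ej_Mn Y(1)] by simp
  also have "\<dots> = q'" using minv_cancel(4)[OF Rad_unip_inv(1)[OF Ej_Mn Y(1)]] M(5) GL_Mn by blast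
  finally have "(One + D) * q = q'" .
  then have "One + D = q' * minv n q" using M by (auto simp: massoc gsimps mcarr mring)
  moreover have "minv n q \<in> Par (One - Ej j)"
    by (rule Par_minv[OF splitting_compl_Ej[OF j]]) (use q M in \<open>auto simp: Qg_def\<close>)
  ultimately have "One + D \<in> Par (One - Ej j)"
    using Par_mult[of "One - Ej j" q' "minv n q"] q by (auto simp: Qg_def Ej_Mn mcarr)
  then have "D $$ (i,l) = 0" if "i < n" "l < n" "i < j" "j \<le> l" for i l
    using Par_compl_Ej[of "One + D" j i l] that M by simp
  then have "D = Zero" using D by (intro ent_eqI) (auto simp: ent_def Rad_Ej_iff mcarr)
  have "X = Y"
  proof (rule ent_eqI)
    fix i l assume "i < n" "l < n"
    then show "ent i l X = ent i l Y"
      using arg_cong[OF \<open>D = Zero\<close>, of "ent i l"] M(1,2) by (simp add: D_def ents)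
  qed (use M in auto)
  then show ?thesis using X Y by simp
qed

lemma Uk_near:
  assumes k: "k \<in> GL_O val n" and X: "X \<in> Rad (Ej j)" "bd s X" and u: "u \<in> Uk k j" "bd (- b) u"
  shows "u * (k * (One + X) * minv n k) \<in> Uk k j" "bd (s - b) (u * (k * (One + X) * minv n k) - u)"
proof -
  note kG = GL_O_GL[OF k] and XM = Rad_Mn[OF X(1)]
  show "u * (k * (One + X) * minv n k) \<in> Uk k j" using X Uk_mult[OF kG u(1)] by (auto simp: Uk_def)
  note uM = GL_Mn[OF Uk_GL[OF kG u(1)]]
  have "u * (k * (One + X) * minv n k) - u = u * (k * X * minv n k)"
    using uM kG XM by (intro ent_eqI) (auto simp: msimps gsimps)
  moreover have "bd (- b + (0 + s + 0)) (u * (k * X * minv n k))"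
    using uM kG XM u X k by (intro bd_mult bd_mult3) (auto simp: gsimps mcarr GL_O_bd)
  ultimately show "bd (s - b) (u * (k * (One + X) * minv n k) - u)" by (simp add: algebra_simps)
qed

text \<open>The sets \<open>u k (Ks s) q\<close> are open. Factoring the middle term by
  \<open>Ks_Uk_Qg\<close> turns its first part into a small change of \<open>u\<close> and leaves
  the second part in \<open>Qg j\<close>.\<close>

lemma open_cell:
  assumes k: "k \<in> GL_O val n" and j: "j \<le> n" and A: "openin (subtopology (Mtop val n) (Uk k j)) A"
  shows "openin (Mtop val n) (cell k j A)"
proof -
  note kG = GL_O_GL[OF k]
  obtain A' where A': "openin (Mtop val n) A'" "A = A' \<inter> Uk k j" using A by (auto simp: openin_subtopology)
  have "\<exists>T. openin (Mtop val n) T \<and> y \<in> T \<and> T \<subseteq> cell k j A" if y: "y \<in> cell k j A" for y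
  proof -
    obtain u q where uq: "u \<in> A" "q \<in> Qg j" "y = u * (k * q)" using y by (auto simp: cell_def)
    have u: "u \<in> A'" "u \<in> Uk k j" using uq A' by auto
    note uG = Uk_GL[OF kG u(2)] and qG = Qg_GL[OF uq(2)]
    obtain l where l: "{z \<in> Mn. bd l (z - u)} \<subseteq> A'" using A'(1) u(1) by (auto simp: openin_Mtop)
    obtain b where b: "b \<ge> 0" "bd (- b) u" using bd_exists by blast
    define s where "s = max 1 (l + b)"
    have s: "s \<ge> 1" "l \<le> s - b" by (auto simp: s_def)
    let ?T = "{u * k * \<kappa> * q | \<kappa>. \<kappa> \<in> Ks s}"
    have "openin (Mtop val n) ?T" using uG kG qG s by (intro open_coset GL_mult)
    moreover have "y = u * k * One * q" using uq(3) uG kG qG by (simp add: massoc mring gsimps mcarr)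
    then have "y \<in> ?T" using Ks_One by blast
    moreover have "?T \<subseteq> cell k j A"
    proof
      fix z assume "z \<in> ?T"
      then obtain \<kappa> where \<kappa>: "\<kappa> \<in> Ks s" "z = u * k * \<kappa> * q" by blast
      obtain X p where X: "X \<in> Rad (Ej j)" "bd s X" "p \<in> Qg j" "\<kappa> = (One + X) * p"
        using Ks_Uk_Qg[OF s(1) j \<kappa>(1)] by blast
      let ?u = "u * (k * (One + X) * minv n k)"
      have u': "?u \<in> Uk k j" "bd (s - b) (?u - u)" using Uk_near[OF k X(1,2) u(2) b(2)] by auto
      then have "?u \<in> A'" using l s(2) GL_Mn[OF Uk_GL[OF kG u'(1)]] by (auto elim: bd_mono)
      then have "?u \<in> A" using u' A' by auto
      moreover have "z = ?u * (k * (p * q))"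
        unfolding \<kappa>(2) X(4) using Rad_Mn[OF X(1)] Qg_GL[OF X(3)] uG kG qG by (simp add: massoc mcarr gsimps)
      ultimately show "z \<in> cell k j A" using Qg_mult[OF X(3) uq(2)] by (auto simp: cell_def)
    qed
    ultimately show ?thesis by blast
  qed
  then show ?thesis by (subst openin_subopen) blast
qed

lemma open_Uk_ball:
  assumes k: "k \<in> Gn"
  shows "openin (subtopology (Mtop val n) (Uk k j)) {u \<in> Uk k j. bd b (u - One)}"
proof -
  have "openin (Mtop val n) {y \<in> Mn. bd b (y - One)}"
    unfolding openin_Mtop
  proof (intro ballI conjI)
    fix x assume x: "x \<in> {y \<in> Mn. bd b (y - One)}"
    have "{y \<in> Mn. bd b (y - x)} \<subseteq> {y \<in> Mn. bd b (y - One)}"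
    proof
      fix y assume y: "y \<in> {y \<in> Mn. bd b (y - x)}"
      have "y - One = (y - x) + (x - One)" using x y by (intro ent_eqI) (auto simp: msimps)
      moreover have "bd b ((y - x) + (x - One))" by (rule bd_add) (use x y in \<open>auto simp: mcarr\<close>)
      ultimately show "y \<in> {y \<in> Mn. bd b (y - One)}" using y by simp
    qed
    then show "\<exists>k. {y \<in> Mn. bd k (y - x)} \<subseteq> {y \<in> Mn. bd b (y - One)}" by blast
  qed auto
  moreover have "{u \<in> Uk k j. bd b (u - One)} = {y \<in> Mn. bd b (y - One)} \<inter> Uk k j"
    using Uk_GL[OF k] GL_Mn by auto
  ultimately show ?thesis unfolding openin_subtopology by blast
qed

lemma open_Uk_translate:
  assumes k: "k \<in> Gn" and h: "h \<in> Uk k j" and A: "openin (subtopology (Mtop val n) (Uk k j)) A"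
  shows "openin (subtopology (Mtop val n) (Uk k j)) ((\<lambda>y. h * y) -` A \<inter> Uk k j)"
proof -
  note hG = Uk_GL[OF k h]
  obtain A' where A': "openin (Mtop val n) A'" "A = A' \<inter> Uk k j" using A by (auto simp: openin_subtopology)
  obtain b where b: "b \<ge> 0" "bd (- b) h" using bd_exists by blast
  have "openin (Mtop val n) {y \<in> Mn. h * y \<in> A'}"
    unfolding openin_Mtop
  proof (intro ballI conjI)
    fix x assume x: "x \<in> {y \<in> Mn. h * y \<in> A'}"
    then obtain l where l: "{z \<in> Mn. bd l (z - h * x)} \<subseteq> A'" using A'(1) by (auto simp: openin_Mtop)
    have "{y \<in> Mn. bd (l + b) (y - x)} \<subseteq> {y \<in> Mn. h * y \<in> A'}"
    proof
      fix y assume y: "y \<in> {y \<in> Mn. bd (l + b) (y - x)}"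
      have "h * y - h * x = h * (y - x)" using x y hG by (simp add: mring gsimps)
      moreover have "bd (- b + (l + b)) (h * (y - x))" using x y hG b by (intro bd_mult) (auto simp: gsimps mcarr)
      ultimately show "y \<in> {y \<in> Mn. h * y \<in> A'}" using y hG l by (auto simp: gsimps mcarr)
    qed
    then show "\<exists>k. {y \<in> Mn. bd k (y - x)} \<subseteq> {y \<in> Mn. h * y \<in> A'}" by blast
  qed auto
  moreover have "(\<lambda>y. h * y) -` A \<inter> Uk k j = {y \<in> Mn. h * y \<in> A'} \<inter> Uk k j"
    using Uk_GL[OF k] GL_Mn Uk_mult[OF k h] A'(2) by auto
  ultimately show ?thesis unfolding openin_subtopology by blast
qed

text \<open>Supplies the measure without which the integral condition in \<open>cuspidal\<close>
  would be void. The projection of the big cell to its radical part commutes with left translation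
  by the radical, so the image of the Haar measure of \<open>GL n\<close> is invariant.\<close>

lemma haar_unipotent:
  assumes mu: "haar_G val n \<mu>" and k: "k \<in> GL_O val n" and j: "j \<le> n"
  shows "\<exists>\<nu>. haar_on val n (Uk k j) \<nu> \<and> (\<forall>b. emeasure \<nu> {u \<in> Uk k j. bd b (u - One)} > 0 \<and>
    emeasure \<nu> {u \<in> Uk k j. bd b (u - One)} < \<infinity>)"
proof -
  note kG = GL_O_GL[OF k]
  let ?U = "Uk k j" and ?O = "cell k j (Uk k j)"
  let ?op = "{A. openin (subtopology (Mtop val n) ?U) A}"
  have UM: "?U \<subseteq> Mn" using Uk_GL[OF kG] GL_Mn by auto
  have opsub: "A \<subseteq> ?U" if "A \<in> ?op" for A using openin_subset[of "subtopology (Mtop val n) ?U" A] that by simp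
  then have opP: "?op \<subseteq> Pow ?U" by blast
  define N where "N = sigma ?U ?op"
  have N: "space N = ?U" "sets N = sigma_sets ?U ?op" unfolding N_def
    using space_measure_of[OF opP] sets_measure_of[OF opP] by blast+
  have cellG: "cell k j A \<subseteq> Gn" if "A \<subseteq> ?U" for A
    using that Uk_GL[OF kG] Qg_GL kG by (auto simp: cell_def intro!: GL_mult)
  have cellS: "cell k j A \<in> sets \<mu>" if "A \<in> ?op" for A
    using haar_G_open[OF mu open_cell[OF k j]] that cellG[OF opsub] by auto
  have topU: "?U \<in> ?op" using UM by (auto simp: openin_subtopology_refl topspace_Mtop)
  have space_mu: "space \<mu> = Gn" using mu by (simp add: haar_G_def haar_on_def)
  \<comment> \<open>The radical coordinate of a point of the cell, unique by
    \<open>cell_inj\<close>.\<close>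
  define p where "p y = (SOME u. u \<in> ?U \<and> (\<exists>q\<in>Qg j. y = u * (k * q)))" for y
  have p: "p (u * (k * q)) = u" if "u \<in> ?U" "q \<in> Qg j" for u q
    unfolding p_def by (rule some_equality) (use that cell_inj[OF kG j] in blast)+
  have pre: "p -` A \<inter> ?O = cell k j A" if "A \<subseteq> ?U" for A
  proof (intro equalityI subsetI)
    fix y assume "y \<in> p -` A \<inter> ?O"
    then obtain u q where uq: "u \<in> ?U" "q \<in> Qg j" "y = u * (k * q)" "p y \<in> A" by (auto simp: cell_def)
    then have "u \<in> A" using p[OF uq(1,2)] by simp
    then show "y \<in> cell k j A" using uq unfolding cell_def by blast
  next
    fix y assume "y \<in> cell k j A"
    then obtain u q where uq: "u \<in> A" "q \<in> Qg j" "y = u * (k * q)" by (auto simp: cell_def)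
    then have "u \<in> ?U" "p y = u" using that p[of u q] by auto
    then show "y \<in> p -` A \<inter> ?O" using uq unfolding cell_def by blast
  qed
  define R where "R = restrict_space \<mu> ?O"
  have OS: "?O \<in> sets \<mu>" by (rule cellS[OF topU])
  have spR: "space R = ?O" using cellG[of ?U] by (auto simp: R_def space_restrict_space space_mu)
  have pm: "p \<in> measurable R N"
    unfolding N_def
  proof (rule measurable_sigma_sets)
    show "sets (sigma ?U ?op) = sigma_sets ?U ?op" using opP by simp
    show "?op \<subseteq> Pow ?U" by (rule opP)
    show "p \<in> space R \<rightarrow> ?U" using p spR by (auto simp: cell_def)
    fix A assume A: "A \<in> ?op"
    have "p -` A \<inter> space R = cell k j A" unfolding spR using opsub[OF A] by (rule pre)
    moreover have "cell k j A \<subseteq> ?O" using opsub[OF A] by (auto simp: cell_def)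
    ultimately show "p -` A \<inter> space R \<in> sets R"
      unfolding R_def using OS cellS[OF A] by (simp add: sets_restrict_space_iff)
  qed
  define \<nu> where "\<nu> = distr R N p"
  have em: "emeasure \<nu> A = emeasure \<mu> (cell k j A)" "cell k j A \<in> sets \<mu>" if A: "A \<in> sets N" for A
  proof -
    have AU: "A \<subseteq> ?U" using sets.sets_into_space[OF A] N by simp
    have "p -` A \<inter> space R \<in> sets R" by (rule measurable_sets[OF pm A])
    then show "cell k j A \<in> sets \<mu>" using pre[OF AU] OS spR
      by (auto simp: R_def sets_restrict_space_iff)
    have "emeasure \<nu> A = emeasure R (cell k j A)"
      unfolding \<nu>_def using emeasure_distr[OF pm A] pre[OF AU] spR by simp
    also have "\<dots> = emeasure \<mu> (cell k j A)"
      unfolding R_def by (rule emeasure_restrict_space) (use OS AU in \<open>auto simp: cell_def\<close>)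
    finally show "emeasure \<nu> A = emeasure \<mu> (cell k j A)" .
  qed
  have opN: "A \<in> sets N" if "A \<in> ?op" for A using that N by auto
  let ?b = "\<lambda>b. {u \<in> ?U. bd b (u - One)}"
  have bN: "?b b \<in> sets N" for b by (rule opN) (use open_Uk_ball[OF kG] in auto)
  have bmono: "?b b \<subseteq> ?b c" if "c \<le> b" for b c using that by (auto elim: bd_mono)
  \<comment> \<open>The formula \<open>em\<close> can be applied to a translated set only if that
    set is again measurable.\<close>
  have trans: "(\<lambda>y. h * y) ` A \<in> sets N" if h: "h \<in> ?U" and A: "A \<in> sets N" for h A
  proof -
    have AU: "A \<subseteq> ?U" using sets.sets_into_space[OF A] N by simp
    note hi = Uk_minv[OF kG h]
    have "(\<lambda>y. minv n h * y) \<in> measurable N N"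
    proof (rule measurable_sigma_sets[OF N(2) opP])
      show "(\<lambda>y. minv n h * y) \<in> space N \<rightarrow> ?U" using Uk_mult[OF kG hi] N by auto
      show "(\<lambda>y. minv n h * y) -` B \<inter> space N \<in> sets N" if "B \<in> ?op" for B
        unfolding N(1) by (rule opN) (use open_Uk_translate[OF kG hi] that in auto)
    qed
    from measurable_sets[OF this A] show ?thesis unfolding Uk_translate[OF kG h AU] N(1) .
  qed
  have inv: "emeasure \<nu> ((\<lambda>y. h * y) ` A) = emeasure \<nu> A" if h: "h \<in> ?U" and A: "A \<in> sets N" for h A
  proof -
    have AU: "A \<subseteq> ?U" using sets.sets_into_space[OF A] N by simp
    note hG = Uk_GL[OF kG h]
    have as: "h * u * (k * q) = h * (u * (k * q))" if "u \<in> A" "q \<in> Qg j" for u q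
      using that AU Uk_GL[OF kG, of u] Qg_GL[of q] hG kG by (auto simp: massoc gsimps mcarr)
    have "cell k j ((\<lambda>y. h * y) ` A) = (\<lambda>y. h * y) ` cell k j A"
    proof (intro equalityI subsetI)
      fix z assume "z \<in> cell k j ((\<lambda>y. h * y) ` A)"
      then obtain u q where "u \<in> A" "q \<in> Qg j" "z = h * u * (k * q)" by (auto simp: cell_def)
      then show "z \<in> (\<lambda>y. h * y) ` cell k j A" using as by (auto simp: cell_def)
    next
      fix z assume "z \<in> (\<lambda>y. h * y) ` cell k j A"
      then obtain u q where uq: "u \<in> A" "q \<in> Qg j" "z = h * (u * (k * q))" by (auto simp: cell_def)
      then have "z = (h * u) * (k * q)" using as by simp
      then show "z \<in> cell k j ((\<lambda>y. h * y) ` A)" using uq(1,2) unfolding cell_def by blast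
    qed
    then show ?thesis using em[OF A] em[OF trans[OF h A]] haar_G_invariant[OF mu hG] by simp
  qed
  have pos: "emeasure \<nu> (?b b) > 0" for b
  proof -
    define s where "s = max 1 b"
    have s: "s \<ge> 1" "b \<le> s" by (auto simp: s_def)
    have "lcos k s \<subseteq> cell k j (?b b)"
    proof
      fix z assume "z \<in> lcos k s"
      then obtain \<kappa> where \<kappa>: "\<kappa> \<in> Ks s" "z = k * \<kappa>" by (auto simp: lcos_def)
      obtain X p where X: "X \<in> Rad (Ej j)" "bd s X" "p \<in> Qg j" "\<kappa> = (One + X) * p"
        using Ks_Uk_Qg[OF s(1) j \<kappa>(1)] by blast
      have "bd (- 0) One" using bd_One by simp
      note Uk_near[OF k X(1,2) Uk_One[OF kG] this]
      moreover have "One * (k * (One + X) * minv n k) = k * (One + X) * minv n k"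
        using kG Rad_Mn[OF X(1)] by (simp add: mring mcarr gsimps)
      ultimately have "k * (One + X) * minv n k \<in> ?b b" using s by (auto elim: bd_mono)
      moreover have "z = (k * (One + X) * minv n k) * (k * p)"
        unfolding \<kappa>(2) X(4) using kG Rad_Mn[OF X(1)] Qg_GL[OF X(3)] by (simp add: massoc mcarr gsimps)
      ultimately show "z \<in> cell k j (?b b)" using X(3) by (auto simp: cell_def)
    qed
    then have "emeasure \<mu> (lcos k s) \<le> emeasure \<mu> (cell k j (?b b))" by (rule emeasure_mono[OF _ em(2)[OF bN]])
    then show ?thesis using haar_G_Ks_pos[OF mu s(1)] haar_G_lcos(2)[OF mu kG s(1)] em(1)[OF bN] by (simp add: less_le_trans)
  qed
  have fin: "emeasure \<nu> (?b b) < \<infinity>" for b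
  proof -
    define c where "c = max 0 (- b)"
    have cc: "c \<ge> 0" "- c \<le> b" by (auto simp: c_def)
    have ub: "bd (- c) u" if "u \<in> ?U" "bd b (u - One)" for u
    proof -
      have uM: "u \<in> Mn" using Uk_GL[OF kG that(1)] GL_Mn by auto
      have "bd (- c) ((u - One) + One)"
        by (rule bd_add) (use that uM cc bd_mono[OF that(2) cc(2)] bd_mono[OF bd_One, of "- c"] in \<open>auto simp: mcarr\<close>)
      moreover have "(u - One) + One = u" using uM by (intro ent_eqI) (auto simp: msimps)
      ultimately show ?thesis by simp
    qed
    have ui: "bd b (minv n u - One)" if u: "u \<in> ?U" "bd b (u - One)" for u
    proof -
      obtain X where X: "X \<in> Rad (Ej j)" "u = k * (One + X) * minv n k" using u by (auto simp: Uk_def)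
      note XM = Rad_Mn[OF X(1)] and inv = Rad_unip_inv[OF Ej_Mn X(1)]
      have "minv n u = k * (One - X) * minv n k"
        unfolding X(2) using kG inv XM by (simp add: minv_mult gsimps massoc mcarr)
      then have "minv n u - One = - (u - One)"
        unfolding X(2) using kG XM by (intro ent_eqI) (auto simp: msimps gsimps)
      then show ?thesis using u GL_Mn[OF Uk_GL[OF kG u(1)]] by (simp add: bd_uminus mcarr)
    qed
    have "emeasure \<mu> (cell k j (?b b)) < \<infinity>"
    proof (rule haar_G_finite[OF mu])
      fix g assume "g \<in> cell k j (?b b)"
      then obtain u q where uq: "u \<in> ?U" "bd b (u - One)" "q \<in> Qg j" "g = u * (k * q)" by (auto simp: cell_def)
      have kq: "k * q \<in> GL_O val n" using k uq(3) Ks_GL_O[of 1 q] by (auto simp: Qg_def intro: GL_O_mult)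
      note uG = Uk_GL[OF kG uq(1)]
      have "bd (- c + 0) (u * (k * q))" by (rule bd_mult) (use uG kq ub[OF uq(1,2)] GL_O_GL[OF kq] in \<open>auto simp: gsimps GL_O_bd\<close>)
      moreover have "bd (0 + - c) (minv n (k * q) * minv n u)"
        by (rule bd_mult) (use uG kq ub[OF Uk_minv[OF kG uq(1)] ui[OF uq(1,2)]] GL_O_GL[OF kq] in \<open>auto simp: gsimps GL_O_bd\<close>)
      ultimately show "g \<in> Gn \<and> bd (- c) g \<and> bd (- c) (minv n g)"
        using uq(4) uG GL_O_GL[OF kq] by (simp add: minv_mult GL_mult)
    qed
    then show ?thesis using em(1)[OF bN] by simp
  qed
  have "haar_on val n ?U \<nu>"
    unfolding haar_on_def
  proof (intro conjI ballI allI impI)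
    show "space \<nu> = ?U" by (simp add: \<nu>_def N)
    show "sets \<nu> = borel_sets (subtopology (Mtop val n) ?U)"
      using borel_sets_subtopology[OF UM] by (simp add: \<nu>_def N)
    fix h A assume "h \<in> ?U" "A \<in> sets \<nu>"
    then show "emeasure \<nu> ((\<lambda>y. h * y) ` A) = emeasure \<nu> A" using inv by (simp add: \<nu>_def)
  next
    show "emeasure \<nu> ?U > 0"
      using pos[of 0] emeasure_mono[of "?b 0" ?U \<nu>] opN[OF topU] by (auto simp: \<nu>_def intro: less_le_trans)
    fix C assume C: "compactin (subtopology (Mtop val n) ?U) C"
    have CU: "C \<subseteq> ?U" using compactin_subset_topspace[OF C] by auto
    \<comment> \<open>Balls of growing radius are open and exhaust the radical, so a compact set
      lies in one of them and has finite measure by \<open>fin\<close>.\<close>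
    let ?F = "range (\<lambda>b::nat. ?b (- int b))"
    have op: "openin (subtopology (Mtop val n) ?U) V" if "V \<in> ?F" for V
      using open_Uk_ball[OF kG] that by auto
    have cov: "C \<subseteq> \<Union>?F"
    proof
      fix u assume u: "u \<in> C"
      obtain b where b: "b \<ge> 0" "bd (- b) (u - One)" using bd_exists by blast
      then have "u \<in> ?b (- int (nat b))" using u CU by auto
      then show "u \<in> \<Union>?F" by blast
    qed
    have "\<exists>F. finite F \<and> F \<subseteq> ?F \<and> C \<subseteq> \<Union>F" by (rule compactinD[OF C op cov])
    then obtain F where F: "finite F" "F \<subseteq> ?F" "C \<subseteq> \<Union>F" by (elim exE conjE)
    obtain S where S: "finite S" "F = (\<lambda>b::nat. ?b (- int b)) ` S"
      using finite_subset_image[OF F(1,2)] by blast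
    obtain B where B: "\<forall>b\<in>S. b \<le> B" using S(1) by (meson finite_nat_set_iff_bounded_le)
    have "C \<subseteq> ?b (- int B)"
    proof
      fix u assume "u \<in> C"
      then obtain b where "b \<in> S" "u \<in> ?b (- int b)" using F(3) S(2) by blast
      then show "u \<in> ?b (- int B)" using B bmono[of "- int B" "- int b"] by auto
    qed
    then have "emeasure \<nu> C \<le> emeasure \<nu> (?b (- int B))" using bN by (intro emeasure_mono) (auto simp: \<nu>_def)
    then show "emeasure \<nu> C < \<infinity>" using fin by (rule le_less_trans)
  qed
  then show ?thesis using pos fin by blast
qed

subsection \<open>The flag of a unipotent radical\<close>

text \<open>For invertible \<open>k\<close> this is the image under \<open>k\<close> of the span of
  the first \<open>j\<close> unit vectors, described by the coordinates of the preimage.\<close>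

definition Wk :: "'a mat \<Rightarrow> nat \<Rightarrow> 'a vec set" where
  "Wk k j = {v \<in> carrier_vec n. \<forall>i<n. j \<le> i \<longrightarrow> (minv n k *\<^sub>v v) $ i = 0}"

lemma vec_cancel:
  assumes "k \<in> Gn" "v \<in> carrier_vec n"
  shows "k *\<^sub>v (minv n k *\<^sub>v v) = v" "minv n k *\<^sub>v (k *\<^sub>v v) = v"
  using assms by (simp_all add: assoc_mult_mat_vec[symmetric, of _ n n _ n] gsimps)

lemma mat_zero_vec: "A \<in> Mn \<Longrightarrow> A *\<^sub>v 0\<^sub>v n = 0\<^sub>v n"
  by (rule eq_vecI) (auto simp: scalar_prod_def)

lemma mat_col_ext:
  assumes "A \<in> Mn" "i < n" "l < n"
  shows "(A *\<^sub>v unit_vec n l) $ i = A $$ (i,l)"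
  using assms by (simp add: mult_mat_vec_def row_def)

lemma proper_flag_Wk:
  assumes k: "k \<in> Gn" and j: "0 < j" "j < n"
  shows "proper_flag n [Wk k j]"
proof -
  note kM = GL_Mn[OF k] minv_Mn[OF k]
  have sub: "Wk k j \<subseteq> carrier_vec n" by (auto simp: Wk_def)
  have z: "0\<^sub>v n \<in> Wk k j" using kM by (auto simp: Wk_def mult_mat_vec_def)
  have ls: "lsubspace n (Wk k j)"
    unfolding lsubspace_def
  proof (intro conjI ballI allI sub z)
    fix v w assume vw: "v \<in> Wk k j" "w \<in> Wk k j"
    then have c: "v \<in> carrier_vec n" "w \<in> carrier_vec n" by (auto simp: Wk_def)
    have "minv n k *\<^sub>v (v + w) = minv n k *\<^sub>v v + minv n k *\<^sub>v w"
      by (rule mult_add_distrib_mat_vec[OF kM(2) c])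
    then show "v + w \<in> Wk k j" using vw c kM by (auto simp: Wk_def simp del: index_mult_mat_vec)
  next
    fix c v assume v: "v \<in> Wk k j"
    then have "v \<in> carrier_vec n" by (auto simp: Wk_def)
    moreover from this have "minv n k *\<^sub>v (c \<cdot>\<^sub>v v) = c \<cdot>\<^sub>v (minv n k *\<^sub>v v)"
      by (intro mult_mat_vec[OF kM(2)])
    ultimately show "c \<cdot>\<^sub>v v \<in> Wk k j" using v kM by (auto simp: Wk_def)
  qed
  have u: "minv n k *\<^sub>v (k *\<^sub>v unit_vec n l) = unit_vec n l" "k *\<^sub>v unit_vec n l \<in> carrier_vec n" for l
    using vec_cancel(2)[OF k, of "unit_vec n l"] kM by auto
  have "k *\<^sub>v unit_vec n 0 \<in> Wk k j" using u[of 0] j by (auto simp: Wk_def)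
  moreover have "k *\<^sub>v unit_vec n 0 \<noteq> 0\<^sub>v n"
  proof
    assume "k *\<^sub>v unit_vec n 0 = 0\<^sub>v n"
    then have "unit_vec n 0 = minv n k *\<^sub>v 0\<^sub>v n" using u(1)[of 0] by simp
    then have "unit_vec n 0 = (0\<^sub>v n :: 'a vec)" by (simp only: mat_zero_vec[OF kM(2)])
    then have "unit_vec n 0 $ 0 = (0\<^sub>v n :: 'a vec) $ 0" by simp
    then show False using j by simp
  qed
  ultimately have 1: "{0\<^sub>v n} \<subset> Wk k j" using z by blast
  have "k *\<^sub>v unit_vec n (n - 1) \<notin> Wk k j"
  proof
    assume "k *\<^sub>v unit_vec n (n - 1) \<in> Wk k j"
    then have "(minv n k *\<^sub>v (k *\<^sub>v unit_vec n (n - 1))) $ (n - 1) = 0" using j by (simp add: Wk_def)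
    then show False unfolding u(1) using j by simp
  qed
  then have 2: "Wk k j \<subset> carrier_vec n" using sub u(2)[of "n - 1"] by blast
  show ?thesis unfolding proper_flag_def flag_chain_def using ls 1 2 by auto
qed

text \<open>In the coordinates given by \<open>k\<close>, acting trivially on the subspace kills the
  first \<open>j\<close> columns of \<open>X\<close>, and acting trivially on the quotient kills its
  rows from \<open>j\<close> on.\<close>

lemma unip_radical_Wk:
  assumes k: "k \<in> Gn" and j: "0 < j" "j < n"
  shows "unip_radical n [Wk k j] = Uk k j"
proof -
  note kM = GL_Mn[OF k] minv_Mn[OF k]
  have all2: "(\<forall>i<length [Wk k j] + 1. P i) \<longleftrightarrow> P 0 \<and> P 1" for P
    by (auto simp: less_Suc_eq)
  have iff: "g \<in> unip_radical n [Wk k j] \<longleftrightarrow> g \<in> Gn \<and> (\<forall>v\<in>Wk k j. g *\<^sub>v v - v = 0\<^sub>v n) \<and>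
      (\<forall>v\<in>carrier_vec n. g *\<^sub>v v - v \<in> Wk k j)" for g
    unfolding unip_radical_def all2 by (simp add: flag_chain_def)
  have key: "(k * (One + X) * minv n k) *\<^sub>v v - v = k *\<^sub>v (X *\<^sub>v (minv n k *\<^sub>v v))"
    if X: "X \<in> Mn" and v: "v \<in> carrier_vec n" for X v
  proof -
    let ?w = "minv n k *\<^sub>v v"
    have w: "?w \<in> carrier_vec n" by (rule mult_mat_vec_carrier[OF kM(2) v])
    have "(k * (One + X) * minv n k) *\<^sub>v v = k *\<^sub>v ((One + X) *\<^sub>v ?w)"
      using kM X v by (simp add: assoc_mult_mat_vec[of _ n n _ n] mcarr)
    also have "(One + X) *\<^sub>v ?w = ?w + X *\<^sub>v ?w"
      using X w by (simp add: add_mult_distrib_mat_vec[of _ n n])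
    also have "k *\<^sub>v (?w + X *\<^sub>v ?w) = k *\<^sub>v ?w + k *\<^sub>v (X *\<^sub>v ?w)"
      by (rule mult_add_distrib_mat_vec[OF kM(1) w]) (use X w in simp)
    also have "k *\<^sub>v ?w = v" using vec_cancel(1)[OF k v] .
    finally have "(k * (One + X) * minv n k) *\<^sub>v v = v + k *\<^sub>v (X *\<^sub>v ?w)" .
    then show ?thesis using v kM X by auto
  qed
  show ?thesis
  proof (intro equalityI subsetI)
    fix g assume "g \<in> Uk k j"
    then obtain X where X: "X \<in> Rad (Ej j)" "g = k * (One + X) * minv n k" by (auto simp: Uk_def)
    note XM = Rad_Mn[OF X(1)]
    have X0: "X $$ (i,l) = 0" if "i < n" "l < n" "\<not> (i < j \<and> j \<le> l)" for i l
      using X(1) that by (auto simp: Rad_Ej_iff)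
    have Xw: "(X *\<^sub>v w) $ i = (\<Sum>l<n. X $$ (i,l) * w $ l)" if "i < n" "w \<in> carrier_vec n" for i w
      using that XM by (auto simp: mult_mat_vec_def scalar_prod_def lessThan_atLeast0)
    have "g *\<^sub>v v - v = 0\<^sub>v n" if v: "v \<in> Wk k j" for v
    proof -
      have vc: "v \<in> carrier_vec n" using v by (simp add: Wk_def)
      let ?w = "minv n k *\<^sub>v v"
      have w: "?w \<in> carrier_vec n" "\<And>i. i < n \<Longrightarrow> j \<le> i \<Longrightarrow> ?w $ i = 0" using v kM by (auto simp: Wk_def)
      have "X *\<^sub>v ?w = 0\<^sub>v n"
      proof (rule eq_vecI)
        fix i assume i: "i < dim_vec (0\<^sub>v n)"
        then have "(X *\<^sub>v ?w) $ i = (\<Sum>l<n. X $$ (i,l) * ?w $ l)" using Xw w(1) by simp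
        also have "\<dots> = 0" using w(2) X0 i by (intro sum.neutral) (metis index_zero_vec(2) lessThan_iff mult_eq_0_iff)
        finally show "(X *\<^sub>v ?w) $ i = 0\<^sub>v n $ i" using i by simp
      qed (use XM in simp)
      then show ?thesis using key[OF XM vc] X(2) mat_zero_vec[OF kM(1)] by simp
    qed
    moreover have "g *\<^sub>v v - v \<in> Wk k j" if v: "v \<in> carrier_vec n" for v
    proof -
      let ?w = "minv n k *\<^sub>v v"
      have w: "?w \<in> carrier_vec n" by (rule mult_mat_vec_carrier[OF kM(2) v])
      have Xwc: "X *\<^sub>v ?w \<in> carrier_vec n" using XM w by auto
      have "(X *\<^sub>v ?w) $ i = 0" if "i < n" "j \<le> i" for i
        using Xw[OF that(1) w] X0[OF that(1)] that by simp
      moreover have "minv n k *\<^sub>v (g *\<^sub>v v - v) = X *\<^sub>v ?w"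
        using key[OF XM v] X(2) vec_cancel(2)[OF k Xwc] by simp
      moreover have "g *\<^sub>v v - v \<in> carrier_vec n" using key[OF XM v] X(2) kM Xwc by auto
      ultimately show ?thesis by (simp add: Wk_def)
    qed
    moreover have "g \<in> Gn" using Uk_GL[OF k] \<open>g \<in> Uk k j\<close> by blast
    ultimately show "g \<in> unip_radical n [Wk k j]" unfolding iff by blast
  next
    fix g assume "g \<in> unip_radical n [Wk k j]"
    then have g: "g \<in> Gn" "\<And>v. v \<in> Wk k j \<Longrightarrow> g *\<^sub>v v - v = 0\<^sub>v n"
      "\<And>v. v \<in> carrier_vec n \<Longrightarrow> g *\<^sub>v v - v \<in> Wk k j" unfolding iff by auto
    define X where "X = minv n k * g * k - One"
    have XM: "X \<in> Mn" using kM g(1) by (simp add: X_def mcarr gsimps)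
    have gX: "g = k * (One + X) * minv n k"
    proof -
      have "One + X = minv n k * g * k" unfolding X_def using kM g(1)
        by (intro ent_eqI) (auto simp: msimps gsimps)
      then show ?thesis using k g(1) by (simp add: massoc mcarr gsimps mring)
    qed
    have col: "X $$ (i,l) = (minv n k *\<^sub>v (g *\<^sub>v (k *\<^sub>v unit_vec n l) - k *\<^sub>v unit_vec n l)) $ i"
      if "i < n" "l < n" for i l
    proof -
      let ?v = "k *\<^sub>v unit_vec n l"
      have v: "?v \<in> carrier_vec n" "minv n k *\<^sub>v ?v = unit_vec n l" using kM vec_cancel(2)[OF k] by auto
      have "X *\<^sub>v unit_vec n l \<in> carrier_vec n" using XM by auto
      then have "minv n k *\<^sub>v (g *\<^sub>v ?v - ?v) = X *\<^sub>v unit_vec n l"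
        using key[OF XM v(1)] v(2) gX vec_cancel(2)[OF k] by simp
      then show ?thesis using mat_col_ext[OF XM that] by simp
    qed
    have "X $$ (i,l) = 0" if il: "i < n" "l < n" "\<not> (i < j \<and> j \<le> l)" for i l
    proof (cases "l < j")
      case True
      have "k *\<^sub>v unit_vec n l \<in> Wk k j"
        using vec_cancel(2)[OF k, of "unit_vec n l"] kM True il
        by (auto simp: Wk_def simp del: index_mult_mat_vec)
      then have "g *\<^sub>v (k *\<^sub>v unit_vec n l) - k *\<^sub>v unit_vec n l = 0\<^sub>v n" by (rule g(2))
      then show ?thesis using col[OF il(1,2)] il by (simp add: mat_zero_vec[OF kM(2)] del: index_mult_mat_vec)
    next
      case False
      have "k *\<^sub>v unit_vec n l \<in> carrier_vec n" using kM by auto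
      from g(3)[OF this] show ?thesis using col[OF il(1,2)] il False by (simp add: Wk_def)
    qed
    then have "X \<in> Rad (Ej j)" using XM by (auto simp: Rad_Ej_iff)
    then show "g \<in> Uk k j" using gX by (auto simp: Uk_def)
  qed
qed

lemma open_Uk_subgroup:
  assumes k: "k \<in> Gn" and A: "A \<subseteq> Uk k j"
    and cl: "\<And>u w. u \<in> A \<Longrightarrow> w \<in> Uk k j \<Longrightarrow> bd b (w - One) \<Longrightarrow> u * w \<in> A"
  shows "openin (subtopology (Mtop val n) (Uk k j)) A"
proof -
  let ?A = "{y \<in> Mn. \<exists>u\<in>A. bd b (minv n u * y - One)}"
  have AG: "u \<in> Gn" if "u \<in> A" for u using Uk_GL[OF k] A that by blast
  have "openin (Mtop val n) ?A"
    unfolding openin_Mtop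
  proof (intro ballI conjI)
    fix y assume y: "y \<in> ?A"
    then obtain u where u: "u \<in> A" "bd b (minv n u * y - One)" by blast
    obtain c where c: "c \<ge> 0" "bd (- c) (minv n u)" using bd_exists by blast
    have "{z \<in> Mn. bd (b + c) (z - y)} \<subseteq> ?A"
    proof
      fix z assume z: "z \<in> {z \<in> Mn. bd (b + c) (z - y)}"
      note uG = AG[OF u(1)]
      have "bd (- c + (b + c)) (minv n u * (z - y))" using z y uG c by (intro bd_mult) (auto simp: gsimps mcarr)
      then have "bd b (minv n u * (z - y) + (minv n u * y - One))"
        using u z y uG by (intro bd_add) (auto simp: gsimps mcarr)
      moreover have "minv n u * (z - y) + (minv n u * y - One) = minv n u * z - One"
        using z y uG by (intro ent_eqI) (auto simp: msimps gsimps)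
      ultimately show "z \<in> ?A" using z u by auto
    qed
    then show "\<exists>k. {z \<in> Mn. bd k (z - y)} \<subseteq> ?A" by blast
  qed auto
  moreover have "A = ?A \<inter> Uk k j"
  proof (intro equalityI subsetI)
    fix u assume u: "u \<in> A"
    have "minv n u * u - One = Zero" using AG[OF u] by (simp add: gsimps mzero mcarr)
    then have "bd b (minv n u * u - One)" by (simp add: bd_Zero)
    then show "u \<in> ?A \<inter> Uk k j" using u A AG[OF u] GL_Mn by blast
  next
    fix y assume y: "y \<in> ?A \<inter> Uk k j"
    then obtain u where u: "u \<in> A" "bd b (minv n u * y - One)" by blast
    have "minv n u * y \<in> Uk k j" using u A y by (intro Uk_mult[OF k] Uk_minv[OF k]) auto
    then have "u * (minv n u * y) \<in> A" using cl u by blast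
    then show "y \<in> A" using AG[OF u(1)] y by (auto simp: gsimps)
  qed
  ultimately show ?thesis unfolding openin_subtopology by blast
qed

lemma add_cancel_Mn:
  assumes "A \<in> Mn" "B \<in> Mn" "C \<in> Mn" "A + B = A + C"
  shows "B = C"
proof (rule ent_eqI)
  fix i l assume il: "i < n" "l < n"
  have "ent i l (A + B) = ent i l (A + C)" using assms(4) by simp
  then show "ent i l B = ent i l C" using il assms(1-3) by (simp add: ents)
qed (use assms in auto)

subsection \<open>Vanishing of orbit sums\<close>

text \<open>Quantitative form of compact support modulo the centre: the scalar may vary with
  \<open>y\<close>, the bound may not.\<close>

definition supp_bound :: "('a mat \<Rightarrow> complex) \<Rightarrow> int \<Rightarrow> bool" where
  "supp_bound f b \<longleftrightarrow> b \<ge> 0 \<and> (\<forall>y\<in>Gn. f y \<noteq> 0 \<longrightarrow>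
     (\<exists>c. c \<noteq> 0 \<and> bd (- b) (c \<cdot>\<^sub>m y) \<and> bd (- b) (minv n (c \<cdot>\<^sub>m y))))"

lemma supp_bound_exists: "compact_supp_mod_center val n f \<Longrightarrow> \<exists>b. supp_bound f b"
proof -
  assume "compact_supp_mod_center val n f"
  then obtain C where C: "compactin (subtopology (Mtop val n) Gn) C"
    "\<forall>x\<in>Gn. f x \<noteq> 0 \<longrightarrow> (\<exists>c. c \<noteq> 0 \<and> c \<cdot>\<^sub>m x \<in> C)" by (auto simp: compact_supp_mod_center_def)
  then obtain b where "b \<ge> 0" "\<forall>y\<in>C. bd (- b) y \<and> bd (- b) (minv n y)" using compactin_bounded by blast
  then show ?thesis using C(2) unfolding supp_bound_def by blast
qed

text \<open>The scalar that brings \<open>y\<close> into the compact set is not unique, but the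
  determinant fixes its valuation up to an error of \<open>b\<close>.\<close>

lemma scaled_det_bound:
  assumes y: "y \<in> Gn" and c: "c \<noteq> 0" and b: "bd (- b) (c \<cdot>\<^sub>m y)" "bd (- b) (minv n (c \<cdot>\<^sub>m y))"
  shows "- (int n * b) \<le> int n * val c + val (det y)" "int n * val c + val (det y) \<le> int n * b"
proof -
  have G: "c \<cdot>\<^sub>m y \<in> Gn" using GL_smult[OF c y] .
  have d: "det (c \<cdot>\<^sub>m y) \<noteq> 0" "val (det (c \<cdot>\<^sub>m y)) = int n * val c + val (det y)"
    using y c GL_Mn[OF y] by (auto simp: GL_iff val_mult val_power)
  have "vge (- (int n * b)) (det (c \<cdot>\<^sub>m y))" by (rule bd_det[OF GL_Mn[OF G] b(1)])
  then have "- (int n * b) \<le> val (det (c \<cdot>\<^sub>m y))" using vge_nonzero[OF d(1)] by blast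
  then show "- (int n * b) \<le> int n * val c + val (det y)" by (simp only: d(2))
  have "vge (- (int n * b)) (det (minv n (c \<cdot>\<^sub>m y)))" by (rule bd_det[OF minv_Mn[OF G] b(2)])
  then have "vge (- (int n * b)) (inverse (det (c \<cdot>\<^sub>m y)))" unfolding det_minv[OF G] .
  then have "- (int n * b) \<le> - val (det (c \<cdot>\<^sub>m y))" using d(1) by (metis inverse_nonzero_iff_nonzero val_inverse vge_nonzero)
  then show "int n * val c + val (det y) \<le> int n * b" unfolding d(2) by simp
qed

text \<open>Equal determinants force the valuations of the two scalars to differ by at most
  \<open>2 * b\<close>; the bounded matrix and the bounded inverse cost another \<open>b\<close>
  each.\<close>

lemma supp_bound_ratio:
  assumes f: "supp_bound f b" and p: "p \<in> Gn" "q \<in> Gn" "f p \<noteq> 0" "f q \<noteq> 0" and d: "det p = det q"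
  shows "bd (- (4 * b)) (p * minv n q)"
proof -
  obtain c where c: "c \<noteq> 0" "bd (- b) (c \<cdot>\<^sub>m p)" "bd (- b) (minv n (c \<cdot>\<^sub>m p))" using f p by (auto simp: supp_bound_def)
  obtain e where e: "e \<noteq> 0" "bd (- b) (e \<cdot>\<^sub>m q)" "bd (- b) (minv n (e \<cdot>\<^sub>m q))" using f p by (auto simp: supp_bound_def)
  have "int n * (val e - val c) \<ge> int n * (- (2 * b))"
    using scaled_det_bound[OF p(1) c] scaled_det_bound[OF p(2) e] d by (simp add: algebra_simps)
  then have "val e - val c \<ge> - (2 * b)" 
    using mult_le_cancel_left_pos[of "int n" "- (2 * b)" "val e - val c"] n_pos by simp
  then have v: "vge (- (2 * b)) (e * inverse c)" using c e by (auto simp: vge_def val_mult val_inverse)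
  have "bd (- b + - b) ((c \<cdot>\<^sub>m p) * minv n (e \<cdot>\<^sub>m q))"
    using c e p by (intro bd_mult) (auto simp: gsimps mcarr GL_smult)
  then have "bd (- (2 * b) + (- b + - b)) ((e * inverse c) \<cdot>\<^sub>m ((c \<cdot>\<^sub>m p) * minv n (e \<cdot>\<^sub>m q)))"
    using c e p by (intro bd_smult v) (auto simp: gsimps mcarr GL_smult)
  moreover have "(e * inverse c) \<cdot>\<^sub>m ((c \<cdot>\<^sub>m p) * minv n (e \<cdot>\<^sub>m q)) = p * minv n q"
  proof -
    have "e * inverse c * (inverse e * c) = 1" using c(1) e(1) by (simp add: field_simps)
    then show ?thesis using c(1) e(1) p by (simp add: minv_smult mring smult_smult gsimps mcarr one_smult)
  qed
  ultimately show ?thesis by simp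
qed

lemma Delta_conj:
  assumes "x \<in> Mn" "k \<in> Gn"
  shows "Delta (k * x * minv n k) = Delta x"
proof -
  have "similar_mat (k * x * minv n k) x"
    by (rule similar_matI[of _ _ k "minv n k" n]) (use assms in \<open>auto simp: gsimps mcarr\<close>)
  then show ?thesis by (simp add: Delta_def char_poly_similar)
qed

lemma contracting_conj_Rad:
  assumes e: "splitting e" and a: "contracting a e M"
  shows "X \<in> Rad e \<Longrightarrow> a * X * minv n a \<in> Rad e" "X \<in> Rad e \<Longrightarrow> minv n a * X * a \<in> Rad e"
    "X \<in> Rad (One - e) \<Longrightarrow> a * X * minv n a \<in> Rad (One - e)"
proof -
  note eM = splittingD(1,2)[OF e]
  have aG: "a \<in> Gn" and com: "a * e = e * a" using a by (auto simp: contracting_def)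
  have aP: "a \<in> Par e"
    using com eM splittingD(4)[OF e] GL_Mn[OF aG] by (auto simp: Par_def)
  note iP = Par_minv[OF e aP aG]
  show "X \<in> Rad e \<Longrightarrow> a * X * minv n a \<in> Rad e" "X \<in> Rad e \<Longrightarrow> minv n a * X * a \<in> Rad e"
    by (intro Rad_Par_left[OF eM(1)] Rad_Par_right[OF eM(1)] aP iP; assumption)+
  have icom: "minv n a * e = e * minv n a"
  proof -
    have "minv n a * (a * e) * minv n a = minv n a * (e * a) * minv n a" using com by simp
    then show ?thesis using aG eM(1) by (simp add: massoc gsimps mcarr mring)
  qed
  assume "X \<in> Rad (One - e)"
  then have X: "X \<in> Mn" "e * X = Zero" "X * e = X" unfolding Rad_compl_iff[OF eM(1)] by auto
  have "e * (a * X * minv n a) = (a * e) * X * minv n a" using X(1) aG eM(1) unfolding com by (simp add: massoc gsimps mcarr)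
  also have "\<dots> = a * (e * X) * minv n a" using X(1) aG eM(1) by (simp add: massoc gsimps mcarr)
  also have "\<dots> = Zero" using X(2) aG by (simp add: mring gsimps)
  finally have 1: "e * (a * X * minv n a) = Zero" .
  have "a * X * minv n a * e = a * X * (minv n a * e)" using X(1) aG eM(1) by (simp add: massoc gsimps mcarr)
  also have "\<dots> = a * (X * e) * minv n a" unfolding icom using X(1) aG eM(1) by (simp add: massoc gsimps mcarr)
  finally have 2: "a * X * minv n a * e = a * X * minv n a" using X(3) by simp
  show "a * X * minv n a \<in> Rad (One - e)"
    unfolding Rad_compl_iff[OF eM(1)] using 1 2 X(1) aG by (simp add: gsimps mcarr)
qed

definition conj_val :: "('a mat \<Rightarrow> complex) \<Rightarrow> 'a mat \<Rightarrow> 'a mat \<Rightarrow> complex" where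
  "conj_val f x g = f (g * x * minv n g)"

text \<open>Conjugating \<open>x\<close> by \<open>g (1 + X)\<close> multiplies \<open>g x g\<^sup>-\<^sup>1\<close> on the left by an element of the radical
  \<open>g U g\<^sup>-\<^sup>1\<close>; as \<open>g\<close> expands \<open>U\<close>, these elements exhaust the support of \<open>f\<close> on the coset.\<close>

lemma orbit_sum_zero:
  assumes mu: "haar_G val n \<mu>" and cusp: "cuspidal val n f" and fb: "supp_bound f b"
    and x: "x \<in> Gn" "bd (- \<rho>) x" "\<rho> \<ge> 0" "Delta x \<noteq> 0" "val (Delta x) \<le> \<rho>"
    and j: "0 < j" "j < n" and k1: "k1 \<in> GL_O val n" and a: "contracting a (Ej j) M"
    and k3: "k3 \<in> Gn" "bd (- c) k3" "bd (- c) (minv n k3)" "c \<ge> 0"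
    and zP: "k3 * x * minv n k3 \<in> Par (Ej j)"
    and M: "M \<ge> 4 * b + (\<rho> + 2 * c) + kap (\<rho> + 2 * c) + 2 * c + s"
    and g: "g = k1 * a * k3"
    and L: "L = {X \<in> (\<lambda>X. minv n k3 * X * k3) ` Rad (Ej j). bd s X}"
    and T: "finite T" "T \<subseteq> L" "\<And>X. X \<in> L \<Longrightarrow> \<exists>t\<in>T. bd N (X - t)"
      "\<And>t t'. t \<in> T \<Longrightarrow> t' \<in> T \<Longrightarrow> bd N (t - t') \<Longrightarrow> t = t'"
    and N: "N \<ge> s"
    and inv: "\<And>X Y. X \<in> L \<Longrightarrow> Y \<in> L \<Longrightarrow> bd N (Y - X) \<Longrightarrow> conj_val f x (g * (One + Y)) = conj_val f x (g * (One + X))"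
  shows "(\<Sum>t\<in>T. conj_val f x (g * (One + t))) = 0"
proof (cases "\<forall>t\<in>T. conj_val f x (g * (One + t)) = 0")
  case False
  \<comment> \<open>A nonzero value serves as reference point: the support of \<open>w\<close> to
    \<open>f (w * y)\<close> will be located relative to it.\<close>
  then obtain t0 where t0: "t0 \<in> T" "conj_val f x (g * (One + t0)) \<noteq> 0" by blast
  let ?e = "Ej j"
  have jn: "j \<le> n" using j by simp
  note e = splitting_Ej[OF jn] and eM = Ej_Mn[of j]
  have kG: "k1 \<in> Gn" using k1 by (rule GL_O_GL)
  have aG: "a \<in> Gn" using a by (simp add: contracting_def)
  have gG: "g \<in> Gn" unfolding g using kG aG k3(1) by (intro GL_mult)
  define z where "z = k3 * x * minv n k3"
  have zG: "z \<in> Gn" unfolding z_def using k3(1) x(1) by (intro GL_mult GL_minv)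
  note zM = GL_Mn[OF zG] and zP' = zP[folded z_def]
  note ziP = Par_minv[OF e zP' zG]
  \<comment> \<open>Conjugation by \<open>k3\<close> costs \<open>2 * c\<close>, so \<open>z\<close>
    satisfies the hypotheses of \<open>sylvester_near\<close> with this bound in place of
    \<open>\<rho>\<close>.\<close>
  let ?r = "\<rho> + 2 * c"
  have r0: "?r \<ge> 0" using x(3) k3(4) by simp
  have bz: "bd (- ?r) z"
  proof -
    have "bd (- c + - \<rho> + - c) z" unfolding z_def using k3 x by (intro bd_mult3) (auto simp: gsimps)
    then show ?thesis by (simp add: algebra_simps)
  qed
  have Dz: "Delta z \<noteq> 0" "val (Delta z) \<le> ?r"
    using Delta_conj[OF GL_Mn[OF x(1)] k3(1)] x(4,5) k3(4) by (auto simp: z_def)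
  have zz: "bd (1 + kap ?r) (z - z)" using zM by (simp add: mzero bd_Zero)
  note syl = sylvester_near[OF zM bz r0 Dz zP' e bz zz order_refl]
  \<comment> \<open>Chosen so that \<open>(1 + X) z (1 - X) = (1 + Lam X) z\<close>; after right
    multiplication by \<open>z\<close> it is the Sylvester operator of \<open>z\<close>.
    \<open>An\<close> and \<open>u\<close> transport it to the radical
    \<open>Uk k1 j\<close>.\<close>
  define Lam where "Lam X = X - z * X * minv n z" for X
  define An where "An X = a * Lam X * minv n a" for X
  define u where "u X = k1 * (One + An X) * minv n k1" for X
  have LamR: "Lam X \<in> Rad ?e" if "X \<in> Rad ?e" for X
    unfolding Lam_def by (rule Rad_diff[OF eM that Rad_Par_right[OF eM ziP Rad_Par_left[OF eM zP' that]]])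
  have AnR: "An X \<in> Rad ?e" if "X \<in> Rad ?e" for X
    unfolding An_def by (rule contracting_conj_Rad(1)[OF e a LamR[OF that]])
  have uU: "u X \<in> Uk k1 j" if "X \<in> Rad ?e" for X
    using AnR[OF that] by (auto simp: u_def Uk_def)
  have uG: "u X \<in> Gn" if "X \<in> Rad ?e" for X using Uk_GL[OF kG uU[OF that]] .
  have An_add: "An (X + Y) = An X + An Y" if "X \<in> Rad ?e" "Y \<in> Rad ?e" for X Y
    using Rad_Mn[OF that(1)] Rad_Mn[OF that(2)] zG aG unfolding An_def Lam_def
    by (intro ent_eqI) (simp_all add: msimps gsimps algebra_simps)
  have u_add: "u (X + Y) = u X * u Y" if "X \<in> Rad ?e" "Y \<in> Rad ?e" for X Y
  proof -
    note M' = Rad_Mn[OF AnR[OF that(1)]] Rad_Mn[OF AnR[OF that(2)]]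
    have "u X * u Y = k1 * ((One + An X) * (One + An Y)) * minv n k1"
      unfolding u_def using kG M' by (simp add: massoc gsimps mcarr)
    also have "\<dots> = u (X + Y)"
      unfolding u_def An_add[OF that] Rad_unip_mult[OF eM AnR[OF that(1)] AnR[OF that(2)]] ..
    finally show ?thesis by simp
  qed
  \<comment> \<open>Surjectivity with precision: undoing the expansion by \<open>a\<close> gains
    \<open>M\<close>, solving the Sylvester equation loses \<open>?r + kap ?r\<close>.\<close>
  have sur: "\<exists>X\<in>Rad ?e. u X = w \<and> bd (t + M - ?r - kap ?r) X"
    if w: "w \<in> Uk k1 j" and t: "bd t (w - One)" for w t
  proof -
    obtain Y where Y: "Y \<in> Rad ?e" "w = k1 * (One + Y) * minv n k1" using w by (auto simp: Uk_def)
    note YM = Rad_Mn[OF Y(1)]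
    have "Y = minv n k1 * (w - One) * k1"
      unfolding Y(2) using kG YM by (intro ent_eqI) (auto simp: msimps gsimps)
    moreover have "bd (0 + t + 0) (minv n k1 * (w - One) * k1)"
      using k1 kG t GL_Mn[OF Uk_GL[OF kG w]] by (intro bd_mult3) (auto simp: GL_O_bd gsimps mcarr)
    ultimately have bY: "bd t Y" by simp
    define Y1 where "Y1 = minv n a * Y * a"
    have Y1: "Y1 \<in> Rad ?e" unfolding Y1_def by (rule contracting_conj_Rad(2)[OF e a Y(1)])
    have "Y1 = minv n a * (Y * a)" unfolding Y1_def using YM aG by (simp add: massoc gsimps)
    then have bY1: "bd (t + M) Y1" using a Y(1) bY by (simp add: contracting_def)
    note Y1M = Rad_Mn[OF Y1]
    have "bd (t + M + - ?r) (Y1 * z)" by (rule bd_mult[OF Y1M zM bY1 bz])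
    from syl(1)[OF Rad_Par_right[OF eM zP' Y1] this]
    obtain X where X: "X \<in> Rad ?e" "X * z - z * X = Y1 * z" "bd (t + M + - ?r - kap ?r) X" by blast
    note XM = Rad_Mn[OF X(1)]
    have "Lam X = (X * z - z * X) * minv n z"
      unfolding Lam_def using XM zG by (simp add: mring gsimps mcarr)
    also have "\<dots> = Y1" unfolding X(2) using Y1M zG by (simp add: massoc gsimps mring)
    finally have "An X = Y" unfolding An_def Y1_def using YM aG by (simp add: massoc gsimps mcarr mring)
    then have "u X = w" by (simp add: u_def Y(2))
    moreover have "bd (t + M - ?r - kap ?r) X" by (rule bd_mono[OF X(3)]) simp
    ultimately show ?thesis using X(1) by blast
  qed
  have inj: "X = Y" if XY: "X \<in> Rad ?e" "Y \<in> Rad ?e" "u X = u Y" for X Y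
  proof -
    define D where "D = X - Y"
    have D: "D \<in> Rad ?e" unfolding D_def by (rule Rad_diff[OF eM XY(1,2)])
    note M' = Rad_Mn[OF XY(1)] Rad_Mn[OF XY(2)] Rad_Mn[OF D] Rad_Mn[OF AnR[OF XY(1)]] Rad_Mn[OF AnR[OF XY(2)]] Rad_Mn[OF AnR[OF D]]
      Rad_Mn[OF LamR[OF D]]
    have XD: "X = D + Y" unfolding D_def using M' by (intro ent_eqI) (auto simp: msimps)
    have "u D * u Y = One * u Y" using u_add[OF D XY(2)] XY(3) XD uG[OF XY(2)] by (simp add: mring gsimps)
    then have "u D * u Y * minv n (u Y) = One * u Y * minv n (u Y)" by simp
    then have uD: "u D = One" using uG[OF D] uG[OF XY(2)] by (simp add: massoc gsimps mring mcarr)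
    have "One + An D = minv n k1 * u D * k1" unfolding u_def using kG M' by (simp add: massoc gsimps mcarr mring)
    also have "\<dots> = One" unfolding uD using kG by (simp add: mring gsimps)
    finally have "One + An D = One" .
    then have "An D = Zero" using add_cancel_Mn[of One "An D" Zero] M' by (simp add: mcarr mzero)
    moreover have "Lam D = minv n a * An D * a" unfolding An_def using M' aG by (simp add: massoc gsimps mcarr mring)
    ultimately have "Lam D = Zero" using aG by (simp add: mring gsimps)
    moreover have "D * z - z * D = Lam D * z" unfolding Lam_def using M' zG by (simp add: mring gsimps mcarr)
    ultimately have "D * z - z * D = Zero" using zM by (simp add: mring)
    have "D * z = z * D"
    proof (rule ent_eqI)
      fix i l assume il: "i < n" "l < n"
      have "ent i l (D * z - z * D) = ent i l Zero" using \<open>D * z - z * D = Zero\<close> by simp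
      then show "ent i l (D * z) = ent i l (z * D)" using il M' zM by (simp add: ents mcarr)
    qed (use M' zM in \<open>auto simp: mcarr\<close>)
    then have "D = Zero" by (rule syl(2)[OF D])
    then show ?thesis using XD M' by (simp add: mzero)
  qed
  define y where "y = g * x * minv n g"
  have yG: "y \<in> Gn" unfolding y_def using gG x(1) by (intro GL_mult GL_minv)
  define cj where "cj X = minv n k3 * X * k3" for X
  have cjM: "cj X \<in> Mn" if "X \<in> Mn" for X unfolding cj_def using that k3(1) by (simp add: gsimps mcarr)
  have val_u: "conj_val f x (g * (One + cj X)) = f (u X * y)" if X: "X \<in> Rad ?e" for X
  proof -
    note XM = Rad_Mn[OF X] and inv' = Rad_unip_inv[OF eM X]
    have 1: "g * (One + cj X) = k1 * a * (One + X) * k3"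
      unfolding g cj_def using kG aG k3(1) XM by (intro ent_eqI) (simp_all add: msimps gsimps)
    have 2: "minv n (k1 * a * (One + X) * k3) = minv n k3 * (One - X) * minv n a * minv n k1"
      using kG aG k3(1) inv' XM by (simp add: minv_mult GL_mult massoc gsimps mcarr)
    have xz: "x = minv n k3 * z * k3" unfolding z_def using x(1) k3(1) by (simp add: massoc gsimps mcarr mring)
    have X0: "X * (z * (X * minv n z)) = Zero"
    proof -
      have "z * (X * minv n z) \<in> Rad ?e" by (intro Rad_Par_left[OF eM zP'] Rad_Par_right[OF eM ziP] X)
      then show ?thesis by (rule Rad_mult_Zero[OF eM X])
    qed
    have 3: "(One + X) * z * (One - X) = (One + Lam X) * z"
    proof -
      have "(One + X) * z * (One - X) = (One + X) * (One - z * (X * minv n z)) * z"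
        using XM zG by (intro ent_eqI) (simp_all add: msimps gsimps)
      also have "(One + X) * (One - z * (X * minv n z)) = One + Lam X"
        unfolding Lam_def using XM zG X0 by (intro ent_eqI) (simp_all add: msimps gsimps algebra_simps)
      finally show ?thesis .
    qed
    note LM = Rad_Mn[OF LamR[OF X]]
    have "(k1 * a * (One + X) * k3) * x * (minv n k3 * (One - X) * minv n a * minv n k1)
        = k1 * a * ((One + X) * z * (One - X)) * minv n a * minv n k1"
      unfolding xz using kG aG k3(1) XM zG by (simp add: massoc gsimps mcarr)
    also have "\<dots> = u X * (k1 * a * z * minv n a * minv n k1)"
      unfolding 3 u_def An_def using kG aG zG LM
      by (intro ent_eqI) (simp_all add: msimps gsimps)
    also have "k1 * a * z * minv n a * minv n k1 = y"
      unfolding y_def g z_def using kG aG k3(1) x(1) by (simp add: minv_mult GL_mult massoc gsimps mcarr)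
    finally show ?thesis unfolding conj_val_def 1 2 by simp
  qed
  have Lx: "X \<in> L \<longleftrightarrow> (\<exists>X'\<in>Rad ?e. X = cj X' \<and> bd s X)" for X unfolding L cj_def by auto
  define tr where "tr t = (SOME X. X \<in> Rad ?e \<and> t = cj X)" for t
  have tr: "tr t \<in> Rad ?e" "cj (tr t) = t" if "t \<in> L" for t
  proof -
    have "\<exists>X. X \<in> Rad ?e \<and> t = cj X" using that Lx by blast
    from someI_ex[OF this] show "tr t \<in> Rad ?e" "cj (tr t) = t" by (auto simp: tr_def)
  qed
  have TL: "t \<in> L" if "t \<in> T" for t using that T(2) by blast
  have cj_add: "cj (X + Y) = cj X + cj Y" "cj (X - Y) = cj X - cj Y" if "X \<in> Mn" "Y \<in> Mn" for X Y
    unfolding cj_def using that k3(1) by (simp_all add: mring gsimps mcarr)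
  \<comment> \<open>\<open>L0\<close> is the part of the Lie algebra at precision \<open>N\<close>,
    and its image \<open>H0\<close> is an open subgroup of the radical. The sets \<open>Bt t\<close>
    are cosets of it, on each of which \<open>f (w * y)\<close> is constant.\<close>
  define L0 where "L0 = {X \<in> Rad ?e. bd N (cj X)}"
  define H0 where "H0 = u ` L0"
  define Bt where "Bt t = (\<lambda>w. u (tr t) * w) ` H0" for t
  obtain \<nu> where \<nu>: "haar_on val n (Uk k1 j) \<nu>"
    "\<And>b. emeasure \<nu> {w \<in> Uk k1 j. bd b (w - One)} > 0" "\<And>b. emeasure \<nu> {w \<in> Uk k1 j. bd b (w - One)} < \<infinity>"
    using haar_unipotent[OF mu k1 jn] by blast
  have sp\<nu>: "space \<nu> = Uk k1 j" using \<nu>(1) by (simp add: haar_on_def)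
  have open_sets: "A \<in> sets \<nu>" if "openin (subtopology (Mtop val n) (Uk k1 j)) A" for A
    using \<nu>(1) that by (auto simp: haar_on_def borel_sets_def)
  have L0R: "X \<in> Rad ?e" if "X \<in> L0" for X using that by (simp add: L0_def)
  have H0U: "H0 \<subseteq> Uk k1 j" using uU L0R by (auto simp: H0_def)
  have cjbd: "bd (l - 2 * c) (cj X)" if "X \<in> Mn" "bd l X" for X l
  proof -
    have "bd (- c + l + - c) (cj X)" unfolding cj_def using that k3 by (intro bd_mult3) (auto simp: gsimps)
    then show ?thesis by (simp add: algebra_simps)
  qed
  \<comment> \<open>Chosen so that \<open>sur\<close>, followed by the loss \<open>2 * c\<close> in
    \<open>cjbd\<close>, ends exactly at precision \<open>N\<close>.\<close>
  define b1 where "b1 = N + 2 * c - (M - ?r - kap ?r)"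
  have small: "w \<in> H0" if w: "w \<in> Uk k1 j" "bd b1 (w - One)" for w
  proof -
    obtain X where X: "X \<in> Rad ?e" "u X = w" "bd (b1 + M - ?r - kap ?r) X" using sur[OF w] by blast
    have "bd (b1 + M - ?r - kap ?r - 2 * c) (cj X)" by (rule cjbd[OF Rad_Mn[OF X(1)] X(3)])
    then have "bd N (cj X)" by (simp add: b1_def)
    then show ?thesis using X by (auto simp: H0_def L0_def)
  qed
  have L0_add: "X + Y \<in> L0" if "X \<in> L0" "Y \<in> L0" for X Y
  proof -
    have R: "X \<in> Rad ?e" "Y \<in> Rad ?e" "bd N (cj X)" "bd N (cj Y)" using that by (auto simp: L0_def)
    then show ?thesis using cj_add(1)[OF Rad_Mn Rad_Mn, of X ?e Y ?e] Rad_add[OF eM R(1,2)] cjM[OF Rad_Mn[OF R(1)]] cjM[OF Rad_Mn[OF R(2)]]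
      by (simp add: L0_def bd_add)
  qed
  have "openin (subtopology (Mtop val n) (Uk k1 j)) H0"
  proof (rule open_Uk_subgroup[OF kG H0U])
    fix v w assume v: "v \<in> H0" and w: "w \<in> Uk k1 j" "bd b1 (w - One)"
    obtain X where X: "X \<in> L0" "v = u X" using v by (auto simp: H0_def)
    obtain Y where Y: "Y \<in> L0" "w = u Y" using small[OF w] by (auto simp: H0_def)
    have "v * w = u (X + Y)" using u_add[OF L0R[OF X(1)] L0R[OF Y(1)]] X Y by simp
    then show "v * w \<in> H0" using L0_add[OF X(1) Y(1)] by (simp add: H0_def)
  qed
  then have H0s: "H0 \<in> sets \<nu>" by (rule open_sets)
  have H0pos: "emeasure \<nu> H0 > 0"
  proof -
    have "{w \<in> Uk k1 j. bd b1 (w - One)} \<subseteq> H0" using small by blast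
    from emeasure_mono[OF this H0s] show ?thesis using \<nu>(2)[of b1] by (rule less_le_trans[rotated])
  qed
  have H0fin: "emeasure \<nu> H0 < \<infinity>"
  proof -
    obtain ba where ba: "ba \<ge> 0" "bd (- ba) a" using bd_exists by blast
    obtain bi where bi: "bi \<ge> 0" "bd (- bi) (minv n a)" using bd_exists by blast
    obtain bzi where bzi: "bzi \<ge> 0" "bd (- bzi) (minv n z)" using bd_exists by blast
    let ?l = "N - 2 * c"
    let ?q = "?l - ?r - bzi"
    let ?b = "{w \<in> Uk k1 j. bd (- ba + ?q + - bi) (w - One)}"
    have "H0 \<subseteq> ?b"
    proof
      fix w assume "w \<in> H0"
      then obtain X where X: "X \<in> Rad ?e" "bd N (cj X)" "w = u X" by (auto simp: H0_def L0_def)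
      note XM = Rad_Mn[OF X(1)]
      have "X = k3 * cj X * minv n k3" unfolding cj_def using XM k3(1) by (simp add: massoc gsimps mcarr mring)
      moreover have "bd (- c + N + - c) (k3 * cj X * minv n k3)"
        using k3 X(2) cjM[OF XM] by (intro bd_mult3) (auto simp: gsimps)
      ultimately have bX: "bd ?l X" by (simp add: algebra_simps)
      have "bd (- ?r + ?l + - bzi) (z * X * minv n z)" using bz bX bzi zG XM by (intro bd_mult3) (auto simp: gsimps)
      then have "bd ?q (z * X * minv n z)" by (simp add: algebra_simps)
      moreover have "bd ?q X" by (rule bd_mono[OF bX]) (use r0 bzi in simp)
      ultimately have "bd ?q (Lam X)" unfolding Lam_def using XM zG by (intro bd_diff) (auto simp: gsimps mcarr)
      then have "bd (- ba + ?q + - bi) (An X)" unfolding An_def using ba bi aG Rad_Mn[OF LamR[OF X(1)]]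
        by (intro bd_mult3) (auto simp: gsimps)
      then have "bd (0 + (- ba + ?q + - bi) + 0) (k1 * An X * minv n k1)"
        using k1 kG Rad_Mn[OF AnR[OF X(1)]] by (intro bd_mult3) (auto simp: GL_O_bd gsimps)
      moreover have "w - One = k1 * An X * minv n k1"
        unfolding X(3) u_def using kG Rad_Mn[OF AnR[OF X(1)]] by (intro ent_eqI) (auto simp: msimps gsimps)
      ultimately show "w \<in> ?b" using uU[OF X(1)] X(3) by simp
    qed
    moreover have "?b \<in> sets \<nu>" by (rule open_sets[OF open_Uk_ball[OF kG]])
    ultimately have "emeasure \<nu> H0 \<le> emeasure \<nu> ?b" by (rule emeasure_mono)
    then show ?thesis using \<nu>(3) by (rule le_less_trans)
  qed
  have Bt_em: "emeasure \<nu> (Bt t) = emeasure \<nu> H0" if "t \<in> T" for t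
    unfolding Bt_def using \<nu>(1) uU[OF tr(1)[OF TL[OF that]]] H0s by (simp add: haar_on_def)
  have Bt_sets: "Bt t \<in> sets \<nu>" if "t \<in> T" for t
    using Bt_em[OF that] H0pos emeasure_notin_sets[of "Bt t" \<nu>] by force
  have Bt_elem: "w \<in> Bt t \<longleftrightarrow> (\<exists>X\<in>L0. w = u (tr t + X))" if "t \<in> T" for t w
    using u_add[OF tr(1)[OF TL[OF that]] L0R] by (auto simp: Bt_def H0_def)
  have F_on: "f (w * y) = conj_val f x (g * (One + t))" if t: "t \<in> T" and w: "w \<in> Bt t" for t w
  proof -
    obtain X where X: "X \<in> L0" "w = u (tr t + X)" using w Bt_elem[OF t] by blast
    note R = tr[OF TL[OF t]] L0R[OF X(1)]
    have sR: "tr t + X \<in> Rad ?e" by (rule Rad_add[OF eM R(1,3)])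
    have eq: "cj (tr t + X) = t + cj X" using cj_add(1)[OF Rad_Mn[OF R(1)] Rad_Mn[OF R(3)]] R(2) by simp
    have tM: "t \<in> Mn" using cjM[OF Rad_Mn[OF R(1)]] R(2) by simp
    note cM = cjM[OF Rad_Mn[OF R(3)]]
    have bX: "bd N (cj X)" using X(1) by (simp add: L0_def)
    have "bd s t" using TL[OF t] Lx by blast
    then have "bd s (t + cj X)" using bd_mono[OF bX N] tM cM by (intro bd_add)
    then have "t + cj X \<in> L" using Lx sR eq by metis
    moreover have "t + cj X - t = cj X" using tM cM by (intro ent_eqI) (auto simp: msimps)
    ultimately have "conj_val f x (g * (One + (t + cj X))) = conj_val f x (g * (One + t))"
      using inv[OF TL[OF t], of "t + cj X"] bX by simp
    then show ?thesis using val_u[OF sR] eq X(2) by simp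
  qed
  have disj: "t = t'" if t: "t \<in> T" "t' \<in> T" and w: "w \<in> Bt t" "w \<in> Bt t'" for t t' w
  proof -
    obtain X where X: "X \<in> L0" "w = u (tr t + X)" using w(1) Bt_elem[OF t(1)] by blast
    obtain Y where Y: "Y \<in> L0" "w = u (tr t' + Y)" using w(2) Bt_elem[OF t(2)] by blast
    note R = tr[OF TL[OF t(1)]] tr[OF TL[OF t(2)]] L0R[OF X(1)] L0R[OF Y(1)]
    note M' = Rad_Mn[OF R(1)] Rad_Mn[OF R(3)] Rad_Mn[OF R(5)] Rad_Mn[OF R(6)]
    have "tr t + X = tr t' + Y"
      by (rule inj[OF Rad_add[OF eM R(1,5)] Rad_add[OF eM R(3,6)]]) (use X(2) Y(2) in simp)
    then have "cj (tr t + X) = cj (tr t' + Y)" by simp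
    then have eq: "t + cj X = t' + cj Y" using cj_add(1) M' R(2,4) by simp
    have tM: "t \<in> Mn" "t' \<in> Mn" using cjM[OF M'(1)] cjM[OF M'(2)] R(2,4) by simp_all
    note cM = cjM[OF M'(3)] cjM[OF M'(4)]
    have "t - t' = cj Y - cj X"
    proof (rule ent_eqI)
      fix i l assume il: "i < n" "l < n"
      have "ent i l (t + cj X) = ent i l (t' + cj Y)" using eq by simp
      then show "ent i l (t - t') = ent i l (cj Y - cj X)" using il tM cM by (simp add: ents algebra_simps)
    qed (use tM cM in \<open>auto simp: mcarr\<close>)
    moreover have "bd N (cj Y - cj X)" using X(1) Y(1) cM by (intro bd_diff) (auto simp: L0_def)
    ultimately show ?thesis using T(4)[OF t] by simp
  qed
  \<comment> \<open>Here the lower bound on \<open>M\<close> enters. Unipotent elements have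
    determinant 1, so \<open>supp_bound_ratio\<close> bounds \<open>w\<close> relative to
    \<open>w0\<close> by \<open>4 * b\<close>; \<open>sur\<close> and the conjugation by
    \<open>k3\<close> turn this into precision at least \<open>s\<close>.\<close>
  have cover: "\<exists>t\<in>T. w \<in> Bt t" if w: "w \<in> Uk k1 j" and nz: "f (w * y) \<noteq> 0" for w
  proof -
    define w0 where "w0 = u (tr t0)"
    note R0 = tr[OF TL[OF t0(1)]]
    have w0: "w0 \<in> Uk k1 j" "f (w0 * y) \<noteq> 0" using uU[OF R0(1)] val_u[OF R0(1)] R0(2) t0(2) by (simp_all add: w0_def)
    have wG: "w \<in> Gn" "w0 \<in> Gn" using Uk_GL[OF kG] w w0 by blast+
    have det1: "det v = 1" if v: "v \<in> Uk k1 j" for v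
    proof -
      obtain X where X: "X \<in> Rad ?e" "v = k1 * (One + X) * minv n k1" using v by (auto simp: Uk_def)
      have "det (One + X) = 1" using splittingD(6)[OF e Par_One[OF e] X(1)] by simp
      then show ?thesis unfolding X(2) using kG Rad_Mn[OF X(1)]
        by (simp add: det_mult[of _ n] gsimps mcarr det_minv) (simp add: GL_iff)
    qed
    have "det (w * y) = det (w0 * y)" using det1[OF w] det1[OF w0(1)] wG yG by (simp add: det_mult[of _ n] gsimps)
    then have "bd (- (4 * b)) ((w * y) * minv n (w0 * y))"
      using wG yG nz w0(2) by (intro supp_bound_ratio[OF fb]) (auto intro: GL_mult)
    moreover have "(w * y) * minv n (w0 * y) = w * minv n w0" using wG yG by (simp add: minv_mult massoc gsimps mcarr)
    ultimately have bw: "bd (- (4 * b)) (w * minv n w0)" by simp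
    have b0: "b \<ge> 0" using fb by (simp add: supp_bound_def)
    have v: "w * minv n w0 \<in> Uk k1 j" using Uk_mult[OF kG w Uk_minv[OF kG w0(1)]] .
    have "bd (- (4 * b)) (w * minv n w0 - One)"
      using bw wG bd_mono[OF bd_One, of "- (4 * b)"] b0 by (intro bd_diff) (auto simp: gsimps mcarr)
    from sur[OF v this] obtain X where X: "X \<in> Rad ?e" "u X = w * minv n w0" "bd (- (4 * b) + M - ?r - kap ?r) X" by blast
    have "bd (- (4 * b) + M - ?r - kap ?r - 2 * c) (cj X)" by (rule cjbd[OF Rad_Mn[OF X(1)] X(3)])
    then have bX: "bd s (cj X)" by (rule bd_mono) (use M in simp)
    have sR: "X + tr t0 \<in> Rad ?e" by (rule Rad_add[OF eM X(1) R0(1)])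
    have wu: "w = u (X + tr t0)"
      using u_add[OF X(1) R0(1)] X(2) wG by (simp add: w0_def[symmetric] massoc gsimps mring)
    have eq: "cj (X + tr t0) = cj X + t0" using cj_add(1)[OF Rad_Mn[OF X(1)] Rad_Mn[OF R0(1)]] R0(2) by simp
    have t0M: "t0 \<in> Mn" using cjM[OF Rad_Mn[OF R0(1)]] R0(2) by simp
    note cM = cjM[OF Rad_Mn[OF X(1)]]
    have "bd s t0" using TL[OF t0(1)] Lx by blast
    then have "bd s (cj X + t0)" using bX t0M cM by (intro bd_add)
    then have "cj X + t0 \<in> L" using Lx sR eq by metis
    then obtain t where t: "t \<in> T" "bd N (cj X + t0 - t)" using T(3) by blast
    note Rt = tr[OF TL[OF t(1)]]
    define Z where "Z = (X + tr t0) - tr t"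
    have Z: "Z \<in> Rad ?e" unfolding Z_def by (rule Rad_diff[OF eM sR Rt(1)])
    have "cj Z = cj X + t0 - t" unfolding Z_def using cj_add(2)[OF Rad_Mn[OF sR] Rad_Mn[OF Rt(1)]] eq Rt(2) by simp
    then have "Z \<in> L0" using Z t(2) by (simp add: L0_def)
    moreover have "tr t + Z = X + tr t0" unfolding Z_def
      using Rad_Mn[OF sR] Rad_Mn[OF Rt(1)] by (intro ent_eqI) (auto simp: ents mcarr)
    ultimately have "w \<in> Bt t" using wu Bt_elem[OF t(1)] by metis
    then show ?thesis using t(1) by blast
  qed
  let ?\<phi> = "\<lambda>t. conj_val f x (g * (One + t))"
  have expand: "f (w * y) = (\<Sum>t\<in>T. indicator (Bt t) w *\<^sub>R ?\<phi> t)" if w: "w \<in> space \<nu>" for w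
  proof (cases "\<exists>t\<in>T. w \<in> Bt t")
    case True
    then obtain t where t: "t \<in> T" "w \<in> Bt t" by blast
    have "(\<Sum>t\<in>T. indicator (Bt t) w *\<^sub>R ?\<phi> t) = (\<Sum>t'\<in>{t}. indicator (Bt t') w *\<^sub>R ?\<phi> t')"
      using T(1) t disj by (intro sum.mono_neutral_right) (auto simp: indicator_def)
    then show ?thesis using t F_on by simp
  next
    case False
    then show ?thesis using cover[of w] w sp\<nu> by (auto simp: indicator_def)
  qed
  have fin: "emeasure \<nu> (Bt t) < \<infinity>" if "t \<in> T" for t using Bt_em[OF that] H0fin by simp
  have "(LINT w|\<nu>. f (w * y)) = (LINT w|\<nu>. (\<Sum>t\<in>T. indicator (Bt t) w *\<^sub>R ?\<phi> t))"
    using expand by (intro Bochner_Integration.integral_cong) auto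
  also have "\<dots> = (\<Sum>t\<in>T. (LINT w|\<nu>. indicator (Bt t) w *\<^sub>R ?\<phi> t))"
    using Bt_sets fin by (intro Bochner_Integration.integral_sum integrable_scaleR_left) (auto intro: integrable_real_indicator)
  also have "\<dots> = (\<Sum>t\<in>T. measure \<nu> H0 *\<^sub>R ?\<phi> t)"
  proof (rule sum.cong[OF refl])
    fix t assume t: "t \<in> T"
    have i: "integrable \<nu> (indicator (Bt t) :: _ \<Rightarrow> real)" using Bt_sets[OF t] fin[OF t] by (intro integrable_real_indicator)
    have "(LINT w|\<nu>. indicator (Bt t) w *\<^sub>R ?\<phi> t) = (LINT w|\<nu>. indicator (Bt t) w) *\<^sub>R ?\<phi> t"
      using i by (intro integral_scaleR_left) auto
    also have "(LINT w|\<nu>. indicator (Bt t) w) = measure \<nu> (Bt t)"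
      using sets.Int_space_eq2[OF Bt_sets[OF t]] by simp
    also have "\<dots> = measure \<nu> H0" using Bt_em[OF t] by (simp add: measure_def)
    finally show "(LINT w|\<nu>. indicator (Bt t) w *\<^sub>R ?\<phi> t) = measure \<nu> H0 *\<^sub>R ?\<phi> t" .
  qed
  finally have int: "(LINT w|\<nu>. f (w * y)) = measure \<nu> H0 *\<^sub>R (\<Sum>t\<in>T. ?\<phi> t)" by (simp add: scaleR_sum_right)
  have "haar_on val n (unip_radical n [Wk k1 j]) \<nu>" using \<nu>(1) unip_radical_Wk[OF kG j] by simp
  then have "(LINT w|\<nu>. f (w * y)) = 0"
    using cusp proper_flag_Wk[OF kG j] yG unfolding cuspidal_def by blast
  moreover have "measure \<nu> H0 > 0" using H0pos H0fin by (simp add: measure_def enn2real_positive_iff)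
  ultimately show ?thesis using int by simp
qed auto

subsection \<open>Expanded radicals\<close>

text \<open>The radicals to which the cancellation along \<open>g\<close> applies: expanded by \<open>g\<close>, with normaliser
  containing \<open>x\<close>. They are unchanged when \<open>g\<close> is multiplied on the right by a small element.\<close>

definition goodset :: "'a mat \<Rightarrow> int \<Rightarrow> int \<Rightarrow> 'a mat \<Rightarrow> 'a mat set set" where
  "goodset x c M g = {R. \<exists>j k1 a k3. 0 < j \<and> j < n \<and> k1 \<in> GL_O val n \<and> contracting a (Ej j) M \<and>
     k3 \<in> Gn \<and> bd (- c) k3 \<and> bd (- c) (minv n k3) \<and> k3 * x * minv n k3 \<in> Par (Ej j) \<and>
     g = k1 * a * k3 \<and> R = (\<lambda>X. minv n k3 * X * k3) ` Rad (Ej j)}"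

text \<open>An element of the opposite radical that is bounded but not small becomes integral when
  moved across \<open>a\<close>; it can then be absorbed into the compact factor on the
  left.\<close>

lemma contracting_lower:
  assumes e: "splitting e" and a: "contracting a e M" and T: "T \<in> Rad (One - e)" "bd t T" and M: "t + M \<ge> 1"
  shows "a * (One + T) * minv n a \<in> GL_O val n"
proof -
  have aG: "a \<in> Gn" using a by (simp add: contracting_def)
  note TM = Rad_Mn[OF T(1)]
  have "bd (t + M) (a * (T * minv n a))" using a T by (simp add: contracting_def)
  moreover have "a * (One + T) * minv n a - One = a * (T * minv n a)"
    using aG TM by (intro ent_eqI) (auto simp: msimps gsimps)
  ultimately have "bd 1 (a * (One + T) * minv n a - One)" using bd_mono[OF _ M] by simp
  then have "a * (One + T) * minv n a \<in> Ks 1" using aG TM by (simp add: Ks_def gsimps mcarr)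
  then show ?thesis by (intro Ks_GL_O[of 1]) auto
qed

text \<open>Conjugation by \<open>k3\<close> costs \<open>2 * c\<close>, so \<open>\<kappa>\<close>
  becomes an element of \<open>Ks 1\<close> and factors as \<open>(1 + T) p\<close>. The factor
  \<open>1 + T\<close> crosses \<open>a\<close> into \<open>k1\<close>. The factor \<open>p\<close>
  changes \<open>k3\<close> to \<open>p k3\<close>, which keeps the bounds since \<open>p\<close> is
  in \<open>GL_O val n\<close>, and keeps the radical since \<open>p\<close> normalises it.\<close>

lemma goodset_right:
  assumes x: "x \<in> Gn" and c: "c \<ge> 0" and M: "M \<ge> 0" and \<kappa>: "\<kappa> \<in> Ks (2 * c + 1)" and R: "R \<in> goodset x c M g"
  shows "R \<in> goodset x c M (g * \<kappa>)"
proof -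
  obtain j k1 a k3 where j: "0 < j" "j < n" and k1: "k1 \<in> GL_O val n" and a: "contracting a (Ej j) M"
    and k3: "k3 \<in> Gn" "bd (- c) k3" "bd (- c) (minv n k3)" "k3 * x * minv n k3 \<in> Par (Ej j)"
    and g: "g = k1 * a * k3" and RR: "R = (\<lambda>X. minv n k3 * X * k3) ` Rad (Ej j)"
    using R unfolding goodset_def by blast
  have jn: "j \<le> n" using j by simp
  note e = splitting_Ej[OF jn] and eM = Ej_Mn[of j]
  have "\<kappa> \<in> Ks (1 + 2 * c)" using \<kappa> by (simp add: add.commute)
  from Ks_conj[OF k3(1-3) this] have k': "k3 * \<kappa> * minv n k3 \<in> Ks 1" .
  obtain T p where T: "T \<in> Rad (One - Ej j)" "bd 1 T" and p: "p \<in> Par (Ej j)" "p \<in> Ks 1"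
    and kTp: "k3 * \<kappa> * minv n k3 = (One + T) * p"
    using block_LU[OF splittingD(1-3)[OF e] k'] by auto
  have G: "k1 \<in> Gn" "a \<in> Gn" "p \<in> Gn" "\<kappa> \<in> Gn"
    using GL_O_GL[OF k1] a Ks_GL[OF _ p(2)] Ks_GL[OF _ \<kappa>] c by (auto simp: contracting_def)
  have pO: "p \<in> GL_O val n" using Ks_GL_O[OF _ p(2)] by simp
  note TM = Rad_Mn[OF T(1)]
  define l where "l = k1 * (a * (One + T) * minv n a)"
  have l: "l \<in> GL_O val n" unfolding l_def
    by (rule GL_O_mult[OF k1 contracting_lower[OF e a T]]) (use M in simp)
  have "\<kappa> = minv n k3 * (k3 * \<kappa> * minv n k3) * k3" using k3(1) G by (simp add: massoc gsimps mcarr mring)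
  then have keq: "\<kappa> = minv n k3 * ((One + T) * p) * k3" unfolding kTp .
  have "g * \<kappa> = k1 * a * ((One + T) * p) * k3"
    unfolding g using G k3(1) TM by (subst keq) (simp add: massoc gsimps mcarr)
  also have "\<dots> = l * a * (p * k3)" unfolding l_def using G k3(1) TM by (simp add: massoc gsimps mcarr)
  finally have 1: "g * \<kappa> = l * a * (p * k3)" .
  have 2: "p * k3 \<in> Gn" using G k3 by (intro GL_mult)
  have mi: "minv n (p * k3) = minv n k3 * minv n p" using G k3(1) by (simp add: minv_mult)
  have "bd (0 + - c) (p * k3)" using G k3 pO by (intro bd_mult) (auto simp: gsimps GL_O_bd)
  then have 3: "bd (- c) (p * k3)" by simp
  have "bd (- c + 0) (minv n k3 * minv n p)" using G k3 pO by (intro bd_mult) (auto simp: gsimps GL_O_bd)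
  then have 4: "bd (- c) (minv n (p * k3))" by (simp add: mi)
  note piP = Par_minv[OF e p(1) G(3)]
  have "p * k3 * x * minv n (p * k3) = p * (k3 * x * minv n k3) * minv n p"
    unfolding mi using G k3(1) x by (simp add: massoc gsimps mcarr)
  then have 5: "p * k3 * x * minv n (p * k3) \<in> Par (Ej j)"
    using p piP k3(4) eM by (simp add: Par_mult)
  have 6: "R = (\<lambda>X. minv n (p * k3) * X * (p * k3)) ` Rad (Ej j)"
  proof -
    have eq: "minv n (p * k3) * X * (p * k3) = minv n k3 * (minv n p * X * p) * k3" if "X \<in> Mn" for X
      unfolding mi using G k3(1) that by (simp add: massoc gsimps mcarr)
    have A: "minv n p * X * p \<in> Rad (Ej j)" "p * X * minv n p \<in> Rad (Ej j)" if X: "X \<in> Rad (Ej j)" for X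
      using Rad_Par_right[OF eM p(1) Rad_Par_left[OF eM piP X]] Rad_Par_right[OF eM piP Rad_Par_left[OF eM p(1) X]]
      by auto
    show ?thesis unfolding RR
    proof (intro equalityI subsetI)
      fix Y assume "Y \<in> (\<lambda>X. minv n k3 * X * k3) ` Rad (Ej j)"
      then obtain X where X: "X \<in> Rad (Ej j)" "Y = minv n k3 * X * k3" by blast
      have "minv n p * (p * X * minv n p) * p = X" using Rad_Mn[OF X(1)] G by (simp add: massoc gsimps mcarr mring)
      then have "Y = minv n (p * k3) * (p * X * minv n p) * (p * k3)"
        using eq[OF Rad_Mn[OF A(2)[OF X(1)]]] X(2) by simp
      then show "Y \<in> (\<lambda>X. minv n (p * k3) * X * (p * k3)) ` Rad (Ej j)" using A(2)[OF X(1)] by blast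
    next
      fix Y assume "Y \<in> (\<lambda>X. minv n (p * k3) * X * (p * k3)) ` Rad (Ej j)"
      then obtain X where X: "X \<in> Rad (Ej j)" "Y = minv n (p * k3) * X * (p * k3)" by blast
      then show "Y \<in> (\<lambda>X. minv n k3 * X * k3) ` Rad (Ej j)" using eq[OF Rad_Mn[OF X(1)]] A(1)[OF X(1)] by blast
    qed
  qed
  show ?thesis unfolding goodset_def using j l a 1 2 3 4 5 6 by blast
qed

lemma goodset_right_eq:
  assumes x: "x \<in> Gn" and c: "c \<ge> 0" and M: "M \<ge> 0" and \<kappa>: "\<kappa> \<in> Ks (2 * c + 1)" and g: "g \<in> Gn"
  shows "goodset x c M (g * \<kappa>) = goodset x c M g"
proof (intro equalityI subsetI)
  have kG: "\<kappa> \<in> Gn" using Ks_GL[OF _ \<kappa>] c by simp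
  fix R assume "R \<in> goodset x c M (g * \<kappa>)"
  from goodset_right[OF x c M _ this, of "minv n \<kappa>"] have "R \<in> goodset x c M (g * \<kappa> * minv n \<kappa>)"
    using Ks_minv[OF _ \<kappa>] c by simp
  then show "R \<in> goodset x c M g" using g kG by (simp add: massoc gsimps mring)
qed (rule goodset_right[OF x c M \<kappa>])

lemma contracting_smult: "z \<noteq> 0 \<Longrightarrow> contracting a e M \<Longrightarrow> e \<in> Mn \<Longrightarrow> contracting (z \<cdot>\<^sub>m a) e M"
proof -
  assume z: "z \<noteq> 0" and a: "contracting a e M" and e: "e \<in> Mn"
  have aG: "a \<in> Gn" using a by (simp add: contracting_def)
  have "minv n (z \<cdot>\<^sub>m a) * (Y * (z \<cdot>\<^sub>m a)) = minv n a * (Y * a)" "z \<cdot>\<^sub>m a * (Y * minv n (z \<cdot>\<^sub>m a)) = a * (Y * minv n a)"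
    if "Y \<in> Mn" for Y
    using that z aG by (simp_all add: minv_smult mring gsimps mcarr smult_smult one_smult)
  note eq = this
  have fM: "One - e \<in> Mn" using e by (simp add: mcarr)
  have com: "(z \<cdot>\<^sub>m a) * e = e * (z \<cdot>\<^sub>m a)" using a e aG by (simp add: contracting_def mring gsimps)
  show ?thesis unfolding contracting_def
  proof (intro conjI allI impI ballI)
    show "z \<cdot>\<^sub>m a \<in> Gn" by (rule GL_smult[OF z aG])
    show "z \<cdot>\<^sub>m a * e = e * (z \<cdot>\<^sub>m a)" by (rule com)
  qed (use a in \<open>auto simp: eq(1)[OF Rad_Mn[of _ e]] eq(2)[OF Rad_Mn[of _ "One - e"]] contracting_def\<close>)
qed

lemma goodset_smult_sub: "z \<noteq> 0 \<Longrightarrow> R \<in> goodset x c M g \<Longrightarrow> R \<in> goodset x c M (z \<cdot>\<^sub>m g)"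
proof -
  assume z: "z \<noteq> 0" and "R \<in> goodset x c M g"
  then obtain j k1 a k3 where h: "0 < j" "j < n" "k1 \<in> GL_O val n" "contracting a (Ej j) M"
    "k3 \<in> Gn" "bd (- c) k3" "bd (- c) (minv n k3)" "k3 * x * minv n k3 \<in> Par (Ej j)"
    "g = k1 * a * k3" "R = (\<lambda>X. minv n k3 * X * k3) ` Rad (Ej j)" unfolding goodset_def by blast
  have "a \<in> Gn" "k1 \<in> Gn" using h GL_O_GL by (auto simp: contracting_def)
  then have "z \<cdot>\<^sub>m g = k1 * (z \<cdot>\<^sub>m a) * k3" using h by (simp add: mring gsimps mcarr)
  then show ?thesis unfolding goodset_def using h contracting_smult[OF z h(4) Ej_Mn] by blast
qed

text \<open>The cells below live modulo the centre, so their radicals must not depend on a scalar;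
  it is put into \<open>a\<close>.\<close>

lemma goodset_smult: "z \<noteq> 0 \<Longrightarrow> g \<in> Gn \<Longrightarrow> goodset x c M (z \<cdot>\<^sub>m g) = goodset x c M g"
  using goodset_smult_sub[of z _ x c M g] goodset_smult_sub[of "inverse z" _ x c M "z \<cdot>\<^sub>m g"]
  by (auto simp: smult_smult one_smult)

text \<open>A nonzero value bounds \<open>g x g^-1\<close> by \<open>2 * b + \<rho>\<close>. Passing
  back through \<open>a\<close> makes the block of \<open>y\<close> in \<open>Rad (Ej j)\<close>
  smaller by \<open>M\<close>, which reaches the precision required by \<open>newton_stable\<close>.
  The correction \<open>T\<close> is bounded by \<open>kap \<rho> + \<rho>\<close>, and the other
  condition on \<open>M\<close> lets it be absorbed into \<open>k1\<close>.\<close>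

lemma goodset_nonempty:
  assumes fb: "supp_bound f b" and x: "x \<in> Gn" "bd (- \<rho>) x" "\<rho> \<ge> 0" "Delta x \<noteq> 0" "val (Delta x) \<le> \<rho>"
    and M: "M \<ge> kap \<rho> + \<rho> + 1" "M \<ge> 2 * b + \<rho> + (2 * kap \<rho> + \<rho> + 1)"
    and i: "i \<ge> int n * int n * M" and g: "g \<in> Gn" and out: "\<And>c. c \<noteq> 0 \<Longrightarrow> c \<cdot>\<^sub>m g \<notin> G_le val n i"
    and nz: "conj_val f x g \<noteq> 0"
  shows "goodset x (kap \<rho> + \<rho>) M g \<noteq> {}"
proof -
  define c where "c = kap \<rho> + \<rho>"
  have kap0: "kap \<rho> \<ge> 0" using kap_ge[OF x(3)] x(3) by simp
  have c0: "c \<ge> 0" and M0: "M \<ge> 0" using kap0 x(3) M(1) by (simp_all add: c_def)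
  obtain j k1 a k2 where j: "0 < j" "j < n" and k: "k1 \<in> GL_O val n" "k2 \<in> GL_O val n"
    and a: "contracting a (Ej j) M" and gk: "g = k1 * a * k2"
    using cartan_gap[OF g M0 i out] by blast
  have jn: "j \<le> n" using j by simp
  note e = splitting_Ej[OF jn] and e' = splitting_compl_Ej[OF jn] and eM = Ej_Mn[of j]
  have G: "k1 \<in> Gn" "k2 \<in> Gn" "a \<in> Gn" using k GL_O_GL a by (auto simp: contracting_def)
  define y where "y = k2 * x * minv n k2"
  have yM: "y \<in> Mn" unfolding y_def using G x by (simp add: gsimps mcarr)
  have by': "bd (- \<rho>) y"
  proof -
    have "bd (0 + - \<rho> + 0) y" unfolding y_def using G x k by (intro bd_mult3) (auto simp: gsimps GL_O_bd)
    then show ?thesis by simp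
  qed
  have Dy: "Delta y \<noteq> 0" "val (Delta y) \<le> \<rho>" using Delta_conj[OF GL_Mn[OF x(1)] G(2)] x by (simp_all add: y_def)
  define p where "p = g * x * minv n g"
  have pG: "p \<in> Gn" unfolding p_def using g x by (intro GL_mult GL_minv)
  have "f p \<noteq> 0" using nz by (simp add: conj_val_def p_def)
  then obtain d where d: "d \<noteq> 0" "bd (- b) (d \<cdot>\<^sub>m p)" "bd (- b) (minv n (d \<cdot>\<^sub>m p))"
    using fb pG by (auto simp: supp_bound_def)
  have dp: "det p = det x" unfolding p_def using g x
    by (simp add: det_mult[of _ n] gsimps mcarr det_minv) (simp add: GL_iff)
  \<comment> \<open>Conjugation preserves the determinant; with \<open>scaled_det_bound\<close> this
    limits the scalar \<open>d\<close>, so that \<open>p\<close> itself is bounded and not only its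
    multiple.\<close>
  have "vge (- (int n * \<rho>)) (det x)" using x by (intro bd_det) (auto simp: gsimps)
  then have "val (det x) \<ge> - (int n * \<rho>)" using x by (auto simp: vge_def GL_iff)
  then have "int n * val d \<le> int n * (b + \<rho>)"
    using scaled_det_bound(2)[OF pG d] dp by (simp add: algebra_simps)
  then have vd: "val d \<le> b + \<rho>" using mult_le_cancel_left_pos[of "int n" "val d" "b + \<rho>"] n_pos by simp
  have bp: "bd (- (2 * b + \<rho>)) p"
  proof -
    have "vge (- (b + \<rho>)) (inverse d)" using d(1) vd by (simp add: vge_def val_inverse)
    then have "bd (- (b + \<rho>) + - b) (inverse d \<cdot>\<^sub>m (d \<cdot>\<^sub>m p))" using d pG by (intro bd_smult) (auto simp: gsimps mcarr)
    moreover have "inverse d \<cdot>\<^sub>m (d \<cdot>\<^sub>m p) = p" using d(1) by (simp add: smult_smult one_smult)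
    ultimately show ?thesis by (simp add: algebra_simps)
  qed
  define w where "w = minv n k1 * p * k1"
  have wM: "w \<in> Mn" unfolding w_def using G pG by (simp add: gsimps mcarr)
  have bw: "bd (- (2 * b + \<rho>)) w"
  proof -
    have "bd (0 + - (2 * b + \<rho>) + 0) w" unfolding w_def using G pG k bp by (intro bd_mult3) (auto simp: gsimps GL_O_bd)
    then show ?thesis by simp
  qed
  have wy: "w = a * y * minv n a"
    unfolding w_def p_def gk y_def using G x by (simp add: minv_mult GL_mult massoc gsimps mcarr mring)
  have com: "a * Ej j = Ej j * a" using a by (simp add: contracting_def)
  have comX: "a * (Ej j * X) = Ej j * (a * X)" if "X \<in> Mn" for X
    using com that G(3) eM massoc[of a "Ej j" X] massoc[of "Ej j" a X] by (simp add: gsimps)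
  have comi: "minv n a * Ej j = Ej j * minv n a"
  proof -
    have "minv n a * (a * Ej j) * minv n a = minv n a * (Ej j * a) * minv n a" using com by simp
    then show ?thesis using G(3) eM by (simp add: massoc gsimps mcarr mring)
  qed
  have comiX: "minv n a * (Ej j * X) = Ej j * (minv n a * X)" if "X \<in> Mn" for X
    using comi that G(3) eM massoc[of "minv n a" "Ej j" X] massoc[of "Ej j" "minv n a" X] by (simp add: gsimps)
  define u where "u = Ej j * w * (One - Ej j)"
  note idem = splittingD(2)[OF e] splittingD(4)[OF e]
  have uR: "u \<in> Rad (Ej j)" unfolding Rad_def u_def using eM wM idem by (auto simp: mring mcarr mzero)
  have "bd (0 + - (2 * b + \<rho>) + 0) u" unfolding u_def
    using splittingD(3)[OF e] splittingD(3)[OF e'] eM wM bw by (intro bd_mult3) (auto simp: mcarr)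
  then have "bd (- (2 * b + \<rho>)) u" by simp
  then have "bd (- (2 * b + \<rho>) + M) (minv n a * (u * a))" using a uR by (simp add: contracting_def)
  moreover have "minv n a * (u * a) = Ej j * y * (One - Ej j)"
    unfolding u_def wy using G(3) yM eM by (simp add: mring gsimps mcarr comX comiX com comi)
  ultimately have bs: "bd (- (2 * b + \<rho>) + M) (Ej j * y * (One - Ej j))" by simp
  have sM: "- (2 * b + \<rho>) + M \<ge> 2 * kap \<rho> + \<rho> + 1" using M(2) by simp
  obtain T where T: "T \<in> Rad (One - Ej j)" "bd (- c) T" "(One + T) * y * (One - T) \<in> Par (Ej j)"
    using newton_stable[OF e e' yM by' x(3) Dy bs sM] unfolding c_def by blast
  note TM = Rad_Mn[OF T(1)]
  have fM: "One - Ej j \<in> Mn" using eM by (simp add: mcarr)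
  note Ti = Rad_unip_inv[OF fM T(1)]
  have "- T \<in> Rad (One - Ej j)" by (rule Rad_uminus[OF fM T(1)])
  moreover have "bd (- c) (- T)" by (rule bd_uminus[OF TM T(2)])
  ultimately have lO: "a * (One + - T) * minv n a \<in> GL_O val n"
    by (rule contracting_lower[OF e a]) (use M(1) in \<open>simp add: c_def\<close>)
  have neg: "One + - T = One - T" using TM by (intro ent_eqI) (auto simp: msimps)
  define k3 where "k3 = (One + T) * k2"
  have k3: "k3 \<in> Gn" "minv n k3 = minv n k2 * (One - T)"
    unfolding k3_def using Ti G by (simp_all add: GL_mult minv_mult)
  have b1: "bd (- c) (One + T)" "bd (- c) (One - T)"
    using T(2) TM bd_mono[OF bd_One, of "- c"] c0 by (auto intro!: bd_add bd_diff mcarr)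
  have "bd (- c + 0) k3" unfolding k3_def using b1 G k TM by (intro bd_mult) (auto simp: gsimps GL_O_bd mcarr)
  moreover have "bd (0 + - c) (minv n k3)" unfolding k3(2) using b1 G k TM by (intro bd_mult) (auto simp: gsimps GL_O_bd mcarr)
  moreover have "k3 * x * minv n k3 = (One + T) * y * (One - T)"
    unfolding k3(2) unfolding k3_def y_def using G x TM by (simp add: massoc gsimps mcarr)
  moreover have "g = (k1 * (a * (One - T) * minv n a)) * a * k3"
  proof -
    have "(One - T) * ((One + T) * k2) = k2"
      using minv_cancel(4)[OF Ti(1), of k2] G unfolding Ti(2) by (simp add: gsimps)
    then show ?thesis unfolding k3_def gk using G TM by (simp add: massoc gsimps mcarr)
  qed
  moreover have "k1 * (a * (One - T) * minv n a) \<in> GL_O val n" using lO k neg by (simp add: GL_O_mult)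
  ultimately have "(\<lambda>X. minv n k3 * X * k3) ` Rad (Ej j) \<in> goodset x c M g"
    unfolding goodset_def using j a k3(1) T(3)
    by (intro CollectI exI[of _ j] exI[of _ "k1 * (a * (One - T) * minv n a)"] exI[of _ a] exI[of _ k3]) simp
  then show ?thesis by (auto simp: c_def)
qed

subsection \<open>Averages as finite sums\<close>

lemma transversal:
  assumes L: "\<And>X. X \<in> L \<Longrightarrow> X \<in> Mn \<and> bd s X"
  obtains T where "finite T" "T \<subseteq> L" "\<And>X. X \<in> L \<Longrightarrow> \<exists>t\<in>T. bd N (X - t)"
    "\<And>t t'. t \<in> T \<Longrightarrow> t' \<in> T \<Longrightarrow> bd N (t - t') \<Longrightarrow> t = t'"
proof -
  have sym: "bd N (Y - X)" if "bd N (X - Y)" "X \<in> Mn" "Y \<in> Mn" for X Y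
  proof -
    have "Y - X = - (X - Y)" using that by (intro ent_eqI) (auto simp: msimps)
    then show ?thesis using that by (simp add: bd_uminus mcarr)
  qed
  have tran: "bd N (X - Z)" if "bd N (X - Y)" "bd N (Y - Z)" "X \<in> Mn" "Y \<in> Mn" "Z \<in> Mn" for X Y Z
  proof -
    have "X - Z = (X - Y) + (Y - Z)" using that by (intro ent_eqI) (auto simp: msimps)
    then show ?thesis using that by (simp add: bd_add mcarr)
  qed
  \<comment> \<open>The choice depends on the class of \<open>X\<close> only: congruent elements
    satisfy the same predicate, by \<open>sym\<close> and \<open>tran\<close>.\<close>
  define h where "h X = (SOME Y. Y \<in> L \<and> bd N (X - Y))" for X
  have h: "h X \<in> L \<and> bd N (X - h X)" if "X \<in> L" for X
  proof -
    have "X \<in> L \<and> bd N (X - X)" using that L by (simp add: mzero bd_Zero)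
    then show ?thesis unfolding h_def by (rule someI)
  qed
  have hc: "h X = h Y" if "X \<in> L" "Y \<in> L" "bd N (X - Y)" for X Y
  proof -
    have "(\<lambda>Z. Z \<in> L \<and> bd N (X - Z)) = (\<lambda>Z. Z \<in> L \<and> bd N (Y - Z))"
      using that L sym tran by (intro ext) meson
    then show ?thesis by (simp add: h_def)
  qed
  obtain S where S: "finite S" "\<And>A. A \<in> S \<Longrightarrow> A \<in> Mn"
    "\<And>A. A \<in> Mn \<Longrightarrow> bd s A \<Longrightarrow> \<exists>r\<in>S. bd (s + int (nat (N - s))) (A - r)"
    using bd_finite_reps[of s "nat (N - s)"] by metis
  have SN: "\<exists>r\<in>S. bd N (X - r)" if X: "X \<in> L" for X
  proof -
    have "X \<in> Mn" "bd s X" using L[OF X] by auto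
    from S(3)[OF this] obtain r where r: "r \<in> S" "bd (s + int (nat (N - s))) (X - r)" by blast
    have "bd N (X - r)" by (rule bd_mono[OF r(2)]) simp
    then show ?thesis using r(1) by blast
  qed
  define q where "q r = h (SOME X. X \<in> L \<and> bd N (X - r))" for r
  have "h ` L \<subseteq> q ` S"
  proof
    fix Y assume "Y \<in> h ` L"
    then obtain X where X: "X \<in> L" "Y = h X" by blast
    obtain r where r: "r \<in> S" "bd N (X - r)" using SN[OF X(1)] by blast
    define Z where "Z = (SOME X. X \<in> L \<and> bd N (X - r))"
    have Z: "Z \<in> L \<and> bd N (Z - r)" unfolding Z_def by (rule someI[of _ X]) (use X r in simp)
    have "bd N (r - Z)" by (rule sym) (use Z S(2)[OF r(1)] L in auto)
    then have "bd N (X - Z)" by (rule tran[OF r(2)]) (use Z S(2)[OF r(1)] L X in auto)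
    then have "Y = q r" using hc[of X Z] X Z by (simp add: q_def Z_def)
    then show "Y \<in> q ` S" using r by blast
  qed
  then have fin: "finite (h ` L)" using S(1) finite_surj by blast
  show ?thesis
  proof
    show "finite (h ` L)" by (rule fin)
    show "h ` L \<subseteq> L" using h by blast
    show "\<exists>t\<in>h ` L. bd N (X - t)" if "X \<in> L" for X using h[OF that] that by blast
    show "t = t'" if tt: "t \<in> h ` L" "t' \<in> h ` L" "bd N (t - t')" for t t'
    proof -
      obtain X Y where XY: "X \<in> L" "t = h X" "Y \<in> L" "t' = h Y" using tt(1,2) by blast
      have M: "X \<in> Mn" "t \<in> Mn" "t' \<in> Mn" "Y \<in> Mn" using XY h L by auto
      have "bd N (X - t)" "bd N (t' - Y)" using h[OF XY(1)] h[OF XY(3)] XY sym M by auto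
      then have "bd N (X - Y)" using tran tt(3) M by meson
      then show ?thesis using hc XY by simp
    qed
  qed
qed

lemma G_le_right: "g \<in> G_le val n i \<Longrightarrow> k \<in> GL_O val n \<Longrightarrow> g * k \<in> G_le val n i"
proof -
  assume g: "g \<in> G_le val n i" and k: "k \<in> GL_O val n"
  have G: "g \<in> Gn" "bd (- i) g" "val (det g) \<le> i" "k \<in> Gn" using g k GL_O_GL by (auto simp: G_le_iff)
  have "val (det k) = 0" "det k \<noteq> 0" "det g \<noteq> 0" using k G by (auto simp: GL_O_def GL_iff)
  then have "val (det (g * k)) \<le> i" using G by (simp add: det_mult[of _ n] gsimps val_mult)
  moreover have "bd (- i + 0) (g * k)" using G k by (intro bd_mult) (auto simp: gsimps GL_O_bd)
  ultimately show ?thesis using G by (simp add: G_le_iff GL_mult)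
qed

lemma G_le_finite_cosets:
  assumes i: "i \<ge> 0" and s: "s \<ge> 1"
  shows "\<exists>S. finite S \<and> S \<subseteq> G_le val n i \<and> (\<forall>y\<in>G_le val n i. \<exists>g\<in>S. minv n g * y \<in> Ks s)"
proof (rule GL_O_finite_cosets[where c = "int n * i + i", OF s])
  fix g assume "g \<in> G_le val n i"
  then have g: "g \<in> Gn" "bd (- i) g" "val (det g) \<le> i" by (auto simp: G_le_iff)
  have "bd (- (int n * i + i)) g" by (rule bd_mono[OF g(2)]) (use i in simp)
  then show "g \<in> Gn \<and> bd (- (int n * i + i)) g \<and> bd (- (int n * i + i)) (minv n g)"
    using g bd_minv[OF g(1) i g(2,3)] by simp
qed

lemma conj_val_locally_constant:
  assumes f: "smooth_fun val n f" and x: "x \<in> Gn" and g: "g \<in> Gn"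
  shows "\<exists>k. \<forall>y\<in>Gn. bd k (y - g) \<longrightarrow> conj_val f x y = conj_val f x g"
proof -
  define p where "p = g * x * minv n g"
  have pG: "p \<in> Gn" unfolding p_def using g x by (intro GL_mult GL_minv)
  obtain l where l: "\<And>y. y \<in> Gn \<Longrightarrow> bd l (y - p) \<Longrightarrow> f y = f p"
    using f pG mbox_eq[OF GL_Mn[OF pG]] GL_Mn unfolding smooth_fun_def by blast
  obtain b where b: "b \<ge> 0" "bd (- b) g" using bd_exists by blast
  obtain c where c: "c \<ge> 0" "bd (- c) (minv n g)" using bd_exists by blast
  obtain d where d: "d \<ge> 0" "bd (- d) x" using bd_exists by blast
  define s where "s = max 1 (l + b + c + d)"
  have s: "s \<ge> 1" "l \<le> - b + (s - d) + - c" by (auto simp: s_def)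
  have "conj_val f x y = conj_val f x g" if y: "y \<in> Gn" "bd (s + c) (y - g)" for y
  proof -
    define \<kappa> where "\<kappa> = minv n g * y"
    have \<kappa>: "\<kappa> \<in> Ks s" unfolding \<kappa>_def using y g c by (intro Ks_left_diff) (auto simp: gsimps)
    note kO = Ks_GL_O[OF s(1) \<kappa>] and kG = Ks_GL[OF s(1) \<kappa>]
    have y': "y = g * \<kappa>" unfolding \<kappa>_def using g y by (simp add: gsimps)
    define D where "D = ((\<kappa> - One) * x - x * (\<kappa> - One)) * minv n \<kappa>"
    have kd: "bd s (\<kappa> - One)" using \<kappa> by (simp add: Ks_def)
    have "bd (s + - d) ((\<kappa> - One) * x)" "bd (- d + s) (x * (\<kappa> - One))"
      using kd d x kG by (auto intro!: bd_mult simp: gsimps mcarr simp del: add_uminus_conv_diff uminus_add_conv_diff)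
    then have "bd (s - d) ((\<kappa> - One) * x - x * (\<kappa> - One))"
      using x kG by (intro bd_diff) (auto simp: gsimps mcarr algebra_simps)
    then have "bd (s - d + 0) D" unfolding D_def using x kG kO by (intro bd_mult) (auto simp: gsimps mcarr GL_O_bd)
    then have "bd (- b + (s - d) + - c) (g * D * minv n g)"
      using b c g x kG by (intro bd_mult3) (auto simp: D_def gsimps mcarr)
    then have "bd l (g * D * minv n g)" by (rule bd_mono[OF _ s(2)])
    moreover have "y * x * minv n y - p = g * D * minv n g"
      unfolding y' p_def D_def using g x kG by (intro ent_eqI) (simp_all add: minv_mult msimps gsimps)
    ultimately show ?thesis unfolding conj_val_def using l[of "y * x * minv n y"] y x
      by (simp add: p_def GL_mult GL_minv)
  qed
  then show ?thesis by blast
qed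

text \<open>Compactness is applied to a ball in the space of all matrices, so limit points with
  determinant 0 have to be treated too. The resulting \<open>N\<close> depends on \<open>x\<close>
  and \<open>i\<close>.\<close>

lemma conj_val_uniform:
  assumes f: "smooth_fun val n f" and x: "x \<in> Gn" and i: "i \<ge> 0"
  shows "\<exists>N. \<forall>g\<in>G_le val n i. \<forall>k\<in>Ks N. k \<in> GL_O val n \<longrightarrow> conj_val f x (g * k) = conj_val f x g"
proof -
  let ?P = "\<lambda>A. \<exists>N. \<forall>g\<in>A \<inter> G_le val n i. \<forall>h\<in>G_le val n i. bd N (h - g) \<longrightarrow> conj_val f x h = conj_val f x g"
  have "?P {y \<in> Mn. bd (- i) y}"
  proof (rule bd_heine_borel)
    fix A B assume "?P A" "?P B"
    then obtain N N' where N: "\<forall>g\<in>A \<inter> G_le val n i. \<forall>h\<in>G_le val n i. bd N (h - g) \<longrightarrow> conj_val f x h = conj_val f x g"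
      "\<forall>g\<in>B \<inter> G_le val n i. \<forall>h\<in>G_le val n i. bd N' (h - g) \<longrightarrow> conj_val f x h = conj_val f x g" by blast
    show "?P (A \<union> B)"
    proof (intro exI[of _ "max N N'"] ballI impI)
      fix g h assume gh: "g \<in> (A \<union> B) \<inter> G_le val n i" "h \<in> G_le val n i" "bd (max N N') (h - g)"
      have "bd N (h - g)" "bd N' (h - g)" by (rule bd_mono[OF gh(3)]; simp)+
      then show "conj_val f x h = conj_val f x g" using N gh by blast
    qed
  next
    fix A B assume "?P B" "A \<subseteq> B"
    then show "?P A" by blast
  next
    fix y assume y: "y \<in> Mn"
    show "\<exists>k. ?P {w \<in> Mn. bd k (w - y)}"
    proof (cases "det y = 0")
      case False
      then have yG: "y \<in> Gn" using y by (simp add: GL_iff)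
      obtain k where k: "\<forall>w\<in>Gn. bd k (w - y) \<longrightarrow> conj_val f x w = conj_val f x y"
        using conj_val_locally_constant[OF f x yG] by blast
      show ?thesis
      proof (intro exI[of _ k] ballI impI)
        fix g h assume gh: "g \<in> {w \<in> Mn. bd k (w - y)} \<inter> G_le val n i" "h \<in> G_le val n i" "bd k (h - g)"
        have G: "g \<in> Gn" "h \<in> Gn" using gh by (auto simp: G_le_iff)
        have "bd k ((h - g) + (g - y))" by (rule bd_add) (use gh G y in \<open>auto simp: gsimps mcarr\<close>)
        moreover have "(h - g) + (g - y) = h - y" using G y by (intro ent_eqI) (auto simp: msimps gsimps)
        ultimately have "conj_val f x h = conj_val f x y" using k G by simp
        moreover have "conj_val f x g = conj_val f x y" using k G gh by simp
        ultimately show "conj_val f x h = conj_val f x g" by simp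
      qed
    next
      case True
      obtain b where b: "b \<ge> 0" "bd (- b) y" using bd_exists by blast
      define c where "c = max b i"
      \<comment> \<open>Near a singular \<open>y\<close> this precision forces a determinant to be 0
        or to have valuation above \<open>i\<close>. The neighbourhood thus misses
        \<open>G_le val n i\<close> and the claim holds vacuously.\<close>
      define k where "k = i + 1 + int n * c"
      have False if w: "w \<in> {w \<in> Mn. bd k (w - y)} \<inter> G_le val n i" for w
      proof -
        have w': "w \<in> Mn" "bd k (w - y)" "bd (- i) w" "val (det w) \<le> i" "det w \<noteq> 0" using w by (auto simp: G_le_iff GL_iff)
        have "bd (- c) w" "bd (- c) y" using bd_mono[OF w'(3), of "- c"] bd_mono[OF b(2), of "- c"] by (auto simp: c_def)
        moreover have "c \<ge> 0" using b by (simp add: c_def)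
        ultimately have "vge (k - int n * c) (det w - det y)" using w' y by (intro bd_det_diff) auto
        then show False using True w' by (simp add: k_def vge_def)
      qed
      then show ?thesis by blast
    qed
  qed
  then obtain N where N: "\<And>g h. g \<in> Mn \<Longrightarrow> bd (- i) g \<Longrightarrow> g \<in> G_le val n i \<Longrightarrow> h \<in> G_le val n i \<Longrightarrow>
      bd N (h - g) \<Longrightarrow> conj_val f x h = conj_val f x g" by blast
  show ?thesis
  proof (intro exI[of _ "N + i"] ballI impI)
    fix g k assume g: "g \<in> G_le val n i" and k: "k \<in> Ks (N + i)" "k \<in> GL_O val n"
    have G: "g \<in> Gn" "bd (- i) g" "k \<in> Gn" using g k GL_O_GL by (auto simp: G_le_iff)
    have "bd (- i + (N + i)) (g * (k - One))" using G k by (intro bd_mult) (auto simp: gsimps mcarr Ks_def)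
    moreover have "g * (k - One) = g * k - g" using G by (simp add: mring gsimps mcarr)
    ultimately have "bd N (g * k - g)" by simp
    then show "conj_val f x (g * k) = conj_val f x g"
      by (rule N[OF GL_Mn[OF G(1)] G(2) g G_le_right[OF g k(2)]])
  qed
qed

section \<open>Cells of the adjoint group and their measure\<close>

lemma zcoset_eqI: "z \<noteq> 0 \<Longrightarrow> zcoset (z \<cdot>\<^sub>m g) = zcoset (g :: 'a mat)"
proof -
  assume z: "z \<noteq> 0"
  have "\<exists>d. w \<cdot>\<^sub>m g = d \<cdot>\<^sub>m (z \<cdot>\<^sub>m g) \<and> d \<noteq> 0" if "w \<noteq> 0" for w
    by (rule exI[of _ "w * inverse z"]) (use that z in \<open>simp add: smult_smult mult.assoc\<close>)
  then show ?thesis using z by (auto simp: zcoset_def smult_smult)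
qed

lemma zcoset_self: "(g :: 'a mat) \<in> zcoset g"
  by (auto simp: zcoset_def intro!: exI[of _ 1] simp: one_smult)

lemma zcoset_memD: "h \<in> zcoset g \<Longrightarrow> \<exists>z. z \<noteq> 0 \<and> h = z \<cdot>\<^sub>m (g :: 'a mat)"
  by (auto simp: zcoset_def)

lemma rep_zcoset: "\<exists>z. z \<noteq> 0 \<and> rep (zcoset g) = z \<cdot>\<^sub>m (g :: 'a mat)"
  unfolding rep_def by (rule zcoset_memD) (rule someI[of "\<lambda>h. h \<in> zcoset g", OF zcoset_self])

lemma conj_val_smult: "z \<noteq> 0 \<Longrightarrow> x \<in> Gn \<Longrightarrow> g \<in> Gn \<Longrightarrow> conj_val f x (z \<cdot>\<^sub>m g) = conj_val f x g"
  by (simp add: conj_val_def minv_smult mring gsimps mcarr smult_smult one_smult)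

definition cl :: "int \<Rightarrow> 'a mat \<Rightarrow> 'a mat set set" where
  "cl N g = zcoset ` lcos g N"

lemma cl_eqD: "N \<ge> 1 \<Longrightarrow> g \<in> Gn \<Longrightarrow> c \<in> cl N g \<Longrightarrow> h \<in> c \<Longrightarrow> \<exists>z k. z \<noteq> 0 \<and> k \<in> Ks N \<and> h = z \<cdot>\<^sub>m (g * k)"
  by (auto simp: cl_def lcos_def dest!: zcoset_memD)

lemma cl_absorb:
  assumes N: "N \<ge> 1" and g: "g \<in> Gn" and z: "z \<noteq> 0" and k: "k \<in> Ks N"
  shows "cl N (z \<cdot>\<^sub>m (g * k)) = cl N g"
proof -
  have kG: "k \<in> Gn" by (rule Ks_GL[OF N k])
  have *: "z \<cdot>\<^sub>m (g * k) * l = z \<cdot>\<^sub>m (g * (k * l))" if "l \<in> Ks N" for l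
    using g kG Ks_GL[OF N that] by (simp add: mring gsimps mcarr)
  show ?thesis
  proof (intro equalityI subsetI)
    fix c assume "c \<in> cl N (z \<cdot>\<^sub>m (g * k))"
    then obtain l where l: "l \<in> Ks N" "c = zcoset (z \<cdot>\<^sub>m (g * k) * l)" by (auto simp: cl_def lcos_def)
    then have "c = zcoset (g * (k * l))" using * z zcoset_eqI by simp
    moreover have "k * l \<in> Ks N" using Ks_mult[OF _ k l(1)] N by simp
    ultimately show "c \<in> cl N g" by (auto simp: cl_def lcos_def)
  next
    fix c assume "c \<in> cl N g"
    then obtain l where l: "l \<in> Ks N" "c = zcoset (g * l)" by (auto simp: cl_def lcos_def)
    have lk: "minv n k * l \<in> Ks N" using Ks_mult[OF _ Ks_minv[OF N k] l(1)] N by simp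
    have "k * (minv n k * l) = l" using kG Ks_GL[OF N l(1)] by (simp add: gsimps)
    then have "z \<cdot>\<^sub>m (g * k) * (minv n k * l) = z \<cdot>\<^sub>m (g * l)" using *[OF lk] by simp
    then have "c = zcoset (z \<cdot>\<^sub>m (g * k) * (minv n k * l))" using l z zcoset_eqI by simp
    then show "c \<in> cl N (z \<cdot>\<^sub>m (g * k))" using lk by (auto simp: cl_def lcos_def)
  qed
qed

lemma cl_self: "g \<in> Gn \<Longrightarrow> zcoset g \<in> cl N g"
proof -
  assume "g \<in> Gn"
  then have "g * One = g" by (simp add: gsimps mring)
  then have "g \<in> lcos g N" unfolding lcos_def using imageI[OF Ks_One[of N], of "\<lambda>k. g * k"] by simp
  then show ?thesis unfolding cl_def by blast
qed

lemma cl_eq: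
  assumes N: "N \<ge> 1" and g: "g \<in> Gn" "h \<in> Gn" and c: "c \<in> cl N g" "c \<in> cl N h"
  shows "cl N g = cl N h" "\<exists>z k. z \<noteq> 0 \<and> k \<in> Ks N \<and> h = z \<cdot>\<^sub>m (g * k)"
proof -
  obtain k where k: "k \<in> Ks N" "c = zcoset (g * k)" using c(1) by (auto simp: cl_def lcos_def)
  obtain l where l: "l \<in> Ks N" "c = zcoset (h * l)" using c(2) by (auto simp: cl_def lcos_def)
  have "h * l \<in> zcoset (g * k)" using k l zcoset_self by metis
  then obtain z where z: "z \<noteq> 0" "h * l = z \<cdot>\<^sub>m (g * k)" using zcoset_memD by blast
  have "h = h * l * minv n l" using g Ks_GL[OF N l(1)] by (simp add: massoc gsimps mring)
  also have "\<dots> = z \<cdot>\<^sub>m (g * (k * minv n l))" unfolding z(2)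
    using g Ks_GL[OF N l(1)] Ks_GL[OF N k(1)] by (simp add: mring gsimps mcarr)
  finally have h: "h = z \<cdot>\<^sub>m (g * (k * minv n l))" .
  have kl: "k * minv n l \<in> Ks N" using Ks_mult[OF _ k(1) Ks_minv[OF N l(1)]] N by simp
  show "\<exists>z k. z \<noteq> 0 \<and> k \<in> Ks N \<and> h = z \<cdot>\<^sub>m (g * k)" using z(1) kl h by blast
  show "cl N g = cl N h" unfolding h by (rule cl_absorb[OF N g(1) z(1) kl, symmetric])
qed

text \<open>The quotient formula is tested on the translate by \<open>g\<close> of
  \<open>A0\<close>, the product of the unit scalars with \<open>Ks N\<close>. Over a point of the
  cell the scalars that lead into this set form one translate of the units, of mass 1; over other
  points there are none. Hence every cell has the measure of \<open>A0\<close>.\<close>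

lemma cl_measure:
  assumes mu: "haar_G val n \<mu>G" and muZ: "haar_Fx val \<mu>Z" and q: "quotient_haar val n \<mu>G \<mu>Z \<mu>ad" and N: "N \<ge> 1"
  shows "\<exists>v. v < \<infinity> \<and> (\<forall>g\<in>Gn. cl N g \<in> sets \<mu>ad \<and> emeasure \<mu>ad (cl N g) = v)"
proof -
  define A0 where "A0 = (\<Union>z\<in>{z. z \<noteq> 0 \<and> val z = 0}. {(z \<cdot>\<^sub>m One) * k * One | k. k \<in> Ks N})"
  have A0_iff: "y \<in> A0 \<longleftrightarrow> (\<exists>z k. z \<noteq> 0 \<and> val z = 0 \<and> k \<in> Ks N \<and> y = z \<cdot>\<^sub>m k)" for y
  proof -
    have "z \<cdot>\<^sub>m One * k * One = z \<cdot>\<^sub>m k" if "k \<in> Ks N" for z k using Ks_Mn[OF that] by (simp add: mring mcarr)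
    then show ?thesis unfolding A0_def by auto metis+
  qed
  have zOne: "z \<cdot>\<^sub>m One \<in> Gn" if "z \<noteq> 0" for z using that GL_smult GL_One by blast
  have A0G: "A0 \<subseteq> Gn" using A0_iff Ks_GL[OF N] GL_smult by auto
  have "openin (Mtop val n) A0" unfolding A0_def
    by (rule openin_Union) (use open_coset[OF zOne GL_One N] in auto)
  then have A0s: "A0 \<in> sets \<mu>G" by (rule haar_G_open[OF mu _ A0G])
  have A0fin: "emeasure \<mu>G A0 < \<infinity>"
  proof (rule haar_G_finite[OF mu])
    fix y assume "y \<in> A0"
    then obtain z k where zk: "z \<noteq> 0" "val z = 0" "k \<in> Ks N" "y = z \<cdot>\<^sub>m k" using A0_iff by blast
    note kO = Ks_GL_O[OF N zk(3)]
    have "bd (0 + 0) (z \<cdot>\<^sub>m k)" using zk kO by (intro bd_smult) (auto simp: vge_def GL_O_bd gsimps GL_O_GL)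
    moreover have "bd (0 + 0) (inverse z \<cdot>\<^sub>m minv n k)"
      using zk kO by (intro bd_smult) (auto simp: vge_def val_inverse GL_O_bd gsimps GL_O_GL)
    ultimately show "y \<in> Gn \<and> bd (- 0) y \<and> bd (- 0) (minv n y)"
      using zk GL_O_GL[OF kO] by (simp add: minv_smult GL_smult)
  qed
  have qd: "space \<mu>ad = Gad n" "sets \<mu>ad = {S. S \<subseteq> Gad n \<and> \<Union>S \<in> sets \<mu>G}"
    "\<And>A. A \<in> sets \<mu>G \<Longrightarrow> emeasure \<mu>G A = (\<integral>\<^sup>+ c. (\<integral>\<^sup>+ z. indicator A (z \<cdot>\<^sub>m rep c) \<partial>\<mu>Z) \<partial>\<mu>ad)"
    using q by (auto simp: quotient_haar_def)
  have Zd: "space \<mu>Z = - {0}" "emeasure \<mu>Z {c. c \<noteq> 0 \<and> val c = 0} = 1"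
    "\<And>c A. c \<noteq> 0 \<Longrightarrow> A \<in> sets \<mu>Z \<Longrightarrow> emeasure \<mu>Z ((\<lambda>y. c * y) ` A) = emeasure \<mu>Z A"
    using muZ by (auto simp: haar_Fx_def)
  let ?u = "{c. c \<noteq> 0 \<and> val c = 0}"
  have us: "?u \<in> sets \<mu>Z" using Zd(2) emeasure_notin_sets[of ?u \<mu>Z] by force
  have "cl N g \<in> sets \<mu>ad \<and> emeasure \<mu>ad (cl N g) = emeasure \<mu>G A0" if g: "g \<in> Gn" for g
  proof
    have U: "\<Union>(cl N g) = (\<Union>z\<in>{z. z \<noteq> 0}. lcos (z \<cdot>\<^sub>m g) N)"
    proof (intro equalityI subsetI)
      fix y assume "y \<in> \<Union>(cl N g)"
      then obtain c where "c \<in> cl N g" "y \<in> c" by blast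
      then obtain z k where "z \<noteq> 0" "k \<in> Ks N" "y = z \<cdot>\<^sub>m (g * k)" using cl_eqD[OF N g] by blast
      moreover have "z \<cdot>\<^sub>m (g * k) = (z \<cdot>\<^sub>m g) * k" using g Ks_Mn[OF \<open>k \<in> Ks N\<close>] by (simp add: mring gsimps)
      ultimately show "y \<in> (\<Union>z\<in>{z. z \<noteq> 0}. lcos (z \<cdot>\<^sub>m g) N)" by (auto simp: lcos_def)
    next
      fix y assume "y \<in> (\<Union>z\<in>{z. z \<noteq> 0}. lcos (z \<cdot>\<^sub>m g) N)"
      then obtain z k where zk: "z \<noteq> 0" "k \<in> Ks N" "y = z \<cdot>\<^sub>m g * k" by (auto simp: lcos_def)
      then have "y = z \<cdot>\<^sub>m (g * k)" using g Ks_Mn[OF zk(2)] by (simp add: mring gsimps)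
      then have "y \<in> zcoset (g * k)" using zk by (auto simp: zcoset_def)
      then show "y \<in> \<Union>(cl N g)" using zk by (auto simp: cl_def lcos_def)
    qed
    have "openin (Mtop val n) (\<Union>(cl N g))" unfolding U
      by (rule openin_Union) (use open_lcos[OF GL_smult N] g in auto)
    moreover have "\<Union>(cl N g) \<subseteq> Gn" unfolding U using lcos_GL[OF GL_smult N] g by blast
    ultimately have "\<Union>(cl N g) \<in> sets \<mu>G" by (rule haar_G_open[OF mu])
    moreover have "cl N g \<subseteq> Gad n" using lcos_GL[OF g N] by (auto simp: cl_def Gad_def)
    ultimately show cs: "cl N g \<in> sets \<mu>ad" by (simp add: qd)
    let ?A = "(\<lambda>y. g * y) ` A0"
    have A_iff: "y \<in> ?A \<longleftrightarrow> (\<exists>z k. z \<noteq> 0 \<and> val z = 0 \<and> k \<in> Ks N \<and> y = z \<cdot>\<^sub>m (g * k))" for y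
    proof -
      have "g * (z \<cdot>\<^sub>m k) = z \<cdot>\<^sub>m (g * k)" if "k \<in> Ks N" for z k using Ks_Mn[OF that] g by (simp add: mring gsimps)
      then show ?thesis using A0_iff by (auto simp: image_iff) metis+
    qed
    have "?A = (\<Union>z\<in>{z. z \<noteq> 0 \<and> val z = 0}. lcos (z \<cdot>\<^sub>m g) N)"
    proof (intro equalityI subsetI)
      have eq: "z \<cdot>\<^sub>m (g * k) = (z \<cdot>\<^sub>m g) * k" if "k \<in> Ks N" for z k using Ks_Mn[OF that] g by (simp add: mring gsimps)
      show "y \<in> (\<Union>z\<in>{z. z \<noteq> 0 \<and> val z = 0}. lcos (z \<cdot>\<^sub>m g) N)" if y: "y \<in> ?A" for y
      proof -
        obtain z k where zk: "z \<noteq> 0" "val z = 0" "k \<in> Ks N" "y = z \<cdot>\<^sub>m (g * k)" using y A_iff by blast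
        then have "y \<in> lcos (z \<cdot>\<^sub>m g) N" by (auto simp: lcos_def eq)
        then show ?thesis using zk(1,2) by blast
      qed
      show "y \<in> ?A" if y: "y \<in> (\<Union>z\<in>{z. z \<noteq> 0 \<and> val z = 0}. lcos (z \<cdot>\<^sub>m g) N)" for y
      proof -
        obtain z k where zk: "z \<noteq> 0" "val z = 0" "k \<in> Ks N" "y = z \<cdot>\<^sub>m g * k" using y by (auto simp: lcos_def)
        then show ?thesis using A_iff eq[OF zk(3)] by metis
      qed
    qed
    note Aeq = this
    have "openin (Mtop val n) ?A" unfolding Aeq
      by (rule openin_Union) (use open_lcos[OF GL_smult N] g in auto)
    moreover have "?A \<subseteq> Gn" using A0G GL_mult[OF g] by auto
    ultimately have As: "?A \<in> sets \<mu>G" by (rule haar_G_open[OF mu])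
    have inner: "(\<integral>\<^sup>+ z. indicator ?A (z \<cdot>\<^sub>m rep c) \<partial>\<mu>Z) = indicator (cl N g) c" if c: "c \<in> space \<mu>ad" for c
    proof (cases "c \<in> cl N g")
      case True
      then obtain k where k: "k \<in> Ks N" "c = zcoset (g * k)" by (auto simp: cl_def lcos_def)
      obtain w where w: "w \<noteq> 0" "rep c = w \<cdot>\<^sub>m (g * k)" using rep_zcoset k(2) by blast
      have dk: "val (det l) = 0" "det l \<noteq> 0" if "l \<in> Ks N" for l
        using Ks_GL_O[OF N that] by (auto simp: GL_O_def GL_iff)
      have iff: "z \<cdot>\<^sub>m rep c \<in> ?A \<longleftrightarrow> z \<in> (\<lambda>y. inverse w * y) ` ?u" if z: "z \<noteq> 0" for z
      proof
        assume "z \<cdot>\<^sub>m rep c \<in> ?A"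
        then obtain t l where t: "t \<noteq> 0" "val t = 0" "l \<in> Ks N" "z \<cdot>\<^sub>m rep c = t \<cdot>\<^sub>m (g * l)" using A_iff by blast
        then have "(z * w) \<cdot>\<^sub>m (g * k) = t \<cdot>\<^sub>m (g * l)" by (simp add: w(2) smult_smult)
        \<comment> \<open>Elements of \<open>Ks N\<close> have determinants of valuation 0, so
          comparing determinants shows that \<open>z * w\<close> has valuation 0; it is here that
          \<open>n\<close> is positive.\<close>
        then have "det ((z * w) \<cdot>\<^sub>m (g * k)) = det (t \<cdot>\<^sub>m (g * l))" by simp
        then have "(z * w) ^ n * (det g * det k) = t ^ n * (det g * det l)"
          using g Ks_Mn[OF k(1)] Ks_Mn[OF t(3)] by (simp add: det_mult[of _ n] gsimps)
        then have "val ((z * w) ^ n * (det g * det k)) = val (t ^ n * (det g * det l))" by (rule arg_cong)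
        moreover have "det g \<noteq> 0" using g by (simp add: GL_iff)
        ultimately have "int n * val (z * w) = 0"
          using z w t dk[OF k(1)] dk[OF t(3)] by (simp add: val_mult val_power)
        then have "val (w * z) = 0" using n_pos by (simp add: mult.commute)
        then have "w * z \<in> ?u" using z w by simp
        moreover have "z = inverse w * (w * z)" using w by simp
        ultimately show "z \<in> (\<lambda>y. inverse w * y) ` ?u" by blast
      next
        assume "z \<in> (\<lambda>y. inverse w * y) ` ?u"
        then obtain y where y: "y \<noteq> 0" "val y = 0" "z = inverse w * y" by blast
        then have "z * w = y" using w(1) by simp
        then have "z \<cdot>\<^sub>m rep c = y \<cdot>\<^sub>m (g * k)" by (simp add: w(2) smult_smult)
        then show "z \<cdot>\<^sub>m rep c \<in> ?A" using A_iff y k by blast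
      qed
      have e1: "emeasure \<mu>Z ((\<lambda>y. inverse w * y) ` ?u) = 1" using Zd(2,3) w us by simp
      then have s1: "(\<lambda>y. inverse w * y) ` ?u \<in> sets \<mu>Z"
        using emeasure_notin_sets[of "(\<lambda>y. inverse w * y) ` ?u" \<mu>Z] by force
      have "(\<integral>\<^sup>+ z. indicator ?A (z \<cdot>\<^sub>m rep c) \<partial>\<mu>Z) = (\<integral>\<^sup>+ z. indicator ((\<lambda>y. inverse w * y) ` ?u) z \<partial>\<mu>Z)"
        by (rule nn_integral_cong) (use iff Zd(1) in \<open>auto simp: indicator_def\<close>)
      also have "\<dots> = 1" using s1 e1 by simp
      finally show ?thesis using True by simp
    next
      case False
      obtain h where h: "h \<in> Gn" "c = zcoset h" using c by (auto simp: qd Gad_def)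
      obtain w where w: "w \<noteq> 0" "rep c = w \<cdot>\<^sub>m h" using rep_zcoset h(2) by blast
      have "z \<cdot>\<^sub>m rep c \<notin> ?A" if z: "z \<noteq> 0" for z
      proof
        assume "z \<cdot>\<^sub>m rep c \<in> ?A"
        then obtain t l where t: "t \<noteq> 0" "l \<in> Ks N" "z \<cdot>\<^sub>m rep c = t \<cdot>\<^sub>m (g * l)" using A_iff by blast
        have "c = zcoset (z \<cdot>\<^sub>m rep c)" using z w h zcoset_eqI by metis
        also have "\<dots> = zcoset (g * l)" using t zcoset_eqI by simp
        finally show False using False t by (auto simp: cl_def lcos_def)
      qed
      then have "(\<integral>\<^sup>+ z. indicator ?A (z \<cdot>\<^sub>m rep c) \<partial>\<mu>Z) = (\<integral>\<^sup>+ z. 0 \<partial>\<mu>Z)"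
        by (intro nn_integral_cong) (use Zd(1) in \<open>auto simp: indicator_def\<close>)
      then show ?thesis using False by simp
    qed
    have "emeasure \<mu>G A0 = emeasure \<mu>G ?A" using haar_G_invariant[OF mu g A0s] by simp
    also have "\<dots> = (\<integral>\<^sup>+ c. indicator (cl N g) c \<partial>\<mu>ad)" unfolding qd(3)[OF As] by (rule nn_integral_cong[OF inner])
    also have "\<dots> = emeasure \<mu>ad (cl N g)" using cs by simp
    finally show "emeasure \<mu>ad (cl N g) = emeasure \<mu>G A0" by simp
  qed
  then show ?thesis using A0fin by blast
qed

definition cells :: "int \<Rightarrow> int \<Rightarrow> 'a mat set set set" where
  "cells N i = cl N ` G_le val n i"

text \<open>A representative that is a function of the cell; a matrix \<open>g\<close> is determined
  by its cell only up to scalars and \<open>Ks N\<close>.\<close>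

definition crep :: "int \<Rightarrow> 'a mat set set \<Rightarrow> 'a mat" where
  "crep N S = (SOME g. g \<in> Gn \<and> S = cl N g)"

lemma crep:
  assumes N: "N \<ge> 1" and g: "g \<in> Gn"
  shows "crep N (cl N g) \<in> Gn" "cl N (crep N (cl N g)) = cl N g"
    "\<exists>z k. z \<noteq> 0 \<and> k \<in> Ks N \<and> crep N (cl N g) = z \<cdot>\<^sub>m (g * k)"
proof -
  have "g \<in> Gn \<and> cl N g = cl N g" using g by simp
  then have *: "crep N (cl N g) \<in> Gn \<and> cl N g = cl N (crep N (cl N g))"
    unfolding crep_def by (rule someI)
  then show 1: "crep N (cl N g) \<in> Gn" "cl N (crep N (cl N g)) = cl N g" by auto
  have "zcoset (crep N (cl N g)) \<in> cl N g" using cl_self[OF 1(1), of N] 1(2) by simp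
  then show "\<exists>z k. z \<noteq> 0 \<and> k \<in> Ks N \<and> crep N (cl N g) = z \<cdot>\<^sub>m (g * k)"
    by (intro cl_eq(2)[OF N g 1(1) _ cl_self[OF 1(1)]])
qed

lemma finite_cells: "i \<ge> 0 \<Longrightarrow> N \<ge> 1 \<Longrightarrow> finite (cells N i)"
proof -
  assume i: "i \<ge> 0" and N: "N \<ge> 1"
  obtain S where S: "finite S" "S \<subseteq> G_le val n i" "\<forall>y\<in>G_le val n i. \<exists>g\<in>S. minv n g * y \<in> Ks N"
    using G_le_finite_cosets[OF i N] by (elim exE conjE)
  have "cells N i \<subseteq> cl N ` S"
  proof
    fix C assume "C \<in> cells N i"
    then obtain y where y: "y \<in> G_le val n i" "C = cl N y" by (auto simp: cells_def)
    obtain g where g: "g \<in> S" "minv n g * y \<in> Ks N" using S(3) y(1) by blast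
    have G: "g \<in> Gn" "y \<in> Gn" using g S(2) y by (auto simp: G_le_iff)
    have "cl N ((1::'a) \<cdot>\<^sub>m (g * (minv n g * y))) = cl N g" by (rule cl_absorb[OF N G(1) _ g(2)]) simp
    then have "C = cl N g" using y(2) G by (simp add: one_smult gsimps)
    then show "C \<in> cl N ` S" using g(1) by blast
  qed
  then show ?thesis using S(1) finite_surj by blast
qed

lemma avg_op_eq_sum:
  assumes i: "i \<ge> 0" and N: "N \<ge> 1" and x: "x \<in> Gn"
    and v: "v < \<infinity>" "\<And>g. g \<in> Gn \<Longrightarrow> cl N g \<in> sets \<mu>ad" "\<And>g. g \<in> Gn \<Longrightarrow> emeasure \<mu>ad (cl N g) = v"
    and inv: "\<And>g k. g \<in> G_le val n i \<Longrightarrow> k \<in> Ks N \<Longrightarrow> conj_val f x (g * k) = conj_val f x g"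
  shows "avg_op val n \<mu>ad i f x = enn2real v *\<^sub>R (\<Sum>S\<in>cells N i. conj_val f x (crep N S))"
proof -
  let ?F = "\<lambda>S. conj_val f x (crep N S)"
  have cG: "\<exists>g. g \<in> G_le val n i \<and> g \<in> Gn \<and> S = cl N g" if "S \<in> cells N i" for S
    using that by (auto simp: cells_def G_le_iff)
  have F: "conj_val f x (rep c) = ?F (cl N g)" if g: "g \<in> G_le val n i" and c: "c \<in> cl N g" for g c
  proof -
    have gG: "g \<in> Gn" using g by (simp add: G_le_iff)
    obtain k where k: "k \<in> Ks N" "c = zcoset (g * k)" using c by (auto simp: cl_def lcos_def)
    obtain z where z: "z \<noteq> 0" "rep c = z \<cdot>\<^sub>m (g * k)" using rep_zcoset k(2) by blast
    have "conj_val f x (rep c) = conj_val f x g"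
      unfolding z(2) using conj_val_smult[OF z(1) x GL_mult[OF gG Ks_GL[OF N k(1)]]] inv[OF g k(1)] by simp
    moreover obtain w l where w: "w \<noteq> 0" "l \<in> Ks N" "crep N (cl N g) = w \<cdot>\<^sub>m (g * l)" using crep(3)[OF N gG] by blast
    moreover have "?F (cl N g) = conj_val f x g"
      unfolding w(3) using conj_val_smult[OF w(1) x GL_mult[OF gG Ks_GL[OF N w(2)]]] inv[OF g w(2)] by simp
    ultimately show ?thesis by simp
  qed
  have union: "c \<in> Gad_le val n i \<longleftrightarrow> (\<exists>S\<in>cells N i. c \<in> S)" for c
  proof
    assume "c \<in> Gad_le val n i"
    then obtain g where g: "g \<in> G_le val n i" "c = zcoset g" by (auto simp: Gad_le_def)
    then have "c \<in> cl N g" using cl_self[of g N] by (simp add: G_le_iff)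
    then show "\<exists>S\<in>cells N i. c \<in> S" using g by (auto simp: cells_def)
  next
    assume "\<exists>S\<in>cells N i. c \<in> S"
    then obtain g k where g: "g \<in> G_le val n i" "k \<in> Ks N" "c = zcoset (g * k)" by (auto simp: cells_def cl_def lcos_def)
    then have "g * k \<in> G_le val n i" using G_le_right Ks_GL_O[OF N] by blast
    then show "c \<in> Gad_le val n i" using g by (auto simp: Gad_le_def)
  qed
  have fin: "finite (cells N i)" by (rule finite_cells[OF i N])
  have cs: "S \<in> sets \<mu>ad" "emeasure \<mu>ad S = v" if "S \<in> cells N i" for S using cG[OF that] v by auto
  have disj: "S = S'" if "S \<in> cells N i" "S' \<in> cells N i" "c \<in> S" "c \<in> S'" for S S' c
    using cG[OF that(1)] cG[OF that(2)] cl_eq(1)[OF N] that(3,4) by blast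
  have expand: "indicator (Gad_le val n i) c *\<^sub>R f (rep c * x * minv n (rep c)) = (\<Sum>S\<in>cells N i. indicator S c *\<^sub>R ?F S)" for c
  proof (cases "c \<in> Gad_le val n i")
    case True
    then obtain S where S: "S \<in> cells N i" "c \<in> S" using union by blast
    then obtain g where g: "g \<in> G_le val n i" "S = cl N g" using cG by blast
    have "(\<Sum>S\<in>cells N i. indicator S c *\<^sub>R ?F S) = (\<Sum>S'\<in>{S}. indicator S' c *\<^sub>R ?F S')"
      using fin S disj by (intro sum.mono_neutral_right) (auto simp: indicator_def)
    also have "\<dots> = ?F S" using S by simp
    also have "\<dots> = conj_val f x (rep c)" using F[OF g(1), of c] S(2) g(2) by simp
    finally show ?thesis using True by (simp add: conj_val_def)
  next
    case False
    then have "(\<Sum>S\<in>cells N i. indicator S c *\<^sub>R ?F S) = 0" using union by (intro sum.neutral) (auto simp: indicator_def)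
    then show ?thesis using False by simp
  qed
  have int: "integrable \<mu>ad (indicator S :: _ \<Rightarrow> real)" if "S \<in> cells N i" for S
    using cs[OF that] v(1) by (intro integrable_real_indicator) auto
  have "avg_op val n \<mu>ad i f x = (LINT c|\<mu>ad. (\<Sum>S\<in>cells N i. indicator S c *\<^sub>R ?F S))"
    unfolding avg_op_def set_lebesgue_integral_def by (simp add: expand)
  also have "\<dots> = (\<Sum>S\<in>cells N i. (LINT c|\<mu>ad. indicator S c *\<^sub>R ?F S))"
    using int by (intro Bochner_Integration.integral_sum integrable_scaleR_left) auto
  also have "\<dots> = (\<Sum>S\<in>cells N i. enn2real v *\<^sub>R ?F S)"
  proof (rule sum.cong[OF refl])
    fix S assume S: "S \<in> cells N i"
    have "(LINT c|\<mu>ad. indicator S c *\<^sub>R ?F S) = (LINT c|\<mu>ad. indicator S c) *\<^sub>R ?F S"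
      using int[OF S] by (intro integral_scaleR_left) auto
    also have "(LINT c|\<mu>ad. indicator S c) = measure \<mu>ad S" using sets.Int_space_eq2[OF cs(1)[OF S]] by simp
    also have "\<dots> = enn2real v" using cs(2)[OF S] by (simp add: measure_def)
    finally show "(LINT c|\<mu>ad. indicator S c *\<^sub>R ?F S) = enn2real v *\<^sub>R ?F S" .
  qed
  finally show ?thesis by (simp add: scaleR_sum_right)
qed

subsection \<open>Cancellation outside a fixed ball\<close>

text \<open>The two scales meet here: at \<open>s = 2 * c + 1\<close> the sets of radicals are
  invariant and the elements \<open>1 + t\<close> act, while the finer \<open>N\<close> serves to
  make the values well defined on cells and to discretise the integrals over radicals.\<close>

lemma shell_sum_zero:
  assumes mu: "haar_G val n \<mu>" and cusp: "cuspidal val n f" and fb: "supp_bound f b"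
    and x: "x \<in> Gn" "bd (- \<rho>) x" "\<rho> \<ge> 0" "Delta x \<noteq> 0" "val (Delta x) \<le> \<rho>"
    and c: "c = kap \<rho> + \<rho>" and s: "s = 2 * c + 1"
    and M: "M \<ge> 4 * b + (\<rho> + 2 * c) + kap (\<rho> + 2 * c) + 2 * c + s" "M \<ge> c + 1"
      "M \<ge> 2 * b + \<rho> + (2 * kap \<rho> + \<rho> + 1)"
    and i0: "i0 \<ge> int n * int n * M" and i: "i \<ge> 0" and N: "N \<ge> s"
    and inv: "\<And>g k. g \<in> G_le val n i \<Longrightarrow> k \<in> Ks N \<Longrightarrow> conj_val f x (g * k) = conj_val f x g"
  shows "(\<Sum>S\<in>cells N i - cells N i0. conj_val f x (crep N S)) = 0"
proof -
  define A where "A = cells N i - cells N i0"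
  define \<Phi> where "\<Phi> S = conj_val f x (crep N S)" for S
  define gs where "gs S = goodset x c M (crep N S)" for S
  \<comment> \<open>A choice that depends on the set \<open>gs S\<close> alone, so cells with equal
    sets receive the same radical.\<close>
  define pick where "pick S = (SOME R. R \<in> gs S)" for S
  have c0: "c \<ge> 0" using kap_ge[OF x(3)] x(3) by (simp add: c)
  have s1: "s \<ge> 1" and N1: "N \<ge> 1" and M0: "M \<ge> 0" using c0 s N M(2) by auto
  have KN: "k \<in> Ks (2 * c + 1)" if "k \<in> Ks N" for k using that Ks_mono[of s N] N s by auto
  have finA: "finite A" unfolding A_def using finite_cells[OF i N1] by simp
  have A_ex: "\<exists>g. g \<in> G_le val n i \<and> g \<in> Gn \<and> S = cl N g" if "S \<in> A" for S
    using that by (auto simp: A_def cells_def G_le_iff)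
  have \<Phi>_cl: "\<Phi> (cl N g) = conj_val f x g" if g: "g \<in> G_le val n i" for g
  proof -
    have gG: "g \<in> Gn" using g by (simp add: G_le_iff)
    obtain z k where zk: "z \<noteq> 0" "k \<in> Ks N" "crep N (cl N g) = z \<cdot>\<^sub>m (g * k)" using crep(3)[OF N1 gG] by blast
    show ?thesis unfolding \<Phi>_def zk(3)
      using conj_val_smult[OF zk(1) x(1) GL_mult[OF gG Ks_GL[OF N1 zk(2)]]] inv[OF g zk(2)] by simp
  qed
  have gs_cl: "gs (cl N g) = goodset x c M g" if gG: "g \<in> Gn" for g
  proof -
    obtain z k where zk: "z \<noteq> 0" "k \<in> Ks N" "crep N (cl N g) = z \<cdot>\<^sub>m (g * k)" using crep(3)[OF N1 gG] by blast
    show ?thesis unfolding gs_def zk(3)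
      using goodset_smult[OF zk(1) GL_mult[OF gG Ks_GL[OF N1 zk(2)]]] goodset_right_eq[OF x(1) c0 M0 KN[OF zk(2)] gG] by simp
  qed
  have out: "z \<cdot>\<^sub>m (g * \<kappa>) \<notin> G_le val n i0" if g: "g \<in> Gn" "cl N g \<notin> cells N i0" and \<kappa>: "\<kappa> \<in> GL_O val n" and z: "z \<noteq> 0" for g \<kappa> z
  proof
    assume "z \<cdot>\<^sub>m (g * \<kappa>) \<in> G_le val n i0"
    from G_le_right[OF this GL_O_minv[OF \<kappa>]] have "z \<cdot>\<^sub>m (g * One) \<in> G_le val n i0"
      using g(1) GL_O_GL[OF \<kappa>] by (simp add: mring massoc gsimps mcarr)
    then have "cl N (z \<cdot>\<^sub>m (g * One)) \<in> cells N i0" by (simp add: cells_def)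
    then show False using cl_absorb[OF N1 g(1) z Ks_One] g(2) by simp
  qed
  have zero: "\<Phi> S = 0" if S: "S \<in> A" "gs S = {}" for S
  proof (rule ccontr)
    assume nz: "\<Phi> S \<noteq> 0"
    obtain g where g: "g \<in> G_le val n i" "g \<in> Gn" "S = cl N g" using A_ex[OF S(1)] by blast
    have o: "z \<cdot>\<^sub>m g \<notin> G_le val n i0" if "z \<noteq> 0" for z
      using out[OF g(2) _ Ks_GL_O[OF N1 Ks_One] that] S(1) g by (simp add: A_def mring gsimps)
    have "conj_val f x g \<noteq> 0" using nz \<Phi>_cl[OF g(1)] g(3) by simp
    from goodset_nonempty[OF fb x _ M(3) i0 g(2) o this] M(2)[unfolded c]
    have "goodset x c M g \<noteq> {}" by (simp add: c)
    then show False using S(2) gs_cl[OF g(2)] g(3) by simp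
  qed
  define A' where "A' = {S \<in> A. gs S \<noteq> {}}"
  have pick: "pick S \<in> gs S" if "S \<in> A'" for S unfolding pick_def using that by (simp add: A'_def some_in_eq)
  have fin: "finite A'" using finA by (simp add: A'_def)
  have group: "(\<Sum>S\<in>{S \<in> A'. pick S = R}. \<Phi> S) = 0" if R: "R \<in> pick ` A'" for R
  proof -
    define B where "B = {S \<in> A'. pick S = R}"
    have finB: "finite B" using fin by (simp add: B_def)
    have RB: "R \<in> goodset x c M g" if "cl N g \<in> B" "g \<in> Gn" for g
      using that pick[of "cl N g"] gs_cl[of g] by (auto simp: B_def)
    obtain S0 where S0: "S0 \<in> A'" "R = pick S0" using R by blast
    have "R \<in> gs S0" using pick[OF S0(1)] S0(2) by simp
    then obtain j0 q where q: "q \<in> Gn" "R = (\<lambda>X. minv n q * X * q) ` Rad (Ej j0)"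
      unfolding gs_def goodset_def by blast
    define L where "L = {X \<in> R. bd s X}"
    have LM: "X \<in> Mn \<and> bd s X" if "X \<in> L" for X
      using that q Rad_Mn by (auto simp: L_def intro!: mcarr simp: gsimps)
    \<comment> \<open>The zero matrix keeps \<open>T\<close> nonempty, so that its cardinality can
      be cancelled at the end.\<close>
    have "minv n q * Zero * q = Zero" using q(1) by (simp add: msimps gsimps)
    then have "Zero \<in> R" unfolding q(2) using imageI[OF Rad_Zero[OF Ej_Mn[of j0]], of "\<lambda>X. minv n q * X * q"] by simp
    then have Z: "Zero \<in> L" by (simp add: L_def bd_Zero)
    obtain T where T: "finite T" "T \<subseteq> L" "\<And>X. X \<in> L \<Longrightarrow> \<exists>t\<in>T. bd N (X - t)"
      "\<And>t t'. t \<in> T \<Longrightarrow> t' \<in> T \<Longrightarrow> bd N (t - t') \<Longrightarrow> t = t'" using transversal[OF LM] by metis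
    have Tne: "card T \<noteq> 0" using T(3)[OF Z] T(1) by auto
    have u: "One + X \<in> Ks s" if "X \<in> L" for X
    proof -
      have "One + X - One = X" using LM[OF that] by (intro ent_eqI) (auto simp: msimps)
      then show ?thesis using LM[OF that] by (simp add: Ks_def mcarr)
    qed
    note uO = Ks_GL_O[OF s1 u] and uG = Ks_GL[OF s1 u]
    define act where "act t S = cl N (crep N S * (One + t))" for t S
    \<comment> \<open>Independence of the representative: \<open>1 + t\<close> lies in
      \<open>GL_O val n\<close>, which normalises \<open>Ks N\<close>.\<close>
    have act_cl: "act t (cl N g) = cl N (g * (One + t))" if g: "g \<in> Gn" and t: "t \<in> L" for g t
    proof -
      obtain z k where zk: "z \<noteq> 0" "k \<in> Ks N" "crep N (cl N g) = z \<cdot>\<^sub>m (g * k)" using crep(3)[OF N1 g] by blast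
      note kG = Ks_GL[OF N1 zk(2)]
      define k' where "k' = minv n (One + t) * k * (One + t)"
      have k': "k' \<in> Ks N" using Ks_conj_GL_O[OF GL_O_minv[OF uO[OF t]] zk(2)] uG[OF t] by (simp add: k'_def minv_minv)
      have "(z \<cdot>\<^sub>m (g * k)) * (One + t) = z \<cdot>\<^sub>m ((g * (One + t)) * k')"
      proof -
        define w where "w = One + t"
        have "w \<in> Gn" using uG[OF t] by (simp add: w_def)
        then have "(z \<cdot>\<^sub>m (g * k)) * w = z \<cdot>\<^sub>m ((g * w) * (minv n w * k * w))" using g kG by (simp add: massoc mring gsimps mcarr)
        then show ?thesis by (simp add: w_def k'_def)
      qed
      then show ?thesis unfolding act_def zk(3) using cl_absorb[OF N1 GL_mult[OF g uG[OF t]] zk(1) k'] by simp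
    qed
    have B_ex: "\<exists>g. g \<in> G_le val n i \<and> g \<in> Gn \<and> S = cl N g" if "S \<in> B" for S
      using that A_ex by (auto simp: B_def A'_def)
    have act_B: "act t S \<in> B" if S: "S \<in> B" and t: "t \<in> L" for t S
    proof -
      obtain g where g: "g \<in> G_le val n i" "g \<in> Gn" "S = cl N g" using B_ex[OF S] by blast
      have gt: "g * (One + t) \<in> G_le val n i" "g * (One + t) \<in> Gn"
        using G_le_right[OF g(1) uO[OF t]] GL_mult[OF g(2) uG[OF t]] by auto
      have SA: "S \<in> A" "gs S \<noteq> {}" "pick S = R" using S by (auto simp: B_def A'_def)
      \<comment> \<open>Both balls are stable under \<open>GL_O val n\<close> on the right, so the
        action cannot leave the shell through its inner boundary either.\<close>
      have "cl N (g * (One + t)) \<notin> cells N i0"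
      proof
        assume "cl N (g * (One + t)) \<in> cells N i0"
        then obtain h where h: "h \<in> G_le val n i0" "cl N (g * (One + t)) = cl N h" by (auto simp: cells_def)
        have hG: "h \<in> Gn" using h by (simp add: G_le_iff)
        have "zcoset h \<in> cl N (g * (One + t))" using cl_self[OF hG] h(2) by simp
        then obtain z k where zk: "z \<noteq> 0" "k \<in> Ks N" "h = z \<cdot>\<^sub>m (g * (One + t) * k)"
          using cl_eq(2)[OF N1 gt(2) hG _ cl_self[OF hG]] by blast
        have "(One + t) * k \<in> GL_O val n" by (rule GL_O_mult[OF uO[OF t] Ks_GL_O[OF N1 zk(2)]])
        from out[OF g(2) _ this zk(1)] have "z \<cdot>\<^sub>m (g * ((One + t) * k)) \<notin> G_le val n i0"
          using SA(1) g(3) by (simp add: A_def)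
        moreover have "g * ((One + t) * k) = g * (One + t) * k"
          using g(2) uG[OF t] Ks_GL[OF N1 zk(2)] by (simp add: massoc gsimps)
        ultimately show False using h(1) zk(3) by simp
      qed
      then have "act t S \<in> A" using gt by (simp add: g(3) act_cl[OF g(2) t] A_def cells_def)
      moreover have geq: "gs (act t S) = gs S"
        using goodset_right_eq[OF x(1) c0 M0 u[OF t, unfolded s] g(2)] gs_cl[OF gt(2)] gs_cl[OF g(2)]
        by (simp add: g(3) act_cl[OF g(2) t])
      moreover have "pick (act t S) = pick S" by (simp add: pick_def geq)
      ultimately show ?thesis using SA by (simp add: B_def A'_def)
    qed
    have act_inj: "inj_on (act t) B" if t: "t \<in> L" for t
    proof (rule inj_onI)
      fix S S' assume S: "S \<in> B" "S' \<in> B" "act t S = act t S'"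
      obtain g where g: "g \<in> Gn" "S = cl N g" using B_ex[OF S(1)] by blast
      obtain h where h: "h \<in> Gn" "S' = cl N h" using B_ex[OF S(2)] by blast
      note gt = GL_mult[OF g(1) uG[OF t]] and ht = GL_mult[OF h(1) uG[OF t]]
      have "zcoset (h * (One + t)) \<in> cl N (g * (One + t))"
        using cl_self[OF ht, of N] S(3) by (simp add: g(2) h(2) act_cl[OF g(1) t] act_cl[OF h(1) t])
      then obtain z k where zk: "z \<noteq> 0" "k \<in> Ks N" "h * (One + t) = z \<cdot>\<^sub>m (g * (One + t) * k)"
        using cl_eq(2)[OF N1 gt ht _ cl_self[OF ht]] by blast
      define w where "w = One + t"
      have w: "w \<in> Gn" "h * w = z \<cdot>\<^sub>m (g * w * k)" using uG[OF t] zk(3) by (auto simp: w_def)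
      note kG = Ks_GL[OF N1 zk(2)]
      have "h = h * w * minv n w" using h(1) w(1) by (simp add: massoc gsimps mring)
      also have "\<dots> = z \<cdot>\<^sub>m (g * (w * k * minv n w))" unfolding w(2) using g(1) w(1) kG by (simp add: massoc mring gsimps mcarr)
      finally have "h = z \<cdot>\<^sub>m (g * (w * k * minv n w))" .
      moreover have "w * k * minv n w \<in> Ks N" unfolding w_def by (rule Ks_conj_GL_O[OF uO[OF t] zk(2)])
      ultimately show "S = S'" using cl_absorb[OF N1 g(1) zk(1)] g(2) h(2) by metis
    qed
    have perm: "(\<Sum>S\<in>B. \<Phi> (act t S)) = (\<Sum>S\<in>B. \<Phi> S)" if t: "t \<in> L" for t
    proof -
      have "act t ` B \<subseteq> B" using act_B t by blast
      then have "act t ` B = B" by (rule endo_inj_surj[OF finB _ act_inj[OF t]])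
      then show ?thesis using sum.reindex[OF act_inj[OF t], of \<Phi>] by simp
    qed
    have orbit: "(\<Sum>t\<in>T. \<Phi> (act t S)) = 0" if S: "S \<in> B" for S
    proof -
      obtain g where g: "g \<in> G_le val n i" "g \<in> Gn" "S = cl N g" using B_ex[OF S] by blast
      have gX: "g * (One + X) \<in> G_le val n i" if "X \<in> L" for X by (rule G_le_right[OF g(1) uO[OF that]])
      have "R \<in> goodset x c M g" using RB S g by simp
      then obtain j k1 a k3 where h: "0 < j" "j < n" "k1 \<in> GL_O val n" "contracting a (Ej j) M"
        "k3 \<in> Gn" "bd (- c) k3" "bd (- c) (minv n k3)" "k3 * x * minv n k3 \<in> Par (Ej j)"
        "g = k1 * a * k3" "R = (\<lambda>X. minv n k3 * X * k3) ` Rad (Ej j)" unfolding goodset_def by blast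
      have L': "L = {X \<in> (\<lambda>X. minv n k3 * X * k3) ` Rad (Ej j). bd s X}" unfolding L_def h(10) ..
      have inv': "conj_val f x (g * (One + Y)) = conj_val f x (g * (One + X))"
        if X: "X \<in> L" and Y: "Y \<in> L" and XY: "bd N (Y - X)" for X Y
      proof -
        define k where "k = minv n (One + X) * (One + Y)"
        have "(One + Y) - (One + X) = Y - X" using LM[OF X] LM[OF Y] by (intro ent_eqI) (auto simp: msimps)
        then have "bd (N + 0) ((One + Y) - (One + X))" using XY by simp
        moreover have "bd (- 0) (minv n (One + X))" using GL_O_bd[OF GL_O_minv[OF uO[OF X]]] by simp
        ultimately have k: "k \<in> Ks N" unfolding k_def
          using Ks_left_diff[OF GL_Mn[OF uG[OF Y]] uG[OF X]] by blast
        have "(One + X) * k = One + Y" unfolding k_def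
          by (rule minv_cancel(3)[OF uG[OF X] GL_Mn[OF uG[OF Y]]])
        then have "g * (One + X) * k = g * (One + Y)"
          using massoc[OF GL_Mn[OF g(2)] GL_Mn[OF uG[OF X]] Ks_Mn[OF k]] by simp
        then show ?thesis using inv[OF gX[OF X] k] by simp
      qed
      have "(\<Sum>t\<in>T. conj_val f x (g * (One + t))) = 0"
        by (rule orbit_sum_zero[OF mu cusp fb x h(1-4) h(5-7) c0 h(8) M(1) h(9) L' T N inv'])
      moreover have "\<Phi> (act t S) = conj_val f x (g * (One + t))" if "t \<in> T" for t
        using T(2) that \<Phi>_cl[OF gX] act_cl[OF g(2)] by (auto simp: g(3))
      ultimately show ?thesis by simp
    qed
    \<comment> \<open>The transversal \<open>T\<close> need not be a group: each
      \<open>act t\<close> permutes \<open>B\<close> by itself, and after exchanging the sums each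
      inner sum vanishes by \<open>orbit\<close>. Cancelling the cardinality uses that the values
      are complex numbers.\<close>
    have "of_nat (card T) * (\<Sum>S\<in>B. \<Phi> S) = (\<Sum>t\<in>T. \<Sum>S\<in>B. \<Phi> S)" by simp
    also have "\<dots> = (\<Sum>t\<in>T. \<Sum>S\<in>B. \<Phi> (act t S))" by (rule sum.cong[OF refl]) (use perm T(2) in auto)
    also have "\<dots> = (\<Sum>S\<in>B. \<Sum>t\<in>T. \<Phi> (act t S))" by (rule sum.swap)
    also have "\<dots> = 0" using orbit by simp
    finally show ?thesis using Tne by (simp add: B_def)
  qed
  have "(\<Sum>S\<in>A. \<Phi> S) = (\<Sum>S\<in>A'. \<Phi> S)"
    by (rule sum.mono_neutral_right[OF finA]) (use zero in \<open>auto simp: A'_def\<close>)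
  also have "\<dots> = (\<Sum>R\<in>pick ` A'. \<Sum>S\<in>{S \<in> A'. pick S = R}. \<Phi> S)"
    by (rule sum.image_gen[OF fin])
  also have "\<dots> = 0" using group by simp
  finally show ?thesis by (simp add: A_def \<Phi>_def)
qed

text \<open>The precision \<open>N\<close> is chosen after \<open>i\<close> and is as fine as the
  larger ball requires; none of the bounds on \<open>i0\<close> involve it.\<close>

lemma avg_op_stable:
  assumes mu: "haar_G val n \<mu>G" and muZ: "haar_Fx val \<mu>Z" and q: "quotient_haar val n \<mu>G \<mu>Z \<mu>ad"
    and sm: "smooth_fun val n f" and cusp: "cuspidal val n f" and fb: "supp_bound f b"
    and x: "x \<in> Gn" "bd (- \<rho>) x" "\<rho> \<ge> 0" "Delta x \<noteq> 0" "val (Delta x) \<le> \<rho>"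
    and c: "c = kap \<rho> + \<rho>"
    and M: "M \<ge> 4 * b + (\<rho> + 2 * c) + kap (\<rho> + 2 * c) + 2 * c + (2 * c + 1)" "M \<ge> c + 1"
      "M \<ge> 2 * b + \<rho> + (2 * kap \<rho> + \<rho> + 1)"
    and i0: "i0 \<ge> int n * int n * M" and i: "i \<ge> i0"
  shows "avg_op val n \<mu>ad i f x = avg_op val n \<mu>ad i0 f x"
proof -
  have c0: "c \<ge> 0" using kap_ge[OF x(3)] x(3) by (simp add: c)
  have "int n * int n * M \<ge> 0" using c0 M(2) by (intro mult_nonneg_nonneg) auto
  then have i0': "i0 \<ge> 0" and i': "i \<ge> 0" using i0 i by auto
  obtain N0 where N0: "\<forall>g\<in>G_le val n i. \<forall>k\<in>Ks N0. k \<in> GL_O val n \<longrightarrow> conj_val f x (g * k) = conj_val f x g"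
    using conj_val_uniform[OF sm x(1) i'] by blast
  define N where "N = max N0 (2 * c + 1)"
  have N: "N \<ge> 2 * c + 1" "N \<ge> 1" using c0 by (auto simp: N_def)
  have inv: "conj_val f x (g * k) = conj_val f x g" if g: "g \<in> G_le val n i" and k: "k \<in> Ks N" for g k
  proof -
    have "k \<in> Ks N0" using k Ks_mono[of N0 N] by (auto simp: N_def)
    then show ?thesis using N0 g Ks_GL_O[OF N(2) k] by blast
  qed
  have sub: "G_le val n i0 \<subseteq> G_le val n i"
  proof
    fix g assume "g \<in> G_le val n i0"
    then have g: "g \<in> Gn" "bd (- i0) g" "val (det g) \<le> i0" by (auto simp: G_le_iff)
    have "bd (- i) g" by (rule bd_mono[OF g(2)]) (use i in simp)
    then show "g \<in> G_le val n i" using g i by (simp add: G_le_iff)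
  qed
  obtain v where v: "v < \<infinity>" "\<forall>g\<in>Gn. cl N g \<in> sets \<mu>ad \<and> emeasure \<mu>ad (cl N g) = v"
    using cl_measure[OF mu muZ q N(2)] by blast
  let ?\<Phi> = "\<lambda>S. conj_val f x (crep N S)"
  have e1: "avg_op val n \<mu>ad i f x = enn2real v *\<^sub>R (\<Sum>S\<in>cells N i. ?\<Phi> S)"
    by (rule avg_op_eq_sum[OF i' N(2) x(1) v(1)]) (use v(2) inv in auto)
  have e0: "avg_op val n \<mu>ad i0 f x = enn2real v *\<^sub>R (\<Sum>S\<in>cells N i0. ?\<Phi> S)"
    by (rule avg_op_eq_sum[OF i0' N(2) x(1) v(1)]) (use v(2) inv sub in auto)
  have "cells N i0 \<subseteq> cells N i" using sub by (auto simp: cells_def)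
  then have "(\<Sum>S\<in>cells N i. ?\<Phi> S) = (\<Sum>S\<in>cells N i - cells N i0. ?\<Phi> S) + (\<Sum>S\<in>cells N i0. ?\<Phi> S)"
    using sum.subset_diff finite_cells[OF i' N(2)] by blast
  moreover have "(\<Sum>S\<in>cells N i - cells N i0. ?\<Phi> S) = 0"
    by (rule shell_sum_zero[OF mu cusp fb x c refl M i0 i' N(1) inv])
  ultimately show ?thesis by (simp add: e1 e0)
qed

end

section \<open>The polynomial bound\<close>

theorem theoremC:
  fixes val :: "'a::field \<Rightarrow> int" and n :: nat
    and \<mu>G :: "'a mat measure" and \<mu>Z :: "'a measure" and \<mu>ad :: "'a mat set measure"
    and m :: "'a mat \<Rightarrow> complex"
  assumes "nonarch_local_field val"
    and "n \<ge> 1"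
    and "haar_G val n \<mu>G"
    and "haar_Fx val \<mu>Z"
    and "quotient_haar val n \<mu>G \<mu>Z \<mu>ad"
    and "smooth_fun val n m"
    and "cuspidal val n m"
    and "compact_supp_mod_center val n m"
  shows "\<exists>\<beta> :: nat poly. \<forall>x \<in> G_rss n.
           \<forall>i :: int. i > int (poly \<beta> (nat (ov_rss val n x))) \<longrightarrow>
             avg_op val n \<mu>ad i m x = avg_op val n \<mu>ad (int (poly \<beta> (nat (ov_rss val n x)))) m x"
proof -
  interpret gl val n by unfold_locales (use assms in auto)
  obtain b where b: "supp_bound m b" "b \<ge> 0"
    using supp_bound_exists[OF assms(8)] by (auto simp: supp_bound_def)
  define q where "q = 7 * int n * int n"
  \<comment> \<open>With \<open>kap t = q * t\<close> and \<open>c = (q + 1) * \<rho>\<close> all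
    three lower bounds on \<open>M\<close> are affine in \<open>\<rho>\<close>; \<open>K\<close>
    dominates each coefficient of \<open>\<rho>\<close> and \<open>6 * b + 3\<close> each constant
    term.\<close>
  define K where "K = 3 + 7 * (q + 1) + q * (3 + 2 * (q + 1))"
  have q0: "q \<ge> 0" by (simp add: q_def)
  have K0: "K \<ge> 0" using q0 by (simp add: K_def)
  \<comment> \<open>The affine function \<open>n^2 M\<close> of \<open>r\<close>, with
    \<open>\<rho> = r + 1\<close>; the factor \<open>n^2\<close> is the threshold of
    \<open>cartan_gap\<close>.\<close>
  define \<beta> where "\<beta> = [:n * n * nat (6 * b + 3 + K), n * n * nat K:]"
  have \<beta>: "int (poly \<beta> r) = int n * int n * (6 * b + 3 + K * (int r + 1))" for r
    using b(2) K0 by (simp add: \<beta>_def algebra_simps)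
  show ?thesis
  proof (intro exI[of _ \<beta>] ballI allI impI)
    fix x i assume "x \<in> G_rss n" and i: "i > int (poly \<beta> (nat (ov_rss val n x)))"
    then have x: "x \<in> Gn" "Delta x \<noteq> 0" by (auto simp: G_rss_def)
    \<comment> \<open>\<open>nat\<close> cuts negative values of \<open>ov_rss\<close> off at 0, so
      this is a nonnegative bound for both \<open>ov_G\<close> and the valuation of the discriminant
      in every case.\<close>
    define \<rho> where "\<rho> = int (nat (ov_rss val n x)) + 1"
    have \<rho>: "\<rho> \<ge> 0" "ov_G val n x \<le> \<rho>" "val (Delta x) \<le> \<rho>" by (auto simp: \<rho>_def ov_rss_def)
    have "x \<in> G_le val n \<rho>" using x \<rho> by (simp add: G_le_def)
    then have bx: "bd (- \<rho>) x" by (simp add: G_le_iff)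
    define c where "c = kap \<rho> + \<rho>"
    define M where "M = 6 * b + 3 + K * \<rho>"
    have kq: "kap t = q * t" for t by (simp add: kap_def q_def)
    have p: "\<rho> * q \<ge> 0" "q * \<rho> \<ge> 0" "q * (q * \<rho>) \<ge> 0" using q0 \<rho>(1) by auto
    have Mv: "M = 6 * b + 3 + 10 * \<rho> + 12 * (q * \<rho>) + 2 * (q * (q * \<rho>))" by (simp add: M_def K_def algebra_simps)
    show "avg_op val n \<mu>ad i m x = avg_op val n \<mu>ad (int (poly \<beta> (nat (ov_rss val n x)))) m x"
    proof (rule avg_op_stable[OF assms(3-7) b(1) x(1) bx \<rho>(1) x(2) \<rho>(3) c_def, where M = M])
      show "M \<ge> 4 * b + (\<rho> + 2 * c) + kap (\<rho> + 2 * c) + 2 * c + (2 * c + 1)"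
        using p b(2) \<rho>(1) by (simp add: Mv c_def kq algebra_simps)
      show "M \<ge> c + 1" using p b(2) \<rho>(1) by (simp add: Mv c_def kq)
      show "M \<ge> 2 * b + \<rho> + (2 * kap \<rho> + \<rho> + 1)" using p b(2) \<rho>(1) by (simp add: Mv kq)
      show "int n * int n * M \<le> int (poly \<beta> (nat (ov_rss val n x)))"
        by (simp add: \<beta> M_def \<rho>_def)
      show "int (poly \<beta> (nat (ov_rss val n x))) \<le> i" using i by simp
    qed
  qed
qed

end
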